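(* Let $\alpha>0$ and let $h$ be as in the context. The following are equivalent: (i) there exists a function $u_*\in D(m)$ such that, with $\gamma(t)=(1+t)^{1/\alpha}$ and $c_*(t,x)=\gamma(t)^2u_*(\gamma(t)x)$, we have $c_*(t,\cdot)\in D(m)$ for all $t\ge0$, $c_*$ is a solution of the fragmentation equation with initial condition $u_*$ (i.e. $c_*$ is a self-similar solution), and every solution $c$ of the fragmentation equation with initial condition $c_0\in D(m)$ satisfies $$\lim_{t\to\infty}\int_0^\infty |c(t,x)-c_*(t,x)|\,x\,dx=0;$$ (ii) $\displaystyle\int_0^1 \log z\, h(z)\,z\,dz>-\infty.$
   Context: Fix $\alpha>0$ and a Borel function $h\colon(0,1)\to[0,\infty)$ with $\int_0^1 h(r)\,r\,dr=1$. Let $m(dx)=x\,dx$ on $(0,\infty)$, $L^1=L^1((0,\infty),m)$ with norm $\|f\|=\int_0^\infty|f(x)|x\,dx$, and $D(m)=\{f\in L^1: f\ge0,\ \|f\|=1\}$. The fragmentation equation is $$\partial_t c(t,x)=\int_x^\infty \frac1y h\Big(\frac xy\Big) y^\alpha c(t,y)\,dy-x^\alpha c(t,x),\quad t,x>0,\qquad c(0,x)=c_0(x).$$ For $c_0\in D(m)$, "the solution" $c$ means the mass-conserving solution with $c(t,\cdot)\in D(m)$ given by the stochastic semigroup on $L^1$; equivalently, $c(t,\cdot)$ is the density with respect to $m$ of $Y(t)$, where $\{Y(t)\}$ is the pure jump Markov process on $(0,\infty)$ which, in state $x$, waits an exponential time with mean $x^{-\alpha}$ and then jumps to $\theta x$,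 with $\theta\in(0,1)$ independent having distribution $P(\theta\le r)=\int_0^r h(z)z\,dz$, and $Y(0)$ has density $c_0$ with respect to $m$. *)

theory Defs
  imports "HOL-Probability.Probability"
begin

definition mm :: "real measure" where
  "mm = density lborel (\<lambda>x. ennreal x * indicator {0<..} x)"

definition Dm :: "(real \<Rightarrow> real) set" where
  "Dm = {f. f \<in> borel_measurable borel \<and> integrable mm f \<and>
            (AE x in mm. 0 \<le> f x) \<and> (\<integral>x. \<bar>f x\<bar> \<partial>mm) = 1}"

definition theta_law :: "(real \<Rightarrow> real) \<Rightarrow> real measure" where
  "theta_law h = density lborel (\<lambda>z. ennreal (h z * z) * indicator {0<..<1} z)"

definition hold_law :: "real measure" where
  "hold_law = density lborel (exponential_density 1)"

text \<open>Underlying probability space: initial state Y(0) with density c0 w.r.t. m,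
  and an i.i.d. sequence of pairs (theta_n, E_n), theta_n ~ theta_law, E_n ~ Exp(1).\<close>
definition jump_space :: "(real \<Rightarrow> real) \<Rightarrow> (real \<Rightarrow> real) \<Rightarrow> (real \<times> (nat \<Rightarrow> real \<times> real)) measure" where
  "jump_space h c0 = density mm (\<lambda>x. ennreal (c0 x)) \<Otimes>\<^sub>M (\<Pi>\<^sub>M n\<in>UNIV. theta_law h \<Otimes>\<^sub>M hold_law)"

definition jchain :: "real \<times> (nat \<Rightarrow> real \<times> real) \<Rightarrow> nat \<Rightarrow> real" where
  "jchain \<omega> n = fst \<omega> * (\<Prod>i<n. fst (snd \<omega> i))"

text \<open>Holding time in state X_n: exponential with mean X_n^(-alpha), realised as E_n / X_n^alpha.\<close>
definition htime :: "real \<Rightarrow> real \<times> (nat \<Rightarrow> real \<times> real) \<Rightarrow> nat \<Rightarrow> real" where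
  "htime \<alpha> \<omega> n = snd (snd \<omega> n) / (jchain \<omega> n) powr \<alpha>"

definition jtime :: "real \<Rightarrow> real \<times> (nat \<Rightarrow> real \<times> real) \<Rightarrow> nat \<Rightarrow> real" where
  "jtime \<alpha> \<omega> n = (\<Sum>i<n. htime \<alpha> \<omega> i)"

text \<open>The pure jump process Y(t) = X_n for S_n \<le> t < S_(n+1) (defined 0 on the null event of explosion).\<close>
definition Yproc :: "real \<Rightarrow> real \<times> (nat \<Rightarrow> real \<times> real) \<Rightarrow> real \<Rightarrow> real" where
  "Yproc \<alpha> \<omega> t = (if \<exists>n. t < jtime \<alpha> \<omega> (Suc n)
                    then jchain \<omega> (LEAST n. t < jtime \<alpha> \<omega> (Suc n)) else 0)"

text \<open>c is the (mass-conserving) solution of the fragmentation equation with initial datum c0: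
  for every t \<ge> 0, c(t,.) \<in> D(m) and c(t,.) is the density w.r.t. m of the law of Y(t).\<close>
definition frag_solution :: "real \<Rightarrow> (real \<Rightarrow> real) \<Rightarrow> (real \<Rightarrow> real) \<Rightarrow> (real \<Rightarrow> real \<Rightarrow> real) \<Rightarrow> bool" where
  "frag_solution \<alpha> h c0 c \<longleftrightarrow>
     (\<forall>t\<ge>0. c t \<in> Dm \<and>
        distr (jump_space h c0) borel (\<lambda>\<omega>. Yproc \<alpha> \<omega> t) = density mm (\<lambda>x. ennreal (c t x)))"

end

theory Submission
  imports Defs
begin

text \<open>
  Let \<open>I = E + \<theta>\<^sup>\<alpha> I'\<close> (in law) be the perpetuity built from an exponential variable \<open>E\<close> and the fragmentation ratio
  \<open>\<theta>\<close>, and \<open>\<phi>\<close> its density. The only candidate for the profile is \<open>u(x) = const \<cdot> \<phi>(x\<^sup>\<alpha>) / x\<^sup>2\<close>. Its total mass is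
  finite because \<open>E[1/I] = E[ln I - ln (\<theta>\<^sup>\<alpha> I')] \<le> \<alpha> E[- ln \<theta>]\<close>, where truncated logarithms make up for the possible
  non-integrability of \<open>ln I\<close>. The functions \<open>\<phi>((1 + t) x\<^sup>\<alpha>) / x\<^sup>2\<close> satisfy the Duhamel equation of the process, so they
  dominate its minimal solution, which is the law of \<open>Y(t)\<close>; having the same mass, the two agree.

  For the convergence, rescale so that \<open>u\<close> becomes invariant. Densities bounded by \<open>C u\<close> stay bounded by \<open>C u\<close>, hence
  remain tight, and on compact sets the process has a common minorant since \<open>\<theta>\<close> has a density: iterated
  convolutions of a set of positive measure dominate Lebesgue measure on arbitrarily long intervals. Two such
  densities of equal mass at least \<open>\<delta>\<close> therefore overlap after one step by some \<open>\<eta>(\<delta>, C) > 0\<close>; removing the overlap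
  and iterating brings the mass below \<open>\<delta>\<close> after finitely many steps. General initial data are approximated by
  \<open>min(c\<^sub>0, C u)\<close>.

  Conversely, if a self-similar solution \<open>u\<close> exists, then truncated logarithms \<open>g\<close> satisfy
  \<open>E g(Y(0)) - E g(Y(1)) \<le> ln 2 / \<alpha>\<close>, whereas the first jump alone contributes at least
  \<open>E[(1 - exp (- Y(0)\<^sup>\<alpha>)) (g(Y(0)) - g(\<theta> Y(0)))]\<close>; removing the truncation bounds \<open>E[- ln \<theta>]\<close>.
\<close>

subsection \<open>Measure-theoretic preliminaries\<close>

abbreviation borel_measurable2 :: "(real \<Rightarrow> real \<Rightarrow> ennreal) \<Rightarrow> bool" where
  "borel_measurable2 H \<equiv> case_prod H \<in> borel_measurable (borel \<Otimes>\<^sub>M borel)"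

lemma borel_measurable2_compose:
  assumes "borel_measurable2 H" "f \<in> borel_measurable M" "g \<in> borel_measurable M"
  shows "(\<lambda>x. H (f x) (g x)) \<in> borel_measurable M"
  using measurable_compose[OF measurable_Pair[OF assms(2,3)] assms(1)] by simp

lemma borel_measurable_indicator_Ioc [measurable (raw)]:
  fixes a b f :: "'a \<Rightarrow> real"
  assumes [measurable]: "a \<in> borel_measurable M" "b \<in> borel_measurable M" "f \<in> borel_measurable M"
  shows "(\<lambda>x. indicator {a x<..b x} (f x) :: ennreal) \<in> borel_measurable M"
  unfolding indicator_def greaterThanAtMost_iff by measurable

lemma nn_integral_le_of_AE_LIMSEQ:
  fixes f :: "nat \<Rightarrow> 'a \<Rightarrow> ennreal"
  assumes "\<And>n. f n \<in> borel_measurable M" "\<And>n. (\<integral>\<^sup>+x. f n x \<partial>M) \<le> C"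
    and "AE x in M. (\<lambda>n. f n x) \<longlonglongrightarrow> g x"
  shows "(\<integral>\<^sup>+x. g x \<partial>M) \<le> C"
proof -
  have "(\<integral>\<^sup>+x. g x \<partial>M) = (\<integral>\<^sup>+x. liminf (\<lambda>n. f n x) \<partial>M)"
    using assms(3) by (intro nn_integral_cong_AE) (auto elim!: eventually_mono simp: lim_imp_Liminf)
  also have "\<dots> \<le> liminf (\<lambda>n. \<integral>\<^sup>+x. f n x \<partial>M)" by (rule nn_integral_liminf) (rule assms)
  also have "\<dots> \<le> liminf (\<lambda>n. C)" by (rule Liminf_mono) (simp add: assms)
  also have "\<dots> = C" by (simp add: Liminf_const)
  finally show ?thesis .
qed

lemma nn_integral_mult_le_of_le_1:
  "(\<And>x. F x \<le> (1::ennreal)) \<Longrightarrow> (\<integral>\<^sup>+x. f x * F x \<partial>M) \<le> (\<integral>\<^sup>+x. f x \<partial>M)"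
  by (intro nn_integral_mono) (simp add: mult_left_le)

lemma nn_integral_diff_add:
  fixes f g F :: "'a \<Rightarrow> ennreal"
  assumes [measurable]: "f \<in> borel_measurable M" "g \<in> borel_measurable M" "F \<in> borel_measurable M"
    and le: "AE x in M. f x \<le> g x"
  shows "(\<integral>\<^sup>+x. g x * F x \<partial>M) = (\<integral>\<^sup>+x. (g x - f x) * F x \<partial>M) + (\<integral>\<^sup>+x. f x * F x \<partial>M)"
proof -
  have "(\<integral>\<^sup>+x. g x * F x \<partial>M) = (\<integral>\<^sup>+x. (g x - f x) * F x + f x * F x \<partial>M)"
    using le by (intro nn_integral_cong_AE)
      (auto elim!: eventually_mono simp: diff_add_cancel_ennreal simp flip: distrib_right)
  then show ?thesis by (simp add: nn_integral_add)
qed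

lemma measure_eqI_le:
  assumes sets: "sets M = sets N" and total: "emeasure M (space M) = emeasure N (space N)"
    and fin: "emeasure N (space N) \<noteq> \<infinity>"
    and le: "\<And>B. B \<in> sets M \<Longrightarrow> emeasure M B \<le> emeasure N B"
  shows "M = N"
proof (rule measure_eqI[OF sets], rule antisym)
  fix B assume B: "B \<in> sets M"
  let ?C = "space M - B"
  have C: "?C \<in> sets M" using B by auto
  have "space M = space N" using sets by (rule sets_eq_imp_space_eq)
  then have "emeasure N ?C + emeasure N B = emeasure N (space N)"
    using B C sets sets.sets_into_space[OF B] by (subst plus_emeasure) (auto simp: Un_absorb2)
  also have "\<dots> = emeasure M ?C + emeasure M B"
    unfolding total[symmetric] using B C sets.sets_into_space[OF B]
    by (subst plus_emeasure) (auto simp: Un_absorb2)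
  also have "\<dots> \<le> emeasure N ?C + emeasure M B" using le[OF C] by (rule add_right_mono)
  finally have "emeasure N ?C + emeasure N B \<le> emeasure N ?C + emeasure M B" .
  moreover have "emeasure N ?C \<noteq> \<infinity>"
    using fin emeasure_space[of N ?C] by (auto simp: top_unique)
  ultimately show "emeasure N B \<le> emeasure M B" by (simp add: ennreal_add_left_cancel_le)
qed (rule le)

lemma exists_Icc_compl_le:
  fixes M :: "real measure"
  assumes "finite_measure M" and sets: "sets M = sets borel" and pos: "AE x in M. 0 < x" and e: "0 < e"
  obtains a b where "0 < a" "a \<le> b" "emeasure M (- {a..b}) \<le> ennreal e"
proof -
  interpret finite_measure M by fact
  define I where "I n = {1 / real (Suc n)..real (Suc n)}" for n
  have inc: "I m \<subseteq> I n" if "m \<le> n" for m n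
    using frac_le[of 1 1 "real (Suc m)" "real (Suc n)"] that by (auto simp: I_def)
  have "(\<Inter>n. - I n) \<subseteq> {..0}"
  proof (rule subsetI, rule ccontr)
    fix x assume x: "x \<in> (\<Inter>n. - I n)" "x \<notin> {..0}"
    then obtain m where m: "inverse (real (Suc m)) < x" using reals_Archimedean[of x] by auto
    obtain n where n: "x \<le> real n" using real_arch_simple by blast
    have "x \<in> I (max m n)"
      using m n frac_le[of 1 1 "real (Suc m)" "real (Suc (max m n))"] by (auto simp: I_def inverse_eq_divide)
    then show False using x(1) by blast
  qed
  moreover have "emeasure M {..0} = 0"
    using pos sets sets_eq_imp_space_eq[OF sets]
    by (subst (asm) AE_iff_measurable[OF _ refl]) (auto simp: not_less atMost_def)
  ultimately have "emeasure M (\<Inter>n. - I n) = 0" using sets by (auto intro: emeasure_eq_0[of "{..0}"])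
  moreover have "(\<lambda>n. emeasure M (- I n)) \<longlonglongrightarrow> emeasure M (\<Inter>n. - I n)"
    using inc sets by (intro Lim_emeasure_decseq) (auto simp: decseq_def I_def emeasure_eq_measure)
  ultimately have "\<forall>\<^sub>F n in sequentially. emeasure M (- I n) < ennreal e"
    using e by (intro order_tendstoD(2)) auto
  then obtain n where "emeasure M (- I n) < ennreal e" by (auto dest: eventually_happens)
  moreover have "1 / real (Suc n) \<le> 1" "1 \<le> real (Suc n)" by auto
  then have "1 / real (Suc n) \<le> real (Suc n)" by (rule order_trans)
  ultimately show ?thesis
    by (intro that[of "1 / real (Suc n)" "real (Suc n)"]) (auto simp: I_def)
qed

lemma (in sequence_space) nn_integral_PiM_iter:
  assumes [measurable]: "F \<in> borel_measurable S"
  shows "(\<integral>\<^sup>+\<omega>. F \<omega> \<partial>S) = (\<integral>\<^sup>+s. \<integral>\<^sup>+\<omega>. F (case_nat s \<omega>) \<partial>S \<partial>M)"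
proof -
  have "(\<integral>\<^sup>+\<omega>. F \<omega> \<partial>S) = (\<integral>\<^sup>+p. F (case_prod case_nat p) \<partial>(M \<Otimes>\<^sub>M S))"
    by (subst PiM_iter[symmetric]) (simp add: nn_integral_distr)
  also have "\<dots> = (\<integral>\<^sup>+s. \<integral>\<^sup>+\<omega>. F (case_nat s \<omega>) \<partial>S \<partial>M)"
    by (subst P.nn_integral_fst[symmetric]) simp_all
  finally show ?thesis .
qed

lemma outer_disjoint_boxes:
  fixes S :: "'a::euclidean_space set"
  assumes S: "S \<in> sets borel" "S \<subseteq> cbox a b" and e: "0 < e"
  obtains \<I> where "countable \<I>" "disjoint_family_on (\<lambda>I. I) \<I>" "\<And>I. I \<in> \<I> \<Longrightarrow> \<exists>c d. I = box c d"
    "emeasure lborel (S - \<Union>\<I>) = 0" "emeasure lborel (\<Union>\<I> - S) \<le> ennreal e"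
proof -
  have S_lm: "S \<in> lmeasurable"
    using S by (intro bounded_set_imp_lmeasurable bounded_subset[OF bounded_cbox]) auto
  obtain \<D> where \<D>: "countable \<D>" "S \<subseteq> \<Union>\<D>" "\<Union>\<D> \<in> lmeasurable"
      and cbox: "\<And>K. K \<in> \<D> \<Longrightarrow> \<exists>c d. K = cbox c d"
      and nonoverlap: "pairwise (\<lambda>A B. interior A \<inter> interior B = {}) \<D>"
      and tight: "measure lebesgue (\<Union>\<D>) \<le> measure lebesgue S + e"
    using measurable_outer_intervals_bounded[OF S_lm S(2) e] by metis
  have Union_borel: "\<Union>\<D> \<in> sets borel" using \<D>(1) cbox by (intro sets.countable_Union) force+
  have "K - interior K \<in> null_sets lborel" if "K \<in> \<D>" for K
    using cbox[OF that] negligible_frontier_interval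
    by (auto simp: negligible_iff_null_sets null_sets_completion_iff interior_cbox)
  then have edges: "(\<Union>K\<in>\<D>. K - interior K) \<in> null_sets lborel" by (intro null_sets_UN' \<D>(1))
  show ?thesis
  proof
    show "countable (interior ` \<D>)" using \<D>(1) by simp
    show "disjoint_family_on (\<lambda>I. I) (interior ` \<D>)"
      using nonoverlap by (fastforce simp: disjoint_family_on_def pairwise_def)
    show "\<exists>c d. I = box c d" if "I \<in> interior ` \<D>" for I
      using that cbox by (auto simp: interior_cbox) (metis interior_cbox)
    show "emeasure lborel (S - \<Union>(interior ` \<D>)) = 0"
    proof (rule emeasure_eq_0)
      show "emeasure lborel (\<Union>K\<in>\<D>. K - interior K) = 0" using edges by auto
      show "S - \<Union>(interior ` \<D>) \<subseteq> (\<Union>K\<in>\<D>. K - interior K)" using \<D>(2) by auto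
    qed (use edges in auto)
    have "emeasure lborel (\<Union>(interior ` \<D>) - S) \<le> emeasure lborel (\<Union>\<D> - S)"
      using interior_subset S(1) Union_borel by (intro emeasure_mono) (fastforce, auto)
    also have "\<dots> = emeasure lebesgue (\<Union>\<D> - S)" using S(1) Union_borel by simp
    also have "\<dots> = ennreal (measure lebesgue (\<Union>\<D>) - measure lebesgue S)"
      using \<D>(2,3) S_lm by (simp add: emeasure_eq_measure2 fmeasurable.Diff measurable_measure_Diff fmeasurableD)
    also have "\<dots> \<le> ennreal e" using tight by (intro ennreal_leI) simp
    finally show "emeasure lborel (\<Union>(interior ` \<D>) - S) \<le> ennreal e" .
  qed
qed

text \<open>A weak form of the Lebesgue density theorem: of the disjoint boxes in a tight cover of \<open>S\<close>, at least one is
  almost filled by \<open>S\<close>.\<close>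
lemma exists_dense_box:
  fixes S :: "'a::euclidean_space set"
  assumes S: "S \<in> sets borel" "S \<subseteq> cbox a b" "emeasure lborel S \<noteq> 0" and i: "0 < i"
  obtains c d where "box c d \<noteq> {}" "emeasure lborel (box c d - S) \<le> ennreal i * emeasure lborel (box c d)"
proof -
  have "emeasure lborel S \<le> emeasure lborel (cbox a b)" using S by (intro emeasure_mono) auto
  then obtain m where m: "emeasure lborel S = ennreal m" "0 < m"
    using S(3) emeasure_lborel_cbox_finite[of a b]
    by (cases "emeasure lborel S") (auto simp: top_unique less_le)
  obtain \<I> where \<I>: "countable \<I>" "disjoint_family_on (\<lambda>I. I) \<I>" and box: "\<And>I. I \<in> \<I> \<Longrightarrow> \<exists>c d. I = box c d"
      and cover: "emeasure lborel (S - \<Union>\<I>) = 0" and tight: "emeasure lborel (\<Union>\<I> - S) \<le> ennreal (i * m / 2)"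
    using outer_disjoint_boxes[OF S(1,2), of "i * m / 2"] m i
    by (metis divide_pos_pos mult_pos_pos zero_less_numeral)
  have \<I>_borel: "I \<in> sets borel" if "I \<in> \<I>" for I using box[OF that] by auto
  then have Union_borel: "\<Union>\<I> \<in> sets borel" using \<I>(1) by (intro sets.countable_Union) auto
  have "\<exists>I\<in>\<I>. I \<noteq> {} \<and> emeasure lborel (I - S) \<le> ennreal i * emeasure lborel I"
  proof (rule ccontr)
    assume "\<not> ?thesis"
    then have sparse: "ennreal i * emeasure lborel I \<le> emeasure lborel (I - S)" if "I \<in> \<I>" for I
      using that by (cases "I = {}") (auto simp: not_le)
    have "ennreal (i * m) = ennreal i * emeasure lborel S" using m i by (simp add: ennreal_mult)
    also have "emeasure lborel S \<le> emeasure lborel (\<Union>\<I> \<union> (S - \<Union>\<I>))"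
      using S(1) Union_borel by (intro emeasure_mono) auto
    also have "\<dots> = emeasure lborel (\<Union>\<I>)"
      using cover S(1) Union_borel by (intro emeasure_Un_null_set) auto
    also have "\<dots> = (\<integral>\<^sup>+I. emeasure lborel I \<partial>count_space \<I>)"
      using \<I> \<I>_borel emeasure_UN_countable[of \<I> "\<lambda>I. I" lborel] by auto
    also have "ennreal i * \<dots> = (\<integral>\<^sup>+I. ennreal i * emeasure lborel I \<partial>count_space \<I>)"
      by (rule nn_integral_cmult[symmetric]) simp
    also have "\<dots> \<le> (\<integral>\<^sup>+I. emeasure lborel (I - S) \<partial>count_space \<I>)"
      using sparse by (intro nn_integral_mono) simp
    also have "\<dots> = emeasure lborel (\<Union>I\<in>\<I>. I - S)"
      using \<I> \<I>_borel S(1) by (intro emeasure_UN_countable[symmetric]) (auto simp: disjoint_family_on_def)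
    also have "(\<Union>I\<in>\<I>. I - S) = \<Union>\<I> - S" by auto
    also note tight
    finally show False using i m(2) by (simp add: mult_left_mono)
  qed
  then show ?thesis using box that by metis
qed

subsection \<open>The exponential law\<close>

lemma sets_hold_law [measurable_cong, simp]: "sets hold_law = sets borel"
  and space_hold_law [simp]: "space hold_law = UNIV"
  by (simp_all add: hold_law_def)

interpretation hold: prob_space hold_law
  unfolding hold_law_def by (rule prob_space_exponential_density) simp

lemma emeasure_hold_law_UNIV [simp]: "emeasure hold_law UNIV = 1"
  using hold.emeasure_space_1 by simp

lemma nn_integral_hold_law:
  assumes [measurable]: "f \<in> borel_measurable borel"
  shows "(\<integral>\<^sup>+e. f e \<partial>hold_law) = (\<integral>\<^sup>+e. ennreal (exp (- e)) * indicator {0<..} e * f e \<partial>lborel)"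
proof -
  have "(\<integral>\<^sup>+e. f e \<partial>hold_law) = (\<integral>\<^sup>+e. ennreal (exponential_density 1 e) * f e \<partial>lborel)"
    unfolding hold_law_def by (rule nn_integral_density) simp_all
  also have "\<dots> = (\<integral>\<^sup>+e. ennreal (exp (- e)) * indicator {0<..} e * f e \<partial>lborel)"
    using AE_lborel_singleton[of 0] by (intro nn_integral_cong_AE)
      (auto elim!: eventually_mono simp: exponential_density_def indicator_def)
  finally show ?thesis .
qed

lemma emeasure_hold_law_atMost:
  "0 \<le> a \<Longrightarrow> emeasure hold_law {..a} = ennreal (1 - exp (- a))"
  by (simp add: hold_law_def emeasure_erlang_density erlang_CDF_0)

lemma AE_hold_law_pos: "AE e in hold_law. 0 < e"
  using emeasure_hold_law_atMost[of 0]
  by (subst AE_iff_measurable[OF _ refl]) (auto simp: not_less atMost_def)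

lemma emeasure_hold_law_greaterThan:
  assumes "0 \<le> a" shows "emeasure hold_law {a<..} = ennreal (exp (- a))"
proof -
  have "emeasure hold_law {a<..} = emeasure hold_law (space hold_law - {..a})"
    by (intro arg_cong[where f="emeasure hold_law"]) auto
  also have "\<dots> = 1 - ennreal (1 - exp (- a))"
    using assms by (subst emeasure_compl) (auto simp: emeasure_hold_law_atMost)
  also have "\<dots> = ennreal (exp (- a))"
    using assms by (subst ennreal_1[symmetric], subst ennreal_minus) simp_all
  finally show ?thesis .
qed

lemma nn_integral_hold_law_ident: "(\<integral>\<^sup>+e. ennreal e \<partial>hold_law) = 1"
  using nn_integral_erlang_ith_moment[of 1 0 1]
  by (simp add: hold_law_def nn_integral_density ennreal_mult' erlang_density_nonneg)

lemma nn_integral_hold_law_exp: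
  assumes "0 \<le> c"
  shows "(\<integral>\<^sup>+e. ennreal (exp (- c * e)) \<partial>hold_law) = ennreal (1 / (1 + c))"
proof -
  have "(\<integral>\<^sup>+e. ennreal (exp (- c * e)) \<partial>hold_law) =
      (\<integral>\<^sup>+e. ennreal (1 / (1 + c)) * ennreal (exponential_density (1 + c) e) \<partial>lborel)"
  proof -
    have "exponential_density 1 e * exp (- c * e) = 1 / (1 + c) * exponential_density (1 + c) e" for e
      using assms by (simp add: exponential_density_def mult_exp_exp distrib_left mult.commute)
    then show ?thesis
      using assms unfolding hold_law_def
      by (subst nn_integral_density) (auto simp: erlang_density_nonneg simp flip: ennreal_mult)
  qed
  also have "\<dots> = ennreal (1 / (1 + c)) * (\<integral>\<^sup>+e. ennreal (exponential_density (1 + c) e) \<partial>lborel)"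
    by (rule nn_integral_cmult) measurable
  also have "(\<integral>\<^sup>+e. ennreal (exponential_density (1 + c) e) \<partial>lborel) = 1"
    using nn_integral_erlang_ith_moment[of "1 + c" 0 0] assms by simp
  finally show ?thesis by simp
qed

lemma nn_integral_hold_law_antiderivative:
  fixes f F :: "real \<Rightarrow> real"
  assumes [measurable]: "f \<in> borel_measurable borel"
    and F: "\<And>s. 0 \<le> s \<Longrightarrow> (F has_real_derivative f s) (at s)" and f: "\<And>s. 0 \<le> s \<Longrightarrow> 0 \<le> f s"
  shows "(\<integral>\<^sup>+e. ennreal (F e - F 0) \<partial>hold_law) = (\<integral>\<^sup>+e. ennreal (f e) \<partial>hold_law)"
proof -
  interpret lborel_hold: pair_sigma_finite lborel hold_law ..
  have "(\<integral>\<^sup>+e. ennreal (F e - F 0) \<partial>hold_law) =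
      (\<integral>\<^sup>+e. \<integral>\<^sup>+s. (if 0 < s \<and> s < e then ennreal (f s) else 0) \<partial>lborel \<partial>hold_law)"
  proof (rule nn_integral_cong_AE)
    show "AE e in hold_law. ennreal (F e - F 0) = (\<integral>\<^sup>+s. (if 0 < s \<and> s < e then ennreal (f s) else 0) \<partial>lborel)"
      using AE_hold_law_pos
    proof eventually_elim
      case (elim e)
      then have "ennreal (F e - F 0) = (\<integral>\<^sup>+s. ennreal (f s) * indicator {0..e} s \<partial>lborel)"
        by (intro nn_integral_FTC_Icc[symmetric]) (auto intro: DERIV_subset F f)
      also have "\<dots> = (\<integral>\<^sup>+s. (if 0 < s \<and> s < e then ennreal (f s) else 0) \<partial>lborel)"
        using AE_lborel_singleton[of 0] AE_lborel_singleton[of e]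
        by (intro nn_integral_cong_AE) (auto elim!: eventually_elim2 simp: indicator_def)
      finally show ?case .
    qed
  qed
  also have "\<dots> = (\<integral>\<^sup>+s. \<integral>\<^sup>+e. (if 0 < s \<and> s < e then ennreal (f s) else 0) \<partial>hold_law \<partial>lborel)"
    by (rule lborel_hold.Fubini') measurable
  also have "\<dots> = (\<integral>\<^sup>+s. ennreal (exp (- s)) * indicator {0<..} s * ennreal (f s) \<partial>lborel)"
  proof (rule nn_integral_cong)
    fix s :: real
    have "(\<integral>\<^sup>+e. (if 0 < s \<and> s < e then ennreal (f s) else 0) \<partial>hold_law) =
        (\<integral>\<^sup>+e. (ennreal (f s) * indicator {0<..} s) * indicator {s<..} e \<partial>hold_law)"
      by (intro nn_integral_cong) (auto simp: indicator_def)
    also have "\<dots> = (ennreal (f s) * indicator {0<..} s) * emeasure hold_law {s<..}"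
      by (rule nn_integral_cmult_indicator) simp
    finally show "(\<integral>\<^sup>+e. (if 0 < s \<and> s < e then ennreal (f s) else 0) \<partial>hold_law) =
        ennreal (exp (- s)) * indicator {0<..} s * ennreal (f s)"
      by (auto simp: indicator_def emeasure_hold_law_greaterThan mult_ac)
  qed
  also have "\<dots> = (\<integral>\<^sup>+e. ennreal (f e) \<partial>hold_law)" by (rule nn_integral_hold_law[symmetric]) measurable
  finally show ?thesis .
qed

subsection \<open>Multiplicative Haar measure\<close>

lemma nn_integral_lborel_Ioi_exp:
  fixes f :: "real \<Rightarrow> ennreal"
  assumes [measurable]: "f \<in> borel_measurable borel"
  shows "(\<integral>\<^sup>+x. f x * indicator {0<..} x \<partial>lborel) = (\<integral>\<^sup>+v. f (exp v) * ennreal (exp v) \<partial>lborel)"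
proof -
  define \<mu> where "\<mu> = density lborel f"
  define \<nu> where "\<nu> = density lborel (\<lambda>v. f (exp v) * ennreal (exp v))"
  define J where "J n = {- real (Suc n)..real (Suc n)}" for n
  define I where "I n = {exp (- real (Suc n))..exp (real (Suc n))}" for n
  have I_iff: "x \<in> I n \<longleftrightarrow> 0 < x \<and> ln x \<in> J n" for x n
    unfolding I_def J_def
    by (metis atLeastAtMost_iff exp_gt_zero exp_le_cancel_iff exp_ln order_less_le_trans)
  have "\<exists>n. v \<in> J n" for v
  proof -
    obtain n where "\<bar>v\<bar> \<le> real n" using real_arch_simple by blast
    then show ?thesis by (intro exI[of _ n]) (auto simp: J_def)
  qed
  then have Union: "(\<Union>n. I n) = {0<..}" "(\<Union>n. J n) = UNIV" by (auto simp: I_iff)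
  have [measurable]: "I n \<in> sets borel" "J n \<in> sets borel" for n by (auto simp: I_def J_def)
  have "incseq J" by (auto simp: incseq_def J_def)
  then have "incseq I" unfolding incseq_def by (meson I_iff subsetD subsetI)
  have "emeasure \<mu> (I n) = emeasure \<nu> (J n)" for n
    unfolding \<mu>_def \<nu>_def I_def J_def
    using nn_integral_substitution_aux[of f "- real (Suc n)" "real (Suc n)" exp exp]
    by (simp add: emeasure_density DERIV_exp continuous_on_exp continuous_on_id)
  moreover have "(\<lambda>n. emeasure \<mu> (I n)) \<longlonglongrightarrow> emeasure \<mu> {0<..}"
    unfolding Union(1)[symmetric] using \<open>incseq I\<close> by (intro Lim_emeasure_incseq) (auto simp: \<mu>_def)
  moreover have "(\<lambda>n. emeasure \<nu> (J n)) \<longlonglongrightarrow> emeasure \<nu> UNIV"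
    unfolding Union(2)[symmetric] using \<open>incseq J\<close> by (intro Lim_emeasure_incseq) (auto simp: \<nu>_def)
  ultimately have "emeasure \<mu> {0<..} = emeasure \<nu> UNIV" by (simp add: LIMSEQ_unique)
  then show ?thesis by (simp add: \<mu>_def \<nu>_def emeasure_density)
qed

definition haar :: "real measure" where
  "haar = distr lborel borel exp"

lemma sets_haar [measurable_cong, simp]: "sets haar = sets borel" and space_haar [simp]: "space haar = UNIV"
  by (simp_all add: haar_def)

lemma nn_integral_haar:
  "f \<in> borel_measurable borel \<Longrightarrow> (\<integral>\<^sup>+x. f x \<partial>haar) = (\<integral>\<^sup>+v. f (exp v) \<partial>lborel)"
  unfolding haar_def by (rule nn_integral_distr) auto

lemma AE_haar_pos: "AE x in haar. 0 < x"
  unfolding haar_def by (subst AE_distr_iff) auto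

lemma not_AE_haar_False: "\<not> (AE x in haar. False)"
  unfolding haar_def by (subst AE_distr_iff) (auto simp: AE_iff_null null_sets_def)

lemma nn_integral_lborel_Ioi_eq_haar:
  assumes [measurable]: "f \<in> borel_measurable borel"
  shows "(\<integral>\<^sup>+x. f x * indicator {0<..} x \<partial>lborel) = (\<integral>\<^sup>+x. f x * ennreal x \<partial>haar)"
  by (simp add: nn_integral_lborel_Ioi_exp nn_integral_haar)

lemma nn_integral_haar_scale:
  assumes [measurable]: "f \<in> borel_measurable borel" and "0 < c"
  shows "(\<integral>\<^sup>+x. f (c * x) \<partial>haar) = (\<integral>\<^sup>+x. f x \<partial>haar)"
  using nn_integral_real_affine[of "\<lambda>v. f (exp v)" 1 "ln c"] assms
  by (simp add: nn_integral_haar exp_add)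

lemma nn_integral_haar_powr:
  assumes [measurable]: "f \<in> borel_measurable borel" and "0 < a"
  shows "ennreal a * (\<integral>\<^sup>+x. f (x powr a) \<partial>haar) = (\<integral>\<^sup>+x. f x \<partial>haar)"
  using nn_integral_real_affine[of "\<lambda>v. f (exp v)" a 0] assms
  by (simp add: nn_integral_haar powr_def)

interpretation haar: sigma_finite_measure haar
proof (rule sigma_finite_measure_distr)
  have "distr haar borel ln = distr lborel borel (ln \<circ> exp)"
    unfolding haar_def by (rule distr_distr) auto
  also have "\<dots> = (lborel :: real measure)" by (simp add: comp_def distr_id2)
  finally show "sigma_finite_measure (distr haar borel ln)" by (simp add: lborel.sigma_finite_measure_axioms)
qed simp

subsection \<open>Mass distributions\<close>

lemma sets_mm [measurable_cong, simp]: "sets mm = sets borel" and space_mm [simp]: "space mm = UNIV"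
  by (simp_all add: mm_def)

lemma AE_mm_pos: "AE x in mm. 0 < x"
  unfolding mm_def by (subst AE_density) (auto simp: indicator_def split: if_splits intro!: AE_I2)

lemma nn_integral_mm_eq_haar:
  assumes [measurable]: "f \<in> borel_measurable borel"
  shows "(\<integral>\<^sup>+x. f x \<partial>mm) = (\<integral>\<^sup>+x. f x * ennreal (x\<^sup>2) \<partial>haar)"
proof -
  have "(\<integral>\<^sup>+x. f x \<partial>mm) = (\<integral>\<^sup>+x. (f x * ennreal x) * indicator {0<..} x \<partial>lborel)"
    unfolding mm_def by (subst nn_integral_density) (auto simp: mult_ac)
  also have "\<dots> = (\<integral>\<^sup>+x. (f x * ennreal x) * ennreal x \<partial>haar)"
    by (rule nn_integral_lborel_Ioi_eq_haar) measurable
  also have "\<dots> = (\<integral>\<^sup>+x. f x * ennreal (x\<^sup>2) \<partial>haar)"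
    using AE_haar_pos by (intro nn_integral_cong_AE)
      (auto elim!: eventually_mono simp: power2_eq_square ennreal_mult mult_ac)
  finally show ?thesis .
qed

lemma nn_integral_mm_scale:
  assumes [measurable]: "f \<in> borel_measurable borel" and "0 < c"
  shows "(\<integral>\<^sup>+x. ennreal (c\<^sup>2) * f (c * x) \<partial>mm) = (\<integral>\<^sup>+x. f x \<partial>mm)"
proof -
  have "(\<integral>\<^sup>+x. ennreal (c\<^sup>2) * f (c * x) \<partial>mm) = (\<integral>\<^sup>+x. f (c * x) * ennreal ((c * x)\<^sup>2) \<partial>haar)"
    by (subst nn_integral_mm_eq_haar) (auto intro!: nn_integral_cong
      simp: power_mult_distrib ennreal_mult mult_ac)
  also have "\<dots> = (\<integral>\<^sup>+x. f x * ennreal (x\<^sup>2) \<partial>haar)"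
    using assms by (intro nn_integral_haar_scale[where f="\<lambda>x. f x * ennreal (x\<^sup>2)"]) auto
  also have "\<dots> = (\<integral>\<^sup>+x. f x \<partial>mm)" by (rule nn_integral_mm_eq_haar[symmetric]) measurable
  finally show ?thesis .
qed

interpretation mm: sigma_finite_measure mm
  unfolding mm_def
  by (subst sigma_finite_measure.sigma_finite_iff_density_finite)
    (auto simp: lborel.sigma_finite_measure_axioms indicator_def ennreal_mult_less_top)

lemma
  assumes "u \<in> Dm"
  shows measurable_Dm: "u \<in> borel_measurable borel"
    and AE_Dm_nonneg: "AE x in mm. 0 \<le> u x"
    and nn_integral_Dm: "(\<integral>\<^sup>+x. ennreal (u x) \<partial>mm) = 1"
    and integrable_Dm: "integrable mm u"
    and integral_Dm: "(\<integral>x. u x \<partial>mm) = 1"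
proof -
  show u: "u \<in> borel_measurable borel" "AE x in mm. 0 \<le> u x" "integrable mm u"
    using assms by (auto simp: Dm_def)
  have "(\<integral>x. u x \<partial>mm) = (\<integral>x. \<bar>u x\<bar> \<partial>mm)"
    using u by (intro integral_cong_AE) (auto elim!: eventually_mono)
  then show "(\<integral>x. u x \<partial>mm) = 1" using assms by (simp add: Dm_def)
  with u show "(\<integral>\<^sup>+x. ennreal (u x) \<partial>mm) = 1" by (simp add: nn_integral_eq_integral)
qed

lemma DmI:
  assumes [measurable]: "f \<in> borel_measurable borel" and nonneg: "\<And>x. 0 \<le> f x"
    and mass: "(\<integral>\<^sup>+x. ennreal (f x) \<partial>mm) = 1"
  shows "f \<in> Dm"
proof -
  have "integrable mm f" by (rule integrableI_nonneg) (auto simp: nonneg mass)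
  moreover have "(\<integral>x. f x \<partial>mm) = 1" using mass nonneg by (subst integral_eq_nn_integral) auto
  ultimately show ?thesis using nonneg by (auto simp: Dm_def)
qed

lemma prob_space_density_Dm:
  assumes "f \<in> Dm" shows "prob_space (density mm (\<lambda>x. ennreal (f x)))"
  using measurable_Dm[OF assms] nn_integral_Dm[OF assms] by (intro prob_spaceI) (simp add: emeasure_density)

lemma integral_abs_diff_Dm_le:
  assumes f: "f \<in> Dm" and g: "g \<in> Dm" and e: "0 \<le> e"
    and le: "(\<integral>\<^sup>+x. ennreal (f x) * indicator {x. g x < f x} x \<partial>mm) \<le>
      (\<integral>\<^sup>+x. ennreal (g x) * indicator {x. g x < f x} x \<partial>mm) + ennreal e"
  shows "(\<integral>x. \<bar>f x - g x\<bar> \<partial>mm) \<le> 2 * e"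
proof -
  note [measurable] = measurable_Dm[OF f] measurable_Dm[OF g]
  define B where "B = {x. g x < f x}"
  have [measurable]: "B \<in> sets borel" unfolding B_def by measurable
  have integrable_on_B: "integrable mm (\<lambda>x. u x * indicator B x)" if "u \<in> Dm" for u
    using integrable_Dm[OF that] by (intro integrable_real_mult_indicator) auto
  have nonneg_on_B: "AE x in mm. 0 \<le> u x * indicator B x" if "u \<in> Dm" for u
    using AE_Dm_nonneg[OF that] by eventually_elim auto
  have nn_integral_B: "(\<integral>\<^sup>+x. ennreal (u x) * indicator B x \<partial>mm) = ennreal (\<integral>x. u x * indicator B x \<partial>mm)"
    if "u \<in> Dm" for u
    using nn_integral_eq_integral[OF integrable_on_B[OF that] nonneg_on_B[OF that]]
    by (simp add: ennreal_mult'' ennreal_indicator)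
  have "0 \<le> (\<integral>x. g x * indicator B x \<partial>mm)" by (intro integral_nonneg_AE nonneg_on_B g)
  then have diff_on_B: "(\<integral>x. f x * indicator B x \<partial>mm) \<le> (\<integral>x. g x * indicator B x \<partial>mm) + e"
    using le e unfolding B_def[symmetric] nn_integral_B[OF f] nn_integral_B[OF g] by (simp flip: ennreal_plus)
  have "(\<integral>x. \<bar>f x - g x\<bar> \<partial>mm) = (\<integral>x. 2 * (f x * indicator B x - g x * indicator B x) - (f x - g x) \<partial>mm)"
    by (intro Bochner_Integration.integral_cong) (auto simp: B_def indicator_def)
  also have "\<dots> = 2 * ((\<integral>x. f x * indicator B x \<partial>mm) - (\<integral>x. g x * indicator B x \<partial>mm))"
    using integrable_Dm[OF f] integrable_Dm[OF g] integral_Dm[OF f] integral_Dm[OF g]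
       integrable_on_B[OF f] integrable_on_B[OF g] by simp
  finally show ?thesis using diff_on_B by simp
qed

subsection \<open>Truncated logarithms\<close>

definition clamp_ln :: "nat \<Rightarrow> real \<Rightarrow> real" where
  "clamp_ln n x = max (- real n) (min (real n) (ln x))"

lemma measurable_clamp_ln [measurable]: "clamp_ln n \<in> borel_measurable borel"
  unfolding clamp_ln_def by measurable

lemma clamp_ln_mono: "0 < x \<Longrightarrow> x \<le> y \<Longrightarrow> clamp_ln n x \<le> clamp_ln n y"
  using ln_mono[of x y] unfolding clamp_ln_def by linarith

lemma clamp_ln_diff_le: "0 < x \<Longrightarrow> x \<le> y \<Longrightarrow> clamp_ln n y - clamp_ln n x \<le> ln y - ln x"
  using ln_mono[of x y] unfolding clamp_ln_def by linarith

lemma clamp_ln_tendsto: "(\<lambda>n. clamp_ln n x) \<longlonglongrightarrow> ln x"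
proof (rule tendsto_eventually)
  show "\<forall>\<^sub>F n in sequentially. clamp_ln n x = ln x"
    using eventually_ge_at_top[of "nat \<lceil>\<bar>ln x\<bar>\<rceil>"]
    by eventually_elim (unfold clamp_ln_def, linarith)
qed

definition shifted_clamp_ln :: "nat \<Rightarrow> real \<Rightarrow> ennreal" where
  "shifted_clamp_ln n x = (if 0 < x then ennreal (clamp_ln n x + real n) else 0)"

lemma measurable_shifted_clamp_ln [measurable]: "shifted_clamp_ln n \<in> borel_measurable borel"
  unfolding shifted_clamp_ln_def by measurable

lemma shifted_clamp_ln_0 [simp]: "shifted_clamp_ln n 0 = 0"
  by (simp add: shifted_clamp_ln_def)

lemma shifted_clamp_ln_le: "shifted_clamp_ln n x \<le> ennreal (2 * real n)"
  by (auto simp: shifted_clamp_ln_def clamp_ln_def intro!: ennreal_leI)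

lemma shifted_clamp_ln_increment:
  assumes "0 < x" "x \<le> y"
  shows "shifted_clamp_ln n y = shifted_clamp_ln n x + ennreal (clamp_ln n y - clamp_ln n x)"
proof -
  have "0 \<le> clamp_ln n x + real n" by (simp add: clamp_ln_def)
  then show ?thesis
    using assms clamp_ln_mono[OF assms, of n] by (simp add: shifted_clamp_ln_def flip: ennreal_plus)
qed

lemma shifted_clamp_ln_le_divide:
  assumes x: "0 < x" and c: "1 \<le> c"
  shows "shifted_clamp_ln n x \<le> shifted_clamp_ln n (x / c) + ennreal (ln c)"
proof -
  have d: "0 < x / c" "x / c \<le> x" using x c by (auto simp: divide_le_eq mult_le_cancel_left1)
  have "ln x - ln (x / c) = ln c" using x c by (simp add: ln_div)
  then show ?thesis
    using clamp_ln_diff_le[OF d, of n] by (simp add: shifted_clamp_ln_increment[OF d] ennreal_leI)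
qed

subsection \<open>Iterated convolution of almost full subsets of intervals\<close>

definition conv_indicator :: "real set \<Rightarrow> (real \<Rightarrow> ennreal) \<Rightarrow> real \<Rightarrow> ennreal" where
  "conv_indicator B F x = (\<integral>\<^sup>+v. indicator B v * F (x - v) \<partial>lborel)"

text \<open>Any sufficiently small fraction would do in place of \<open>1 / 20\<close>.\<close>
definition almost_interval :: "real set \<Rightarrow> real \<Rightarrow> real \<Rightarrow> bool" where
  "almost_interval B p w \<longleftrightarrow> 0 < w \<and> B \<in> sets borel \<and> B \<subseteq> {p..p + w} \<and>
    emeasure lborel ({p..p + w} - B) \<le> ennreal (w / 20)"

definition conv_dominates_interval :: "real set \<Rightarrow> real \<Rightarrow> bool" where
  "conv_dominates_interval B R \<longleftrightarrow> (\<exists>n q c. 0 < c \<and> (\<forall>F\<in>borel_measurable borel. \<forall>x.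
    ennreal c * conv_indicator {q..q + R} F x \<le> (conv_indicator B ^^ n) F x))"

lemma measurable_conv_indicator [measurable]:
  assumes [measurable]: "B \<in> sets borel" "F \<in> borel_measurable borel"
  shows "conv_indicator B F \<in> borel_measurable borel"
  unfolding conv_indicator_def[abs_def] by measurable

lemma measurable_conv_indicator_pow [measurable]:
  "B \<in> sets borel \<Longrightarrow> F \<in> borel_measurable borel \<Longrightarrow> (conv_indicator B ^^ n) F \<in> borel_measurable borel"
  by (induction n) auto

lemma conv_indicator_conv_indicator_ge:
  assumes [measurable]: "A \<in> sets borel" "B \<in> sets borel" "S \<in> sets borel" "F \<in> borel_measurable borel"
    and ge: "\<And>s. s \<in> S \<Longrightarrow> ennreal c \<le> emeasure lborel {v \<in> A. s - v \<in> B}"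
  shows "ennreal c * conv_indicator S F x \<le> conv_indicator A (conv_indicator B F) x"
proof -
  have "ennreal c * conv_indicator S F x = (\<integral>\<^sup>+s. ennreal c * (indicator S s * F (x - s)) \<partial>lborel)"
    unfolding conv_indicator_def by (rule nn_integral_cmult[symmetric]) measurable
  also have "\<dots> \<le> (\<integral>\<^sup>+s. F (x - s) * emeasure lborel {v \<in> A. s - v \<in> B} \<partial>lborel)"
  proof (rule nn_integral_mono)
    fix s
    show "ennreal c * (indicator S s * F (x - s)) \<le> F (x - s) * emeasure lborel {v \<in> A. s - v \<in> B}"
      using mult_left_mono[OF ge[of s], of "F (x - s)"] by (cases "s \<in> S") (auto simp: mult.commute)
  qed
  also have "\<dots> = (\<integral>\<^sup>+s. \<integral>\<^sup>+v. F (x - s) * indicator {v \<in> A. s - v \<in> B} v \<partial>lborel \<partial>lborel)"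
    by (intro nn_integral_cong nn_integral_cmult_indicator[symmetric]) measurable
  also have "\<dots> = (\<integral>\<^sup>+s. \<integral>\<^sup>+v. indicator A v * (indicator B (s - v) * F (x - s)) \<partial>lborel \<partial>lborel)"
    by (intro nn_integral_cong) (auto simp: indicator_def)
  also have "\<dots> = (\<integral>\<^sup>+v. \<integral>\<^sup>+s. indicator A v * (indicator B (s - v) * F (x - s)) \<partial>lborel \<partial>lborel)"
    by (rule lborel_pair.Fubini') measurable
  also have "\<dots> = conv_indicator A (conv_indicator B F) x"
    unfolding conv_indicator_def[of A]
  proof (rule nn_integral_cong)
    fix v
    have "(\<integral>\<^sup>+s. indicator B (s - v) * F (x - s) \<partial>lborel) = conv_indicator B F (x - v)"
      using nn_integral_real_affine[of "\<lambda>s. indicator B (s - v) * F (x - s)" 1 v]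
      by (simp add: conv_indicator_def algebra_simps)
    then show "(\<integral>\<^sup>+s. indicator A v * (indicator B (s - v) * F (x - s)) \<partial>lborel) =
        indicator A v * conv_indicator B F (x - v)"
      by (simp add: nn_integral_cmult)
  qed
  finally show ?thesis .
qed

lemma conv_indicator_mono:
  "A \<subseteq> B \<Longrightarrow> (\<And>y. F y \<le> G y) \<Longrightarrow> conv_indicator A F x \<le> conv_indicator B G x"
  unfolding conv_indicator_def by (intro nn_integral_mono mult_mono indicator_leI) auto

lemma conv_indicator_cmult:
  assumes [measurable]: "B \<in> sets borel" "F \<in> borel_measurable borel"
  shows "conv_indicator B (\<lambda>y. a * F y) x = a * conv_indicator B F x"
  unfolding conv_indicator_def by (subst nn_integral_cmult[symmetric]) (auto simp: mult_ac)

lemma almost_interval_inter_ge: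
  assumes B: "almost_interval B p w" and "{q..r} \<subseteq> {p..p + w}" "q \<le> r"
  shows "ennreal (r - q - w / 20) \<le> emeasure lborel (B \<inter> {q..r})"
proof -
  have [measurable]: "B \<in> sets borel" using B by (simp add: almost_interval_def)
  have "ennreal (r - q) = emeasure lborel {q..r}" using assms by simp
  also have "\<dots> \<le> emeasure lborel ((B \<inter> {q..r}) \<union> ({p..p + w} - B))"
    using assms by (intro emeasure_mono) auto
  also have "\<dots> \<le> emeasure lborel (B \<inter> {q..r}) + emeasure lborel ({p..p + w} - B)"
    by (intro emeasure_subadditive) auto
  also have "\<dots> \<le> emeasure lborel (B \<inter> {q..r}) + ennreal (w / 20)"
    using B by (intro add_left_mono) (simp add: almost_interval_def)
  finally have "ennreal (r - q) - ennreal (w / 20) \<le> emeasure lborel (B \<inter> {q..r})"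
    by (simp add: ennreal_minus_le_iff add.commute)
  then show ?thesis using B by (simp add: almost_interval_def ennreal_minus)
qed

lemma emeasure_lborel_reflect:
  fixes A :: "real set"
  assumes [measurable]: "A \<in> sets borel"
  shows "emeasure lborel {v. s - v \<in> A} = emeasure lborel A"
proof -
  have "indicator A (s - v) = (indicator {v. s - v \<in> A} v :: ennreal)" for v by (simp add: indicator_def)
  then have "emeasure lborel {v. s - v \<in> A} = (\<integral>\<^sup>+v. indicator A (s - v) \<partial>lborel)" by simp
  also have "\<dots> = (\<integral>\<^sup>+v. indicator A v \<partial>lborel)"
    using nn_integral_real_affine[of "indicator A" "-1" s] by simp
  finally show ?thesis by simp
qed

lemma almost_interval_self_overlap:
  assumes B: "almost_interval B p w" and s: "2 * p + w / 5 \<le> s" "s \<le> 2 * p + 9 * w / 5"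
  shows "ennreal (w / 10) \<le> emeasure lborel {v \<in> B. s - v \<in> B}"
proof -
  let ?I = "{p..p + w}"
  have [measurable]: "B \<in> sets borel" and w: "0 < w" and gap: "emeasure lborel (?I - B) \<le> ennreal (w / 20)"
    using B by (auto simp: almost_interval_def)
  define l where "l = max p (s - p - w)"
  define u where "u = min (p + w) (s - p)"
  have "w / 5 \<le> u - l" using s w unfolding l_def u_def by linarith
  then have "ennreal (w / 5) \<le> emeasure lborel {l..u}" using w by (simp add: ennreal_leI)
  also have "\<dots> \<le> emeasure lborel ({v \<in> B. s - v \<in> B} \<union> ((?I - B) \<union> {v. s - v \<in> ?I - B}))"
    by (intro emeasure_mono) (auto simp: l_def u_def)
  also have "\<dots> \<le> emeasure lborel {v \<in> B. s - v \<in> B} + emeasure lborel ((?I - B) \<union> {v. s - v \<in> ?I - B})"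
    by (intro emeasure_subadditive) auto
  also have "\<dots> \<le> emeasure lborel {v \<in> B. s - v \<in> B} +
      (emeasure lborel (?I - B) + emeasure lborel {v. s - v \<in> ?I - B})"
    by (intro add_left_mono emeasure_subadditive) auto
  also have "\<dots> \<le> emeasure lborel {v \<in> B. s - v \<in> B} + (ennreal (w / 20) + ennreal (w / 20))"
    using gap by (subst emeasure_lborel_reflect) (auto intro!: add_left_mono add_mono)
  finally have "ennreal (w / 10) + ennreal (w / 10) \<le> ennreal (w / 10) + emeasure lborel {v \<in> B. s - v \<in> B}"
    using w by (simp add: add.commute flip: ennreal_plus)
  then show ?thesis by (simp add: ennreal_add_left_cancel_le)
qed

lemma conv_dominates_interval_base:
  assumes B: "almost_interval B p w" shows "conv_dominates_interval B w"
  unfolding conv_dominates_interval_def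
proof (intro exI conjI ballI allI)
  have [measurable]: "B \<in> sets borel" and w: "0 < w" using B by (auto simp: almost_interval_def)
  show "0 < w / 10" using w by simp
  fix F :: "real \<Rightarrow> ennreal" and x :: real assume "F \<in> borel_measurable borel"
  then have "ennreal (w / 10) * conv_indicator {2 * p + w / 5..2 * p + w / 5 + w} F x \<le>
      conv_indicator B (conv_indicator B F) x"
    using w by (intro conv_indicator_conv_indicator_ge almost_interval_self_overlap[OF B]) auto
  then show "ennreal (w / 10) * conv_indicator {2 * p + w / 5..2 * p + w / 5 + w} F x \<le>
      (conv_indicator B ^^ 2) F x"
    by (simp add: numeral_2_eq_2)
qed

lemma conv_dominates_interval_step:
  assumes B: "almost_interval B p w" and R: "conv_dominates_interval B R" "w \<le> R"
  shows "conv_dominates_interval B (R + w / 2)"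
proof -
  have [measurable]: "B \<in> sets borel" and w: "0 < w" using B by (auto simp: almost_interval_def)
  obtain n q c where c: "0 < c" and ge: "\<And>F x. F \<in> borel_measurable borel \<Longrightarrow>
      ennreal c * conv_indicator {q..q + R} F x \<le> (conv_indicator B ^^ n) F x"
    using R(1) unfolding conv_dominates_interval_def by blast
  have overlap: "ennreal (w / 5) \<le> emeasure lborel {v \<in> B. s - v \<in> {q..q + R}}"
    if s: "s \<in> {q + p + w / 4..q + p + w / 4 + (R + w / 2)}" for s
  proof -
    define l where "l = max p (s - q - R)"
    define u where "u = min (p + w) (s - q)"
    have "w / 4 \<le> u - l" using s w R(2) unfolding l_def u_def atLeastAtMost_iff by linarith
    then have "ennreal (w / 5) \<le> ennreal (u - l - w / 20)" by (intro ennreal_leI) simp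
    also have "\<dots> \<le> emeasure lborel (B \<inter> {l..u})"
    proof (rule almost_interval_inter_ge[OF B])
      show "{l..u} \<subseteq> {p..p + w}" by (rule subsetI) (simp add: l_def u_def)
    qed (use \<open>w / 4 \<le> u - l\<close> w in simp)
    also have "\<dots> \<le> emeasure lborel {v \<in> B. s - v \<in> {q..q + R}}"
      by (intro emeasure_mono) (auto simp: l_def u_def)
    finally show ?thesis .
  qed
  show ?thesis
    unfolding conv_dominates_interval_def
  proof (intro exI conjI ballI allI)
    show "0 < c * (w / 5)" using c w by simp
    fix F :: "real \<Rightarrow> ennreal" and x :: real assume [measurable]: "F \<in> borel_measurable borel"
    let ?I = "{q + p + w / 4..q + p + w / 4 + (R + w / 2)}"
    have "ennreal (c * (w / 5)) * conv_indicator ?I F x =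
        ennreal c * (ennreal (w / 5) * conv_indicator ?I F x)"
      using c w by (subst ennreal_mult) (simp_all add: mult.assoc)
    also have "\<dots> \<le> ennreal c * conv_indicator B (conv_indicator {q..q + R} F) x"
      by (intro mult_left_mono conv_indicator_conv_indicator_ge overlap) auto
    also have "\<dots> = conv_indicator B (\<lambda>y. ennreal c * conv_indicator {q..q + R} F y) x"
      by (rule conv_indicator_cmult[symmetric]) measurable
    also have "\<dots> \<le> conv_indicator B ((conv_indicator B ^^ n) F) x"
      by (intro conv_indicator_mono ge) auto
    finally show "ennreal (c * (w / 5)) * conv_indicator ?I F x \<le> (conv_indicator B ^^ Suc n) F x" by simp
  qed
qed

lemma conv_dominates_interval_mono:
  assumes "conv_dominates_interval B R" "R' \<le> R" shows "conv_dominates_interval B R'"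
proof -
  obtain n q c where c: "0 < c" and ge: "\<And>F x. F \<in> borel_measurable borel \<Longrightarrow>
      ennreal c * conv_indicator {q..q + R} F x \<le> (conv_indicator B ^^ n) F x"
    using assms(1) unfolding conv_dominates_interval_def by blast
  have "ennreal c * conv_indicator {q..q + R'} F x \<le> (conv_indicator B ^^ n) F x"
    if "F \<in> borel_measurable borel" for F x
    using assms(2) by (intro order_trans[OF _ ge[OF that]] mult_left_mono conv_indicator_mono) auto
  then show ?thesis using c unfolding conv_dominates_interval_def by blast
qed

lemma almost_interval_conv_dominates_interval:
  assumes B: "almost_interval B p w" shows "conv_dominates_interval B R"
proof -
  have w: "0 < w" using B by (simp add: almost_interval_def)
  have spread: "conv_dominates_interval B (w + real k * (w / 2))" for k
  proof (induction k)
    case (Suc k)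
    have "conv_dominates_interval B (w + real k * (w / 2) + w / 2)"
      using w by (intro conv_dominates_interval_step[OF B Suc]) simp
    moreover have "w + real k * (w / 2) + w / 2 = w + real (Suc k) * (w / 2)" by (simp add: field_simps)
    ultimately show ?case by (simp only:)
  qed (use conv_dominates_interval_base[OF B] in simp)
  obtain k where "(R - w) / (w / 2) \<le> real k" using real_arch_simple by blast
  then have "R \<le> w + real k * (w / 2)" using w by (simp add: field_simps)
  then show ?thesis by (rule conv_dominates_interval_mono[OF spread])
qed

lemma exists_almost_interval:
  assumes A[measurable]: "A \<in> sets borel" and "A \<subseteq> {a..b}" "emeasure lborel A \<noteq> 0"
  obtains p w where "almost_interval (A \<inter> {p..p + w}) p w"
proof -
  obtain c d where cd: "box c d \<noteq> {}"
    "emeasure lborel (box c d - A) \<le> ennreal (1 / 20) * emeasure lborel (box c d)"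
    using assms by (elim exists_dense_box[of A a b "1 / 20"]) auto
  then have "c < d" by (simp add: box_real)
  have "emeasure lborel ({c..d} - A) \<le> emeasure lborel ((box c d - A) \<union> {c, d})"
    by (intro emeasure_mono) (auto simp: box_real)
  also have "\<dots> = emeasure lborel (box c d - A)"
    by (intro emeasure_Un_null_set) (auto intro!: countable_imp_null_set_lborel)
  also have "\<dots> \<le> ennreal (1 / 20) * ennreal (d - c)" using cd(2) \<open>c < d\<close> by (simp add: box_real)
  finally have "emeasure lborel ({c..d} - A) \<le> ennreal ((d - c) / 20)"
    using \<open>c < d\<close> by (simp flip: ennreal_mult)
  moreover have "{c..d} - A \<inter> {c..d} = {c..d} - A" by blast
  ultimately have "almost_interval (A \<inter> {c..c + (d - c)}) c (d - c)"
    using \<open>c < d\<close> by (simp add: almost_interval_def)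
  then show ?thesis by (rule that)
qed

lemma exists_level_set_not_null:
  fixes f :: "real \<Rightarrow> ennreal"
  assumes [measurable]: "f \<in> borel_measurable borel" and "(\<integral>\<^sup>+v. f v \<partial>lborel) \<noteq> 0"
  obtains \<delta> m where "0 < \<delta>" "emeasure lborel {v \<in> {- m..m}. ennreal \<delta> \<le> f v} \<noteq> 0"
proof -
  define B where "B n = {v \<in> {- real n..real n}. ennreal (1 / real (Suc n)) \<le> f v}" for n
  have [measurable]: "B n \<in> sets borel" for n unfolding B_def by measurable
  have "\<exists>n. v \<in> B n" if "f v \<noteq> 0" for v
  proof -
    have "\<exists>r>0. ennreal r \<le> f v"
      using that by (cases "f v") (force simp: less_le intro: exI[of _ 1])+
    then obtain r where r: "0 < r" "ennreal r \<le> f v" by blast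
    obtain n where n: "inverse (real (Suc n)) < r" using reals_Archimedean r(1) by blast
    obtain k where k: "\<bar>v\<bar> \<le> real k" using real_arch_simple by blast
    have "1 / real (Suc (max n k)) \<le> r"
      using n frac_le[of 1 1 "real (Suc n)" "real (Suc (max n k))"] by (simp add: inverse_eq_divide)
    then have "ennreal (1 / real (Suc (max n k))) \<le> f v" using r(2) by (metis ennreal_leI order_trans)
    then show ?thesis using k by (intro exI[of _ "max n k"]) (auto simp: B_def)
  qed
  moreover have "\<not> (AE v in lborel. f v = 0)" using assms by (simp add: nn_integral_0_iff_AE)
  ultimately have "\<not> (AE v in lborel. \<forall>n. v \<notin> B n)" by (metis (mono_tags, lifting) eventually_mono)
  then obtain n where "\<not> (AE v in lborel. v \<notin> B n)" by (auto simp: AE_all_countable)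
  then have "emeasure lborel (B n) \<noteq> 0" by (auto simp: AE_iff_null_sets[symmetric] null_sets_def)
  then show ?thesis by (intro that[of "1 / real (Suc n)" "real n"]) (auto simp: B_def)
qed

subsection \<open>Paths of the jump process\<close>

lemma jchain_0 [simp]: "jchain w 0 = fst w"
  by (simp add: jchain_def)

lemma jtime_0 [simp]: "jtime \<alpha> w 0 = 0"
  by (simp add: jtime_def)

lemma jchain_Suc_case_nat: "jchain (x, case_nat (z, e) \<omega>) (Suc n) = jchain (z * x, \<omega>) n"
  by (simp add: jchain_def prod.lessThan_Suc_shift mult_ac del: prod.lessThan_Suc)

lemma jtime_Suc_case_nat:
  "jtime \<alpha> (x, case_nat (z, e) \<omega>) (Suc n) = e / x powr \<alpha> + jtime \<alpha> (z * x, \<omega>) n"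
  by (simp add: jtime_def htime_def jchain_Suc_case_nat sum.lessThan_Suc_shift del: sum.lessThan_Suc)

lemma jchain_pos: "0 < x \<Longrightarrow> (\<And>i. 0 < fst (\<omega> i)) \<Longrightarrow> 0 < jchain (x, \<omega>) n"
  by (simp add: jchain_def prod_pos)

lemma jchain_le:
  assumes "0 < x" "\<And>i. 0 < fst (\<omega> i) \<and> fst (\<omega> i) < 1"
  shows "jchain (x, \<omega>) n \<le> x"
proof -
  have "(\<Prod>i<n. fst (\<omega> i)) \<le> 1" using assms(2) by (intro prod_le_1) (auto intro: less_imp_le)
  then show ?thesis using assms(1) by (simp add: jchain_def)
qed

lemma jtime_mono:
  assumes "\<And>i. 0 < snd (\<omega> i)" "m \<le> n"
  shows "jtime \<alpha> (x, \<omega>) m \<le> jtime \<alpha> (x, \<omega>) n"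
  unfolding jtime_def using assms
  by (intro sum_mono2) (auto simp: htime_def intro!: divide_nonneg_nonneg intro: less_imp_le)

lemma sojourn_unique:
  assumes pos: "\<And>i. 0 < snd (\<omega> i)"
    and m: "jtime \<alpha> (x, \<omega>) m \<le> t" "t < jtime \<alpha> (x, \<omega>) (Suc m)"
    and n: "jtime \<alpha> (x, \<omega>) n \<le> t" "t < jtime \<alpha> (x, \<omega>) (Suc n)"
  shows "m = n"
proof (cases m n rule: linorder_cases)
  case less
  then have "jtime \<alpha> (x, \<omega>) (Suc m) \<le> jtime \<alpha> (x, \<omega>) n" by (intro jtime_mono pos) simp
  then show ?thesis using m(2) n(1) by simp
next
  case greater
  then have "jtime \<alpha> (x, \<omega>) (Suc n) \<le> jtime \<alpha> (x, \<omega>) m" by (intro jtime_mono pos) simp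
  then show ?thesis using n(2) m(1) by simp
qed

lemma Yproc_cases:
  assumes "0 \<le> t"
  obtains (sojourn) n where "jtime \<alpha> w n \<le> t" "t < jtime \<alpha> w (Suc n)" "Yproc \<alpha> w t = jchain w n"
    | (explosion) "\<And>n. jtime \<alpha> w (Suc n) \<le> t" "Yproc \<alpha> w t = 0"
proof (cases "\<exists>n. t < jtime \<alpha> w (Suc n)")
  case True
  define n where "n = (LEAST n. t < jtime \<alpha> w (Suc n))"
  have "t < jtime \<alpha> w (Suc n)" unfolding n_def using True by (rule LeastI_ex)
  moreover have "jtime \<alpha> w n \<le> t"
    using assms not_less_Least[of "n - 1" "\<lambda>n. t < jtime \<alpha> w (Suc n)"] by (cases n) (auto simp: n_def)
  ultimately show ?thesis using True sojourn[of n] by (simp add: Yproc_def n_def)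
qed (auto simp: Yproc_def not_less intro: explosion)

lemma Yproc_eq_jchain:
  assumes pos: "\<And>i. 0 < snd (\<omega> i)" and n: "jtime \<alpha> (x, \<omega>) n \<le> t" "t < jtime \<alpha> (x, \<omega>) (Suc n)"
  shows "Yproc \<alpha> (x, \<omega>) t = jchain (x, \<omega>) n"
proof -
  have "0 \<le> t" using jtime_mono[of \<omega> 0 n \<alpha> x] pos n(1) by simp
  then show ?thesis
  proof (cases rule: Yproc_cases[of t \<alpha> "(x, \<omega>)"])
    case (sojourn m)
    then show ?thesis using sojourn_unique[OF pos sojourn(1,2) n] by simp
  next
    case explosion
    then show ?thesis using n(2) by (simp add: not_less[symmetric])
  qed
qed

lemma Yproc_suminf:
  fixes f :: "real \<Rightarrow> ennreal"
  assumes pos: "\<And>i. 0 < snd (\<omega> i)" and "0 \<le> t" "f 0 = 0"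
  shows "f (Yproc \<alpha> (x, \<omega>) t) =
    (\<Sum>n. if jtime \<alpha> (x, \<omega>) n \<le> t \<and> t < jtime \<alpha> (x, \<omega>) (Suc n) then f (jchain (x, \<omega>) n) else 0)"
  using \<open>0 \<le> t\<close>
proof (cases rule: Yproc_cases[of t \<alpha> "(x, \<omega>)"])
  case (sojourn n)
  have "jtime \<alpha> (x, \<omega>) m \<le> t \<and> t < jtime \<alpha> (x, \<omega>) (Suc m) \<longleftrightarrow> m = n" for m
    using sojourn(1,2) sojourn_unique[where \<omega>=\<omega>, OF pos] by blast
  then show ?thesis
    using sums_single[of n "\<lambda>n. f (jchain (x, \<omega>) n)"] by (simp add: sojourn(3) sums_iff)
next
  case explosion
  then show ?thesis using \<open>f 0 = 0\<close> by (simp add: not_less[symmetric])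
qed

lemma Yproc_scale:
  assumes "0 < l" "0 < x" "\<And>i. 0 < fst (\<omega> i)"
  shows "Yproc \<alpha> (l * x, \<omega>) (t / l powr \<alpha>) = l * Yproc \<alpha> (x, \<omega>) t"
proof -
  have scale: "jchain (l * x, \<omega>) n = l * jchain (x, \<omega>) n" for n by (simp add: jchain_def)
  then have "htime \<alpha> (l * x, \<omega>) n = htime \<alpha> (x, \<omega>) n / l powr \<alpha>" for n
    using jchain_pos[of x \<omega> n] assms by (simp add: htime_def powr_mult)
  then have "jtime \<alpha> (l * x, \<omega>) n = jtime \<alpha> (x, \<omega>) n / l powr \<alpha>" for n
    by (simp add: jtime_def sum_divide_distrib)
  then have "t / l powr \<alpha> < jtime \<alpha> (l * x, \<omega>) n \<longleftrightarrow> t < jtime \<alpha> (x, \<omega>) n" for n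
    using assms(1) by (simp add: divide_less_cancel)
  then show ?thesis by (simp add: Yproc_def scale)
qed

subsection \<open>The driving noise\<close>

locale fragmentation =
  fixes \<alpha> :: real and h :: "real \<Rightarrow> real"
  assumes alpha_pos: "\<alpha> > 0"
    and h_measurable: "set_borel_measurable borel {0<..<1} h"
    and h_nonneg: "\<forall>r\<in>{0<..<1}. 0 \<le> h r"
    and h_mass: "(\<integral>\<^sup>+ r\<in>{0<..<1}. ennreal (h r * r) \<partial>lborel) = 1"
begin

definition ratio_density :: "real \<Rightarrow> ennreal" where
  "ratio_density z = ennreal (h z * z) * indicator {0<..<1} z"

abbreviation ratio_law :: "real measure" where
  "ratio_law \<equiv> theta_law h"

lemma measurable_ratio_density [measurable]: "ratio_density \<in> borel_measurable borel"
proof -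
  have [measurable]: "(\<lambda>z. indicator {0<..<1} z *\<^sub>R h z) \<in> borel_measurable borel"
    using h_measurable by (simp add: set_borel_measurable_def)
  have "(\<lambda>z. ennreal ((indicator {0<..<1} z *\<^sub>R h z) * z)) \<in> borel_measurable borel"
    by measurable
  also have "(\<lambda>z. ennreal ((indicator {0<..<1} z *\<^sub>R h z) * z)) = ratio_density"
    by (auto simp: fun_eq_iff ratio_density_def indicator_def)
  finally show ?thesis .
qed

lemma ratio_law_eq: "ratio_law = density lborel ratio_density"
  by (simp add: theta_law_def ratio_density_def[abs_def])

lemma sets_ratio_law [measurable_cong, simp]: "sets ratio_law = sets borel"
  and space_ratio_law [simp]: "space ratio_law = UNIV"
  by (simp_all add: ratio_law_eq)

lemma nn_integral_ratio_law:
  "f \<in> borel_measurable borel \<Longrightarrow> (\<integral>\<^sup>+z. f z \<partial>ratio_law) = (\<integral>\<^sup>+z. ratio_density z * f z \<partial>lborel)"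
  unfolding ratio_law_eq by (rule nn_integral_density) auto

sublocale ratio: prob_space ratio_law
proof
  have "emeasure ratio_law (space ratio_law) = (\<integral>\<^sup>+z. 1 \<partial>ratio_law)" by simp
  also have "\<dots> = 1" using h_mass by (subst nn_integral_ratio_law) (auto simp: ratio_density_def)
  finally show "emeasure ratio_law (space ratio_law) = 1" .
qed

lemma AE_ratio_lawI:
  assumes "\<And>z. 0 < z \<Longrightarrow> z < 1 \<Longrightarrow> P z" shows "AE z in ratio_law. P z"
  unfolding ratio_law_eq using assms
  by (subst AE_density) (auto simp: ratio_density_def indicator_def split: if_splits intro!: AE_I2)

lemma ratio_powr_less_1: "0 < z \<Longrightarrow> z < 1 \<Longrightarrow> z powr \<alpha> < 1"
  using alpha_pos powr_less_mono2[of \<alpha> z 1] by simp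

abbreviation jump_law :: "(real \<times> real) measure" where
  "jump_law \<equiv> ratio_law \<Otimes>\<^sub>M hold_law"

sublocale jump: pair_prob_space ratio_law hold_law ..

lemma sets_jump_law: "sets jump_law = sets (borel \<Otimes>\<^sub>M borel)"
  by (intro sets_pair_measure_cong) auto

definition noise_law :: "(nat \<Rightarrow> real \<times> real) measure" where
  "noise_law = (\<Pi>\<^sub>M n\<in>UNIV. jump_law)"

sublocale noise: prob_space noise_law
  unfolding noise_law_def by (intro prob_space_PiM) unfold_locales

declare noise.emeasure_space_1 [simp]

lemma emeasure_ratio_law_UNIV [simp]: "emeasure ratio_law UNIV = 1"
  using ratio.emeasure_space_1 by simp

lemma AE_noise_law: "AE \<omega> in noise_law. \<forall>i. (0 < fst (\<omega> i) \<and> fst (\<omega> i) < 1) \<and> 0 < snd (\<omega> i)"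
proof -
  have "AE p in jump_law. (0 < fst p \<and> fst p < 1) \<and> 0 < snd p"
  proof (rule jump.AE_pair_measure)
    show "AE z in ratio_law. AE e in hold_law. (0 < fst (z, e) \<and> fst (z, e) < 1) \<and> 0 < snd (z, e)"
      using AE_hold_law_pos by (intro AE_ratio_lawI) (auto elim: eventually_mono)
  qed measurable
  then have "AE \<omega> in noise_law. (0 < fst (\<omega> i) \<and> fst (\<omega> i) < 1) \<and> 0 < snd (\<omega> i)" for i
    unfolding noise_law_def by (intro AE_PiM_component) (auto intro: jump.prob_space_axioms)
  then show ?thesis unfolding AE_all_countable by blast
qed

lemma measurable_noise_component [measurable]:
  "(\<lambda>\<omega>. fst (\<omega> i)) \<in> borel_measurable noise_law" "(\<lambda>\<omega>. snd (\<omega> i)) \<in> borel_measurable noise_law"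
proof -
  have component: "(\<lambda>\<omega>. \<omega> i) \<in> noise_law \<rightarrow>\<^sub>M jump_law"
    unfolding noise_law_def by (rule measurable_component_singleton) simp
  show "(\<lambda>\<omega>. fst (\<omega> i)) \<in> borel_measurable noise_law" "(\<lambda>\<omega>. snd (\<omega> i)) \<in> borel_measurable noise_law"
    using measurable_compose[OF component measurable_fst] measurable_compose[OF component measurable_snd]
    by (simp_all cong: measurable_cong_sets)
qed

lemma measurable_case_nat_noise [measurable (raw)]:
  assumes "f \<in> M \<rightarrow>\<^sub>M borel \<Otimes>\<^sub>M borel" "g \<in> M \<rightarrow>\<^sub>M noise_law"
  shows "(\<lambda>x. case_nat (f x) (g x)) \<in> M \<rightarrow>\<^sub>M noise_law"
proof -
  have "f \<in> M \<rightarrow>\<^sub>M jump_law" using assms(1) by (simp add: sets_jump_law cong: measurable_cong_sets)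
  then show ?thesis using assms(2) unfolding noise_law_def by (intro measurable_case_nat') auto
qed

lemma nn_integral_noise_law:
  assumes [measurable]: "F \<in> borel_measurable noise_law"
  shows "(\<integral>\<^sup>+\<omega>. F \<omega> \<partial>noise_law) =
    (\<integral>\<^sup>+z. \<integral>\<^sup>+e. \<integral>\<^sup>+\<omega>. F (case_nat (z, e) \<omega>) \<partial>noise_law \<partial>hold_law \<partial>ratio_law)"
proof -
  note sets_jump_law[measurable_cong]
  have "(\<integral>\<^sup>+\<omega>. F \<omega> \<partial>noise_law) = (\<integral>\<^sup>+p. \<integral>\<^sup>+\<omega>. F (case_nat p \<omega>) \<partial>noise_law \<partial>jump_law)"
    using sequence_space.nn_integral_PiM_iter[of jump_law F] assms
    by (simp add: noise_law_def sequence_space_def product_prob_space_def product_sigma_finite_def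
        product_prob_space_axioms_def jump.prob_space_axioms jump.sigma_finite_measure_axioms)
  also have "\<dots> = (\<integral>\<^sup>+z. \<integral>\<^sup>+e. \<integral>\<^sup>+\<omega>. F (case_nat (z, e) \<omega>) \<partial>noise_law \<partial>hold_law \<partial>ratio_law)"
    by (subst hold.nn_integral_fst[symmetric]) measurable
  finally show ?thesis .
qed

subsection \<open>The transition semigroup\<close>

lemma measurable_jchain [measurable]:
  "(\<lambda>w. jchain w n) \<in> borel_measurable (borel \<Otimes>\<^sub>M noise_law)"
  unfolding jchain_def by measurable

lemma measurable_jtime [measurable]:
  "(\<lambda>w. jtime \<alpha> w n) \<in> borel_measurable (borel \<Otimes>\<^sub>M noise_law)"
  unfolding jtime_def htime_def by measurable

lemma measurable_Yproc [measurable]: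
  "(\<lambda>w. Yproc \<alpha> w t) \<in> borel_measurable (borel \<Otimes>\<^sub>M noise_law)"
proof -
  have [measurable]: "(\<lambda>w. jchain w (LEAST n. t < jtime \<alpha> w (Suc n))) \<in> borel_measurable (borel \<Otimes>\<^sub>M noise_law)"
    by (rule measurable_compose_countable[where g="\<lambda>w. LEAST n. t < jtime \<alpha> w (Suc n)"]) measurable
  show ?thesis unfolding Yproc_def by measurable
qed

definition transition :: "real \<Rightarrow> (real \<Rightarrow> ennreal) \<Rightarrow> real \<Rightarrow> ennreal" where
  "transition t f x = (\<integral>\<^sup>+\<omega>. f (Yproc \<alpha> (x, \<omega>) t) \<partial>noise_law)"

lemma measurable_transition [measurable]:
  assumes [measurable]: "f \<in> borel_measurable borel"
  shows "transition t f \<in> borel_measurable borel"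
  unfolding transition_def[abs_def]
  by (rule noise.borel_measurable_nn_integral_fst[where f="\<lambda>w. f (Yproc \<alpha> w t)"]) measurable

lemma transition_le_1: "(\<And>y. f y \<le> 1) \<Longrightarrow> transition t f x \<le> 1"
  using nn_integral_mono[of noise_law "\<lambda>\<omega>. f (Yproc \<alpha> (x, \<omega>) t)" "\<lambda>_. 1"] by (simp add: transition_def)

lemma transition_1 [simp]: "transition t (\<lambda>_. 1) x = 1"
  by (simp add: transition_def)

lemma nn_integral_distr_Yproc:
  assumes M: "sets M = sets borel" and f[measurable]: "f \<in> borel_measurable borel"
  shows "(\<integral>\<^sup>+y. f y \<partial>distr (M \<Otimes>\<^sub>M noise_law) borel (\<lambda>w. Yproc \<alpha> w t)) = (\<integral>\<^sup>+x. transition t f x \<partial>M)"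
proof -
  have "sets (M \<Otimes>\<^sub>M noise_law) = sets (borel \<Otimes>\<^sub>M noise_law)"
    using M by (intro sets_pair_measure_cong) auto
  then have Y: "(\<lambda>w. Yproc \<alpha> w t) \<in> borel_measurable (M \<Otimes>\<^sub>M noise_law)"
    using measurable_Yproc by (simp cong: measurable_cong_sets)
  show ?thesis
    using noise.nn_integral_fst[OF measurable_compose[OF Y f]]
    by (simp add: nn_integral_distr[OF Y] transition_def)
qed

lemma nn_integral_distr_jump_space:
  assumes [measurable]: "c0 \<in> borel_measurable borel" "f \<in> borel_measurable borel"
  shows "(\<integral>\<^sup>+y. f y \<partial>distr (jump_space h c0) borel (\<lambda>w. Yproc \<alpha> w t)) =
      (\<integral>\<^sup>+x. ennreal (c0 x) * transition t f x \<partial>mm)"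
  unfolding jump_space_def noise_law_def[symmetric]
  by (subst nn_integral_distr_Yproc) (auto simp: nn_integral_density)

lemma transition_scale:
  assumes "0 < l" "0 < x"
  shows "transition t (\<lambda>y. f (l * y)) x = transition (t / l powr \<alpha>) f (l * x)"
  unfolding transition_def
proof (rule nn_integral_cong_AE)
  show "AE \<omega> in noise_law. f (l * Yproc \<alpha> (x, \<omega>) t) = f (Yproc \<alpha> (l * x, \<omega>) (t / l powr \<alpha>))"
    using AE_noise_law by eventually_elim (subst Yproc_scale, use assms in auto)
qed

lemma transition_0:
  assumes "0 < x" shows "transition 0 f x = f x"
proof -
  have "AE \<omega> in noise_law. f (Yproc \<alpha> (x, \<omega>) 0) = f x"
    using AE_noise_law
  proof eventually_elim
    case (elim \<omega>)
    then have "Yproc \<alpha> (x, \<omega>) 0 = jchain (x, \<omega>) 0"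
      using assms by (intro Yproc_eq_jchain) (auto simp: jtime_def htime_def)
    then show ?case by simp
  qed
  then have "transition 0 f x = (\<integral>\<^sup>+\<omega>. f x \<partial>noise_law)" unfolding transition_def by (rule nn_integral_cong_AE)
  then show ?thesis by simp
qed

lemma transition_le_of_mono:
  assumes "0 < x" "0 \<le> t" "G 0 = 0" and mono: "\<And>a b. 0 < a \<Longrightarrow> a \<le> b \<Longrightarrow> G a \<le> G b"
  shows "transition t G x \<le> G x"
proof -
  have "transition t G x \<le> (\<integral>\<^sup>+\<omega>. G x \<partial>noise_law)"
    unfolding transition_def
  proof (rule nn_integral_mono_AE)
    show "AE \<omega> in noise_law. G (Yproc \<alpha> (x, \<omega>) t) \<le> G x"
      using AE_noise_law
    proof eventually_elim
      case (elim \<omega>)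
      show ?case
        using \<open>0 \<le> t\<close>
      proof (cases rule: Yproc_cases[of t \<alpha> "(x, \<omega>)"])
        case (sojourn n)
        then show ?thesis using elim assms jchain_pos[of x \<omega> n] jchain_le[of x \<omega> n] by (simp add: mono)
      qed (simp add: assms)
    qed
  qed
  then show ?thesis by simp
qed

subsection \<open>The renewal equation\<close>

text \<open>\<open>jump_op\<close> is the transition operator of the Markov chain of pairs (jump time, post-jump state).\<close>
definition jump_op :: "(real \<Rightarrow> real \<Rightarrow> ennreal) \<Rightarrow> real \<Rightarrow> real \<Rightarrow> ennreal" where
  "jump_op H s y = (\<integral>\<^sup>+z. \<integral>\<^sup>+e. H (s + e / y powr \<alpha>) (z * y) \<partial>hold_law \<partial>ratio_law)"

definition survival :: "real \<Rightarrow> real \<Rightarrow> ennreal" where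
  "survival t y = ennreal (exp (- (t * y powr \<alpha>)))"

definition hold_until :: "real \<Rightarrow> (real \<Rightarrow> ennreal) \<Rightarrow> real \<Rightarrow> real \<Rightarrow> ennreal" where
  "hold_until t f s y = indicator {..t} s * survival (t - s) y * f y"

lemma measurable_survival [measurable]:
  assumes [measurable]: "f \<in> borel_measurable M" "g \<in> borel_measurable M"
  shows "(\<lambda>x. survival (f x) (g x)) \<in> borel_measurable M"
  unfolding survival_def by measurable

lemma survival_add: "survival (s + t) y = survival s y * survival t y"
  by (simp add: survival_def distrib_right exp_diff exp_minus field_simps flip: ennreal_mult)

lemma survival_antimono: "0 \<le> s \<Longrightarrow> s \<le> t \<Longrightarrow> 0 \<le> x \<Longrightarrow> x \<le> y \<Longrightarrow> survival t y \<le> survival s x"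
  using alpha_pos unfolding survival_def by (intro ennreal_leI) (simp add: mult_mono powr_mono2)

lemma borel_measurable2_jump_op:
  assumes "borel_measurable2 H" shows "borel_measurable2 (jump_op H)"
proof -
  note [measurable] = borel_measurable2_compose[OF assms]
  show ?thesis unfolding jump_op_def split_beta by measurable
qed

lemma borel_measurable2_jump_op_pow: "borel_measurable2 H \<Longrightarrow> borel_measurable2 ((jump_op ^^ n) H)"
  by (induction n) (auto intro: borel_measurable2_jump_op)

lemma borel_measurable2_hold_until:
  assumes [measurable]: "f \<in> borel_measurable borel" shows "borel_measurable2 (hold_until t f)"
  unfolding hold_until_def split_beta by measurable

lemma jump_op_mono:
  assumes "\<And>s z. 0 < z \<Longrightarrow> z \<le> b \<Longrightarrow> H s z \<le> H' s z" "0 < y" "y \<le> b"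
  shows "jump_op H s y \<le> jump_op H' s y"
  unfolding jump_op_def
proof (intro nn_integral_mono_AE AE_ratio_lawI AE_I2)
  fix z e :: real assume z: "0 < z" "z < 1"
  then have "z * y \<le> b" using assms(2,3) by (meson dual_order.trans less_imp_le mult_left_le_one_le)
  then show "H (s + e / y powr \<alpha>) (z * y) \<le> H' (s + e / y powr \<alpha>) (z * y)"
    using z assms by auto
qed

lemma jump_op_pow_mono:
  assumes "\<And>s z. 0 < z \<Longrightarrow> z \<le> b \<Longrightarrow> H s z \<le> H' s z" "0 < y" "y \<le> b"
  shows "(jump_op ^^ n) H s y \<le> (jump_op ^^ n) H' s y"
  using assms(2,3) by (induction n arbitrary: s y) (auto intro: assms(1) jump_op_mono)

lemma jump_op_pow_cong:
  assumes "\<And>s z. 0 < z \<Longrightarrow> H s z = H' s z" "0 < y"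
  shows "(jump_op ^^ n) H s y = (jump_op ^^ n) H' s y"
  by (rule antisym) (auto intro!: jump_op_pow_mono[where b=y] simp: assms)

lemma jump_op_add:
  assumes "borel_measurable2 H" "borel_measurable2 H'"
  shows "jump_op (\<lambda>s y. H s y + H' s y) s y = jump_op H s y + jump_op H' s y"
proof -
  note [measurable] = borel_measurable2_compose[OF assms(1)] borel_measurable2_compose[OF assms(2)]
  show ?thesis unfolding jump_op_def by (simp add: nn_integral_add)
qed

lemma jump_op_pow_add:
  assumes "borel_measurable2 H" "borel_measurable2 H'"
  shows "(jump_op ^^ n) (\<lambda>s y. H s y + H' s y) = (\<lambda>s y. (jump_op ^^ n) H s y + (jump_op ^^ n) H' s y)"
  by (induction n) (auto intro!: ext simp: jump_op_add borel_measurable2_jump_op_pow assms)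

lemma jump_op_suminf:
  assumes "\<And>n. borel_measurable2 (H n)"
  shows "jump_op (\<lambda>s y. \<Sum>n. H n s y) s y = (\<Sum>n. jump_op (H n) s y)"
proof -
  note [measurable] = borel_measurable2_compose[OF assms]
  show ?thesis unfolding jump_op_def by (simp add: nn_integral_suminf)
qed

lemma jump_op_pow_hold_until:
  assumes [measurable]: "f \<in> borel_measurable borel" and "0 < x"
  shows "(jump_op ^^ n) (hold_until t f) s x =
    (\<integral>\<^sup>+\<omega>. (if s + jtime \<alpha> (x, \<omega>) n \<le> t \<and> t < s + jtime \<alpha> (x, \<omega>) (Suc n) then f (jchain (x, \<omega>) n) else 0) \<partial>noise_law)"
    (is "_ = (\<integral>\<^sup>+\<omega>. ?F n s x \<omega> \<partial>noise_law)")
  using \<open>0 < x\<close>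
proof (induction n arbitrary: s x)
  case 0
  have "(\<integral>\<^sup>+\<omega>. ?F 0 s x \<omega> \<partial>noise_law) =
      (\<integral>\<^sup>+e. (indicator {..t} s * f x) * indicator {(t - s) * x powr \<alpha> <..} e \<partial>hold_law)"
    using 0 by (subst nn_integral_noise_law)
      (auto intro!: nn_integral_cong simp: jtime_Suc_case_nat indicator_def field_simps cong: if_cong)
  also have "\<dots> = (indicator {..t} s * f x) * emeasure hold_law {(t - s) * x powr \<alpha> <..}"
    by (rule nn_integral_cmult_indicator) simp
  also have "\<dots> = hold_until t f s x"
    by (simp add: hold_until_def survival_def indicator_def emeasure_hold_law_greaterThan mult_ac)
  finally show ?case by simp
next
  case (Suc n)
  have "(\<integral>\<^sup>+\<omega>. ?F (Suc n) s x \<omega> \<partial>noise_law) =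
      (\<integral>\<^sup>+z. \<integral>\<^sup>+e. \<integral>\<^sup>+\<omega>. ?F n (s + e / x powr \<alpha>) (z * x) \<omega> \<partial>noise_law \<partial>hold_law \<partial>ratio_law)"
    by (subst nn_integral_noise_law, measurable) (simp only: jtime_Suc_case_nat jchain_Suc_case_nat add.assoc)
  also have "\<dots> = (\<integral>\<^sup>+z. \<integral>\<^sup>+e. (jump_op ^^ n) (hold_until t f) (s + e / x powr \<alpha>) (z * x) \<partial>hold_law \<partial>ratio_law)"
    by (intro nn_integral_cong_AE AE_ratio_lawI AE_I2) (use Suc in auto)
  also have "\<dots> = (jump_op ^^ Suc n) (hold_until t f) s x" by (simp add: jump_op_def)
  finally show ?case by simp
qed

lemma transition_eq_suminf_jump_op:
  assumes [measurable]: "f \<in> borel_measurable borel" and "0 < x" "0 \<le> t" "f 0 = 0"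
  shows "transition t f x = (\<Sum>n. (jump_op ^^ n) (hold_until t f) 0 x)"
proof -
  have "transition t f x = (\<integral>\<^sup>+\<omega>. (\<Sum>n. if jtime \<alpha> (x, \<omega>) n \<le> t \<and> t < jtime \<alpha> (x, \<omega>) (Suc n)
      then f (jchain (x, \<omega>) n) else 0) \<partial>noise_law)"
    unfolding transition_def
  proof (rule nn_integral_cong_AE)
    show "AE \<omega> in noise_law. f (Yproc \<alpha> (x, \<omega>) t) = (\<Sum>n. if jtime \<alpha> (x, \<omega>) n \<le> t \<and> t < jtime \<alpha> (x, \<omega>) (Suc n)
        then f (jchain (x, \<omega>) n) else 0)"
      using AE_noise_law by eventually_elim (rule Yproc_suminf, use assms in auto)
  qed
  also have "\<dots> = (\<Sum>n. (jump_op ^^ n) (hold_until t f) 0 x)"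
    using assms by (subst nn_integral_suminf) (auto simp: jump_op_pow_hold_until)
  finally show ?thesis .
qed

text \<open>Below a fixed size \<open>b\<close> the jump rates are bounded, so discounting makes \<open>jump_op\<close> a strict contraction.
  This is what rules out explosion.\<close>
lemma jump_op_exp_le:
  assumes "0 < y" "y \<le> b" "0 \<le> r"
  shows "jump_op (\<lambda>s _. ennreal (r * exp (- s))) s y \<le> ennreal (b powr \<alpha> / (1 + b powr \<alpha>) * r * exp (- s))"
proof -
  define l where "l = y powr \<alpha>"
  have l: "0 < l" using assms(1) by (simp add: l_def)
  have "jump_op (\<lambda>s _. ennreal (r * exp (- s))) s y =
      (\<integral>\<^sup>+e. ennreal (r * exp (- s)) * ennreal (exp (- (1 / l) * e)) \<partial>hold_law)"
    using assms(3) by (simp add: jump_op_def l_def exp_diff exp_add exp_minus divide_inverse mult_ac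
      flip: ennreal_mult)
  also have "\<dots> = ennreal (r * exp (- s)) * ennreal (1 / (1 + 1 / l))"
    using l by (subst nn_integral_cmult, measurable) (subst nn_integral_hold_law_exp, auto)
  also have "1 / (1 + 1 / l) = l / (1 + l)" using l by (simp add: field_simps)
  also have "ennreal (r * exp (- s)) * ennreal (l / (1 + l)) \<le>
      ennreal (r * exp (- s)) * ennreal (b powr \<alpha> / (1 + b powr \<alpha>))"
  proof (intro mult_left_mono ennreal_leI)
    have "l \<le> b powr \<alpha>" using assms alpha_pos unfolding l_def by (intro powr_mono2) auto
    then show "l / (1 + l) \<le> b powr \<alpha> / (1 + b powr \<alpha>)" using l by (simp add: divide_simps algebra_simps)
  qed simp
  finally show ?thesis using assms(3) by (simp add: add_nonneg_nonneg mult_ac flip: ennreal_mult)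
qed

lemma jump_op_pow_exp_le:
  assumes "0 < y" "y \<le> b" "0 \<le> r"
  shows "(jump_op ^^ n) (\<lambda>s _. ennreal (r * exp (- s))) s y \<le>
      ennreal ((b powr \<alpha> / (1 + b powr \<alpha>)) ^ n * r * exp (- s))"
  using assms(1,2)
proof (induction n arbitrary: s y)
  case (Suc n)
  let ?r = "(b powr \<alpha> / (1 + b powr \<alpha>)) ^ n * r"
  have "(jump_op ^^ Suc n) (\<lambda>s _. ennreal (r * exp (- s))) s y \<le> jump_op (\<lambda>s _. ennreal (?r * exp (- s))) s y"
    using Suc by (auto intro: jump_op_mono[where b=b])
  also have "\<dots> \<le> ennreal (b powr \<alpha> / (1 + b powr \<alpha>) * ?r * exp (- s))"
    using Suc.prems assms(3) by (intro jump_op_exp_le) (auto simp: add_nonneg_nonneg)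
  finally show ?case by (simp add: mult.assoc)
qed simp

lemma jump_op_pow_tendsto_0:
  assumes le: "\<And>s y. 0 < y \<Longrightarrow> V s y \<le> indicator {..T} s" and x: "0 < x"
  shows "(\<lambda>n. (jump_op ^^ n) V s x) \<longlonglongrightarrow> 0"
proof (rule tendsto_sandwich[OF _ _ tendsto_const])
  let ?\<beta> = "x powr \<alpha> / (1 + x powr \<alpha>)"
  show "\<forall>\<^sub>F n in sequentially. (jump_op ^^ n) V s x \<le> ennreal (?\<beta> ^ n * exp T * exp (- s))"
  proof (intro always_eventually allI)
    fix n
    have "(jump_op ^^ n) V s x \<le> (jump_op ^^ n) (\<lambda>s _. ennreal (exp T * exp (- s))) s x"
    proof (intro jump_op_pow_mono[where b=x] x order_refl)
      fix s z :: real assume "0 < z"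
      have "indicator {..T} s \<le> ennreal (exp T * exp (- s))" by (auto simp: indicator_def mult_exp_exp)
      then show "V s z \<le> ennreal (exp T * exp (- s))" using le[OF \<open>0 < z\<close>] by (rule order_trans[rotated])
    qed
    also have "\<dots> \<le> ennreal (?\<beta> ^ n * exp T * exp (- s))" using x by (intro jump_op_pow_exp_le) auto
    finally show "(jump_op ^^ n) V s x \<le> ennreal (?\<beta> ^ n * exp T * exp (- s))" .
  qed
  have "(\<lambda>n. ?\<beta> ^ n * exp T * exp (- s)) \<longlonglongrightarrow> 0 * exp T * exp (- s)"
    using x by (intro tendsto_intros LIMSEQ_realpow_zero) (auto simp: divide_less_eq add_pos_pos)
  from tendsto_ennrealI[OF this]
  show "(\<lambda>n. ennreal (?\<beta> ^ n * exp T * exp (- s))) \<longlonglongrightarrow> 0" by simp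
qed auto

lemma renewal_equation_unique:
  assumes V: "borel_measurable2 V" and g: "borel_measurable2 g"
    and renewal: "\<And>s y. 0 < y \<Longrightarrow> V s y = g s y + jump_op V s y"
    and le: "\<And>s y. 0 < y \<Longrightarrow> V s y \<le> indicator {..T} s"
    and x: "0 < x"
  shows "V s x = (\<Sum>n. (jump_op ^^ n) g s x)"
proof -
  have split: "V s x = (\<Sum>n<N. (jump_op ^^ n) g s x) + (jump_op ^^ N) V s x" for N
  proof (induction N)
    case (Suc N)
    have "(jump_op ^^ N) V s x = (jump_op ^^ N) (\<lambda>s y. g s y + jump_op V s y) s x"
      using renewal x by (intro jump_op_pow_cong) auto
    also have "\<dots> = (jump_op ^^ N) g s x + (jump_op ^^ Suc N) V s x"
      by (simp add: jump_op_pow_add g V borel_measurable2_jump_op funpow_swap1)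
    finally show ?case using Suc.IH by (simp add: add.assoc)
  qed simp
  have "(\<lambda>N. (\<Sum>n<N. (jump_op ^^ n) g s x) + (jump_op ^^ N) V s x) \<longlonglongrightarrow> (\<Sum>n. (jump_op ^^ n) g s x) + 0"
    using jump_op_pow_tendsto_0[OF le x] by (intro tendsto_add summable_LIMSEQ summableI)
  then show ?thesis
    unfolding split[symmetric] by (simp add: LIMSEQ_const_iff)
qed

lemma jump_op_indicator_atMost:
  assumes "0 < y"
  shows "jump_op (\<lambda>s _. indicator {..t} s) s y =
      indicator {..t} s * ennreal (1 - exp (- ((t - s) * y powr \<alpha>)))"
proof -
  define l where "l = y powr \<alpha>"
  have l: "0 < l" using assms by (simp add: l_def)
  have "indicator {..t} (s + e / l) = (indicator {..(t - s) * l} e :: ennreal)" for e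
    using l by (auto simp: indicator_def field_simps)
  then have "jump_op (\<lambda>s _. indicator {..t} s) s y = (\<integral>\<^sup>+e. indicator {..(t - s) * l} e \<partial>hold_law)"
    by (simp add: jump_op_def l_def[symmetric])
  also have "\<dots> = emeasure hold_law {..(t - s) * l}" by simp
  also have "\<dots> = indicator {..t} s * ennreal (1 - exp (- ((t - s) * l)))"
  proof (cases "s \<le> t")
    case False
    then have "(t - s) * l < 0" using l by (intro mult_neg_pos) auto
    then have "emeasure hold_law {..(t - s) * l} \<le> emeasure hold_law {..0}" by (intro emeasure_mono) auto
    then show ?thesis using False by (simp add: emeasure_hold_law_atMost)
  qed (use l in \<open>simp add: emeasure_hold_law_atMost\<close>)
  finally show ?thesis by (simp add: l_def)
qed

lemma transition_indicator_pos:
  assumes "0 < x" "0 \<le> t" shows "transition t (indicator {0<..}) x = 1"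
proof -
  have "indicator {..t} 0 = (\<Sum>n. (jump_op ^^ n) (hold_until t (\<lambda>_. 1)) 0 x)"
  proof (rule renewal_equation_unique[where T=t and V="\<lambda>s _. indicator {..t} s"])
    show "borel_measurable2 (\<lambda>s _. indicator {..t} s)" unfolding split_beta by measurable
    show "indicator {..t} s = hold_until t (\<lambda>_. 1) s y + jump_op (\<lambda>s _. indicator {..t} s) s y"
      if "0 < y" for s y
      using that by (cases "s \<le> t") (simp_all add: jump_op_indicator_atMost hold_until_def survival_def
        flip: ennreal_plus)
  qed (auto intro: borel_measurable2_hold_until assms)
  also have "\<dots> = (\<Sum>n. (jump_op ^^ n) (hold_until t (indicator {0<..})) 0 x)"
    using assms by (intro suminf_cong jump_op_pow_cong) (auto simp: hold_until_def)
  also have "\<dots> = transition t (indicator {0<..}) x"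
    using assms by (intro transition_eq_suminf_jump_op[symmetric]) auto
  finally show ?thesis using assms by simp
qed

lemma AE_Yproc_pos:
  assumes "0 < x" "0 \<le> t" shows "AE \<omega> in noise_law. 0 < Yproc \<alpha> (x, \<omega>) t"
proof (rule noise.AE_prob_1[THEN AE_mp])
  have "emeasure noise_law {\<omega> \<in> space noise_law. 0 < Yproc \<alpha> (x, \<omega>) t} =
      (\<integral>\<^sup>+\<omega>. indicator {\<omega> \<in> space noise_law. 0 < Yproc \<alpha> (x, \<omega>) t} \<omega> \<partial>noise_law)"
    by (rule nn_integral_indicator[symmetric]) measurable
  also have "\<dots> = transition t (indicator {0<..}) x"
    unfolding transition_def by (intro nn_integral_cong) (auto simp: indicator_def)
  finally show "measure noise_law {\<omega> \<in> space noise_law. 0 < Yproc \<alpha> (x, \<omega>) t} = 1"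
    using transition_indicator_pos[OF assms] by (simp add: measure_def)
qed (auto intro!: AE_I2)

lemma transition_cong:
  assumes "0 < x" "0 \<le> t" "\<And>y. 0 < y \<Longrightarrow> f y = g y"
  shows "transition t f x = transition t g x"
  unfolding transition_def using AE_Yproc_pos[OF assms(1,2)]
  by (intro nn_integral_cong_AE) (auto elim: eventually_mono simp: assms(3))

definition renewal_series :: "real \<Rightarrow> (real \<Rightarrow> ennreal) \<Rightarrow> real \<Rightarrow> real \<Rightarrow> ennreal" where
  "renewal_series t f s x = (\<Sum>n. (jump_op ^^ n) (hold_until t f) s x)"

lemma borel_measurable2_renewal_series:
  assumes "f \<in> borel_measurable borel" shows "borel_measurable2 (renewal_series t f)"
proof -
  have [measurable]: "borel_measurable2 ((jump_op ^^ n) (hold_until t f))" for n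
    by (intro borel_measurable2_jump_op_pow borel_measurable2_hold_until assms)
  have "(\<lambda>p. \<Sum>n. case_prod ((jump_op ^^ n) (hold_until t f)) p) \<in> borel_measurable (borel \<Otimes>\<^sub>M borel)"
    by measurable
  then show ?thesis by (simp add: renewal_series_def split_beta')
qed

lemma renewal_series_eq_transition:
  assumes [measurable]: "f \<in> borel_measurable borel" and "0 < x" "s \<le> t"
  shows "renewal_series t f s x = transition (t - s) f x"
proof -
  let ?f = "\<lambda>y. indicator {0<..} y * f y"
  have "(jump_op ^^ n) (hold_until t f) s x = (jump_op ^^ n) (hold_until (t - s) ?f) 0 x" for n
  proof -
    have "(jump_op ^^ n) (hold_until t f) s x = (jump_op ^^ n) (hold_until t ?f) s x"
      using assms by (intro jump_op_pow_cong) (auto simp: hold_until_def)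
    also have "\<dots> = (jump_op ^^ n) (hold_until (t - s) ?f) 0 x"
      using assms by (subst (1 2) jump_op_pow_hold_until) (auto intro!: nn_integral_cong simp: algebra_simps)
    finally show ?thesis .
  qed
  then have "renewal_series t f s x = transition (t - s) ?f x"
    unfolding renewal_series_def using assms by (subst transition_eq_suminf_jump_op) auto
  also have "\<dots> = transition (t - s) f x" using assms by (intro transition_cong) auto
  finally show ?thesis .
qed

lemma renewal_series_eq_0:
  assumes [measurable]: "f \<in> borel_measurable borel" and "0 < x" "t < s"
  shows "renewal_series t f s x = 0"
proof -
  have "(jump_op ^^ n) (hold_until t f) s x = 0" for n
  proof -
    have "AE \<omega> in noise_law. 0 \<le> jtime \<alpha> (x, \<omega>) n"
      using AE_noise_law by eventually_elim (use jtime_mono[of _ 0 n \<alpha> x] in auto)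
    then show ?thesis
      using \<open>t < s\<close> unfolding jump_op_pow_hold_until[OF assms(1,2)]
      by (subst nn_integral_0_iff_AE) (auto elim!: eventually_mono)
  qed
  then show ?thesis by (simp add: renewal_series_def)
qed

lemma renewal_series_renewal:
  assumes "f \<in> borel_measurable borel"
  shows "renewal_series t f s x = hold_until t f s x + jump_op (renewal_series t f) s x"
proof -
  have "jump_op (renewal_series t f) s x = (\<Sum>n. (jump_op ^^ Suc n) (hold_until t f) s x)"
    unfolding renewal_series_def
    by (subst jump_op_suminf) (auto intro!: borel_measurable2_jump_op_pow borel_measurable2_hold_until assms)
  moreover have "renewal_series t f s x =
      (jump_op ^^ 0) (hold_until t f) s x + (\<Sum>n. (jump_op ^^ Suc n) (hold_until t f) s x)"
    unfolding renewal_series_def by (subst suminf_offset[where i=1]) (auto intro: summableI)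
  ultimately show ?thesis by simp
qed

lemma jump_op_density:
  assumes "borel_measurable2 H" "0 < y"
  shows "jump_op H s y = (\<integral>\<^sup>+r. indicator {s<..} r * (ennreal (y powr \<alpha>) * survival (r - s) y) *
    (\<integral>\<^sup>+z. H r (z * y) \<partial>ratio_law) \<partial>lborel)"
proof -
  note [measurable] = borel_measurable2_compose[OF assms(1)]
  define l where "l = y powr \<alpha>"
  have l: "0 < l" using assms by (simp add: l_def)
  let ?W = "\<lambda>r. \<integral>\<^sup>+z. H r (z * y) \<partial>ratio_law"
  have "jump_op H s y = (\<integral>\<^sup>+e. ?W (s + e / l) \<partial>hold_law)"
    unfolding jump_op_def l_def by (intro jump.Fubini'[symmetric]) measurable
  also have "\<dots> = (\<integral>\<^sup>+e. ennreal (exp (- e)) * indicator {0<..} e * ?W (s + e / l) \<partial>lborel)"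
    by (subst nn_integral_hold_law) auto
  also have "\<dots> = ennreal \<bar>l\<bar> *
      (\<integral>\<^sup>+r. ennreal (exp (- (- s * l + l * r))) * indicator {0<..} (- s * l + l * r) *
      ?W (s + (- s * l + l * r) / l) \<partial>lborel)"
    using l by (intro nn_integral_real_affine) auto
  also have "\<dots> = ennreal l * (\<integral>\<^sup>+r. indicator {s<..} r * survival (r - s) y * ?W r \<partial>lborel)"
  proof -
    have "s + (- s * l + l * r) / l = r" for r using l by (simp add: field_simps)
    moreover have "- s * l + l * r = (r - s) * l" for r by (simp add: algebra_simps)
    moreover have "0 < (r - s) * l \<longleftrightarrow> s < r" for r using l by (simp add: zero_less_mult_iff)
    ultimately show ?thesis
      using l by (simp add: survival_def l_def[symmetric] indicator_def mult_ac)
  qed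
  also have "\<dots> = (\<integral>\<^sup>+r. indicator {s<..} r * (ennreal l * survival (r - s) y) * ?W r \<partial>lborel)"
    by (subst nn_integral_cmult[symmetric]) (auto simp: mult_ac)
  finally show ?thesis unfolding l_def .
qed

lemma transition_first_jump:
  assumes f[measurable]: "f \<in> borel_measurable borel" and "0 < x" "0 \<le> t"
  shows "transition t f x =
      survival t x * f x + (\<integral>\<^sup>+r. indicator {0<..t} r * (ennreal (x powr \<alpha>) * survival r x) *
      (\<integral>\<^sup>+z. transition (t - r) f (z * x) \<partial>ratio_law) \<partial>lborel)"
proof -
  have "(\<integral>\<^sup>+z. renewal_series t f r (z * x) \<partial>ratio_law) =
      indicator {..t} r * (\<integral>\<^sup>+z. transition (t - r) f (z * x) \<partial>ratio_law)" for r
  proof -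
    have "AE z in ratio_law. renewal_series t f r (z * x) = indicator {..t} r * transition (t - r) f (z * x)"
      using assms by (intro AE_ratio_lawI) (simp add: indicator_def renewal_series_eq_transition renewal_series_eq_0)
    then show ?thesis by (subst nn_integral_cmult[symmetric]) (auto intro: nn_integral_cong_AE)
  qed
  then have "jump_op (renewal_series t f) 0 x =
      (\<integral>\<^sup>+r. indicator {0<..t} r * (ennreal (x powr \<alpha>) * survival r x) *
      (\<integral>\<^sup>+z. transition (t - r) f (z * x) \<partial>ratio_law) \<partial>lborel)"
    using assms by (subst jump_op_density)
      (auto intro!: borel_measurable2_renewal_series nn_integral_cong simp: indicator_def)
  moreover have "hold_until t f 0 x = survival t x * f x" using assms by (simp add: hold_until_def)
  ultimately show ?thesis
    using renewal_series_renewal[OF f, of t 0 x] renewal_series_eq_transition[OF f \<open>0 < x\<close>, of 0 t] assms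
    by simp
qed

lemma jump_op_memoryless:
  assumes V: "borel_measurable2 V" and "0 < y" "\<sigma> \<le> s"
  shows "jump_op V \<sigma> y = jump_op (\<lambda>r y. indicator {..s} r * V r y) \<sigma> y + survival (s - \<sigma>) y * jump_op V s y"
proof -
  note [measurable] = borel_measurable2_compose[OF V]
  have "borel_measurable2 (\<lambda>r y. indicator {..s} r * V r y)" unfolding split_beta by measurable
  note jump_op_V' = jump_op_density[OF this \<open>0 < y\<close>] and jump_op_V = jump_op_density[OF V \<open>0 < y\<close>]
  let ?W = "\<lambda>r. \<integral>\<^sup>+z. V r (z * y) \<partial>ratio_law"
  have "jump_op V \<sigma> y = (\<integral>\<^sup>+r. indicator {\<sigma><..} r * (ennreal (y powr \<alpha>) * survival (r - \<sigma>) y) *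
      (indicator {..s} r * ?W r) +
      survival (s - \<sigma>) y * (indicator {s<..} r * (ennreal (y powr \<alpha>) * survival (r - s) y) * ?W r) \<partial>lborel)"
    unfolding jump_op_V
  proof (rule nn_integral_cong)
    fix r
    have "survival (r - \<sigma>) y = survival (s - \<sigma>) y * survival (r - s) y" by (simp flip: survival_add)
    then show "indicator {\<sigma><..} r * (ennreal (y powr \<alpha>) * survival (r - \<sigma>) y) * ?W r =
        indicator {\<sigma><..} r * (ennreal (y powr \<alpha>) * survival (r - \<sigma>) y) * (indicator {..s} r * ?W r) +
        survival (s - \<sigma>) y * (indicator {s<..} r * (ennreal (y powr \<alpha>) * survival (r - s) y) * ?W r)"
      using \<open>\<sigma> \<le> s\<close> by (auto simp: indicator_def mult_ac)
  qed
  also have "\<dots> = jump_op (\<lambda>r y. indicator {..s} r * V r y) \<sigma> y + survival (s - \<sigma>) y * jump_op V s y"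
    unfolding jump_op_V' jump_op_V by (simp add: nn_integral_add nn_integral_cmult)
  finally show ?thesis .
qed

lemma transition_semigroup:
  assumes f[measurable]: "f \<in> borel_measurable borel" and f_le_1: "\<And>y. f y \<le> 1"
    and "0 \<le> s" "0 \<le> t" "0 < x"
  shows "transition (s + t) f x = transition s (transition t f) x"
proof -
  define V where "V = renewal_series (s + t) f"
  define V' where "V' = (\<lambda>\<sigma> y. indicator {..s} \<sigma> * V \<sigma> y)"
  have V: "borel_measurable2 V" unfolding V_def by (rule borel_measurable2_renewal_series) measurable
  note [measurable] = borel_measurable2_compose[OF V]
  have V_eq: "V \<sigma> y = transition (s + t - \<sigma>) f y" if "0 < y" "\<sigma> \<le> s" for \<sigma> y
    unfolding V_def using that \<open>0 \<le> t\<close> by (intro renewal_series_eq_transition) auto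
  have "V' 0 x = (\<Sum>n. (jump_op ^^ n) (hold_until s (transition t f)) 0 x)"
  proof (rule renewal_equation_unique)
    show "borel_measurable2 V'" unfolding V'_def split_beta by measurable
    show "borel_measurable2 (hold_until s (transition t f))"
      by (intro borel_measurable2_hold_until) measurable
    fix \<sigma> y :: real assume y: "0 < y"
    show "V' \<sigma> y \<le> indicator {..s} \<sigma>"
      using y by (auto simp: V'_def indicator_def V_eq intro: transition_le_1 f_le_1)
    show "V' \<sigma> y = hold_until s (transition t f) \<sigma> y + jump_op V' \<sigma> y"
    proof (cases "\<sigma> \<le> s")
      case True
      have "survival (s + t - \<sigma>) y = survival (s - \<sigma>) y * survival t y"
        using survival_add[of "s - \<sigma>" t y] by (simp add: algebra_simps)
      then have "hold_until (s + t) f \<sigma> y = survival (s - \<sigma>) y * hold_until (s + t) f s y"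
        using True \<open>0 \<le> t\<close> by (simp add: hold_until_def mult_ac)
      then have "V \<sigma> y = survival (s - \<sigma>) y * V s y + jump_op V' \<sigma> y"
        using renewal_series_renewal[OF f, of "s + t" \<sigma> y] renewal_series_renewal[OF f, of "s + t" s y]
          jump_op_memoryless[OF V y True]
        by (simp add: V_def[symmetric] V'_def[symmetric] distrib_left add_ac)
      then show ?thesis using True y by (simp add: V'_def hold_until_def V_eq[of y s])
    next
      case False
      have "jump_op V' \<sigma> y \<le> jump_op (\<lambda>r _. indicator {..s} r) \<sigma> y"
        using y by (intro jump_op_mono[where b=y])
          (auto simp: V'_def indicator_def V_eq intro: transition_le_1 f_le_1)
      then show ?thesis
        using False y by (simp add: jump_op_indicator_atMost V'_def hold_until_def)
    qed
  qed (rule \<open>0 < x\<close>)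
  also have "\<dots> = transition s (transition t f) x"
    using renewal_series_eq_transition[of "transition t f" x 0 s] assms by (simp add: renewal_series_def)
  finally show ?thesis using assms by (simp add: V'_def V_eq)
qed

subsection \<open>Mild solutions dominate the semigroup\<close>

definition gain :: "(real \<Rightarrow> ennreal) \<Rightarrow> real \<Rightarrow> ennreal" where
  "gain g x = (\<integral>\<^sup>+z. ennreal ((x / z) powr \<alpha>) * g (x / z) \<partial>ratio_law)"

text \<open>The fragmentation equation in Duhamel form, for densities with respect to \<open>haar\<close>.\<close>
definition mild_solution :: "(real \<Rightarrow> real \<Rightarrow> ennreal) \<Rightarrow> bool" where
  "mild_solution v \<longleftrightarrow> borel_measurable2 v \<and>
    (\<forall>t\<ge>0. \<forall>x>0. survival t x * v 0 x +
      (\<integral>\<^sup>+s. indicator {0<..t} s * survival (t - s) x * gain (v s) x \<partial>lborel) = v t x)"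

text \<open>The expected sum of \<open>H\<close> over the initial and all later pairs (jump time, post-jump state) of a process whose
  density at time \<open>r\<close> is \<open>v r\<close>.\<close>
definition occupation :: "(real \<Rightarrow> real \<Rightarrow> ennreal) \<Rightarrow> (real \<Rightarrow> real \<Rightarrow> ennreal) \<Rightarrow> ennreal" where
  "occupation v H = (\<integral>\<^sup>+x. v 0 x * H 0 x + (\<integral>\<^sup>+r. indicator {0<..} r * gain (v r) x * H r x \<partial>lborel) \<partial>haar)"

lemma
  assumes "mild_solution v"
  shows mild_solution_measurable: "borel_measurable2 v"
    and mild_solution_Duhamel: "0 \<le> t \<Longrightarrow> 0 < x \<Longrightarrow> survival t x * v 0 x +
      (\<integral>\<^sup>+s. indicator {0<..t} s * survival (t - s) x * gain (v s) x \<partial>lborel) = v t x"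
  using assms by (auto simp: mild_solution_def)

lemma borel_measurable2_gain:
  assumes "borel_measurable2 v" shows "borel_measurable2 (\<lambda>r. gain (v r))"
proof -
  note [measurable] = borel_measurable2_compose[OF assms]
  show ?thesis unfolding gain_def split_beta by measurable
qed

lemma gain_adjoint:
  assumes [measurable]: "g \<in> borel_measurable borel" "G \<in> borel_measurable borel"
  shows "(\<integral>\<^sup>+x. gain g x * G x \<partial>haar) =
    (\<integral>\<^sup>+x. ennreal (x powr \<alpha>) * g x * (\<integral>\<^sup>+z. G (z * x) \<partial>ratio_law) \<partial>haar)"
proof -
  interpret haar_ratio: pair_sigma_finite haar ratio_law ..
  have "(\<integral>\<^sup>+x. gain g x * G x \<partial>haar) = (\<integral>\<^sup>+x. \<integral>\<^sup>+z. ennreal ((x / z) powr \<alpha>) * g (x / z) * G x \<partial>ratio_law \<partial>haar)"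
    unfolding gain_def by (intro nn_integral_cong nn_integral_multc[symmetric]) measurable
  also have "\<dots> = (\<integral>\<^sup>+z. \<integral>\<^sup>+x. ennreal ((x / z) powr \<alpha>) * g (x / z) * G x \<partial>haar \<partial>ratio_law)"
    by (rule haar_ratio.Fubini'[symmetric]) measurable
  also have "\<dots> = (\<integral>\<^sup>+z. \<integral>\<^sup>+x. ennreal (x powr \<alpha>) * g x * G (z * x) \<partial>haar \<partial>ratio_law)"
  proof (rule nn_integral_cong_AE, rule AE_ratio_lawI)
    fix z :: real assume "0 < z"
    then show "(\<integral>\<^sup>+x. ennreal ((x / z) powr \<alpha>) * g (x / z) * G x \<partial>haar) =
        (\<integral>\<^sup>+x. ennreal (x powr \<alpha>) * g x * G (z * x) \<partial>haar)"
      using nn_integral_haar_scale[of "\<lambda>x. ennreal ((x / z) powr \<alpha>) * g (x / z) * G x" z] by simp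
  qed
  also have "\<dots> = (\<integral>\<^sup>+x. \<integral>\<^sup>+z. ennreal (x powr \<alpha>) * g x * G (z * x) \<partial>ratio_law \<partial>haar)"
    by (rule haar_ratio.Fubini') measurable
  also have "\<dots> = (\<integral>\<^sup>+x. ennreal (x powr \<alpha>) * g x * (\<integral>\<^sup>+z. G (z * x) \<partial>ratio_law) \<partial>haar)"
    by (intro nn_integral_cong nn_integral_cmult) measurable
  finally show ?thesis .
qed

lemma occupation_hold_until:
  assumes v: "mild_solution v" and [measurable]: "f \<in> borel_measurable borel" and t: "0 \<le> t"
  shows "occupation v (hold_until t f) = (\<integral>\<^sup>+x. v t x * f x \<partial>haar)"
  unfolding occupation_def
proof (rule nn_integral_cong_AE)
  note [measurable] = borel_measurable2_compose[OF borel_measurable2_gain[OF mild_solution_measurable[OF v]]]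
  show "AE x in haar. v 0 x * hold_until t f 0 x +
      (\<integral>\<^sup>+r. indicator {0<..} r * gain (v r) x * hold_until t f r x \<partial>lborel) =
      v t x * f x"
    using AE_haar_pos
  proof eventually_elim
    case (elim x)
    have "(\<integral>\<^sup>+r. indicator {0<..} r * gain (v r) x * hold_until t f r x \<partial>lborel) =
        (\<integral>\<^sup>+r. indicator {0<..t} r * survival (t - r) x * gain (v r) x * f x \<partial>lborel)"
      by (intro nn_integral_cong) (auto simp: hold_until_def indicator_def mult_ac)
    also have "\<dots> = (\<integral>\<^sup>+r. indicator {0<..t} r * survival (t - r) x * gain (v r) x \<partial>lborel) * f x"
      by (rule nn_integral_multc) measurable
    finally have later: "(\<integral>\<^sup>+r. indicator {0<..} r * gain (v r) x * hold_until t f r x \<partial>lborel) = \<dots>" .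
    have initial: "v 0 x * hold_until t f 0 x = survival t x * v 0 x * f x"
      using t by (simp add: hold_until_def mult_ac)
    show ?case
      unfolding later initial by (simp only: distrib_right[symmetric] mild_solution_Duhamel[OF v t elim])
  qed
qed

lemma mild_solution_jump_op:
  assumes v: "mild_solution v" and H: "borel_measurable2 H" and x: "0 < x"
  shows "v 0 x * jump_op H 0 x + (\<integral>\<^sup>+s. indicator {0<..} s * gain (v s) x * jump_op H s x \<partial>lborel) =
    (\<integral>\<^sup>+r. indicator {0<..} r * (ennreal (x powr \<alpha>) * v r x * (\<integral>\<^sup>+z. H r (z * x) \<partial>ratio_law)) \<partial>lborel)"
proof -
  note [measurable] = borel_measurable2_compose[OF H]
    borel_measurable2_compose[OF borel_measurable2_gain[OF mild_solution_measurable[OF v]]]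
  define W where "W r = ennreal (x powr \<alpha>) * (\<integral>\<^sup>+z. H r (z * x) \<partial>ratio_law)" for r
  have [measurable]: "W \<in> borel_measurable borel" unfolding W_def[abs_def] by measurable
  have jump_op_H: "jump_op H s x = (\<integral>\<^sup>+r. indicator {s<..} r * survival (r - s) x * W r \<partial>lborel)" for s
    unfolding jump_op_density[OF H x] W_def by (simp add: mult_ac)
  have initial: "v 0 x * jump_op H 0 x = (\<integral>\<^sup>+r. indicator {0<..} r * (survival r x * v 0 x) * W r \<partial>lborel)"
    unfolding jump_op_H by (subst nn_integral_cmult[symmetric]) (auto simp: mult_ac)
  have "(\<integral>\<^sup>+s. indicator {0<..} s * gain (v s) x * jump_op H s x \<partial>lborel) =
      (\<integral>\<^sup>+s. \<integral>\<^sup>+r. (if 0 < s \<and> s < r then gain (v s) x * survival (r - s) x * W r else 0) \<partial>lborel \<partial>lborel)"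
    unfolding jump_op_H
    by (subst nn_integral_cmult[symmetric]) (auto intro!: nn_integral_cong simp: indicator_def mult_ac)
  also have "\<dots> = (\<integral>\<^sup>+r. \<integral>\<^sup>+s.
      (if 0 < s \<and> s < r then gain (v s) x * survival (r - s) x * W r else 0) \<partial>lborel \<partial>lborel)"
    by (rule lborel_pair.Fubini') measurable
  also have "\<dots> = (\<integral>\<^sup>+r. indicator {0<..} r *
      (\<integral>\<^sup>+s. indicator {0<..r} s * survival (r - s) x * gain (v s) x \<partial>lborel) * W r \<partial>lborel)"
  proof (rule nn_integral_cong)
    fix r
    have "(\<integral>\<^sup>+s. (if 0 < s \<and> s < r then gain (v s) x * survival (r - s) x * W r else 0) \<partial>lborel) =
        (\<integral>\<^sup>+s. indicator {0<..} r * W r * (indicator {0<..r} s * survival (r - s) x * gain (v s) x) \<partial>lborel)"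
      using AE_lborel_singleton[of r]
      by (intro nn_integral_cong_AE) (auto elim!: eventually_mono simp: indicator_def mult_ac)
    then show "(\<integral>\<^sup>+s. (if 0 < s \<and> s < r then gain (v s) x * survival (r - s) x * W r else 0) \<partial>lborel) =
        indicator {0<..} r * (\<integral>\<^sup>+s. indicator {0<..r} s * survival (r - s) x * gain (v s) x \<partial>lborel) * W r"
      by (simp add: nn_integral_cmult mult_ac)
  qed
  finally have "v 0 x * jump_op H 0 x + (\<integral>\<^sup>+s. indicator {0<..} s * gain (v s) x * jump_op H s x \<partial>lborel) =
      (\<integral>\<^sup>+r. indicator {0<..} r * (survival r x * v 0 x) * W r +
        indicator {0<..} r * (\<integral>\<^sup>+s. indicator {0<..r} s * survival (r - s) x * gain (v s) x \<partial>lborel) * W r \<partial>lborel)"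
    unfolding initial by (simp add: nn_integral_add)
  also have "\<dots> = (\<integral>\<^sup>+r. indicator {0<..} r * v r x * W r \<partial>lborel)"
  proof (rule nn_integral_cong)
    fix r
    show "indicator {0<..} r * (survival r x * v 0 x) * W r +
        indicator {0<..} r * (\<integral>\<^sup>+s. indicator {0<..r} s * survival (r - s) x * gain (v s) x \<partial>lborel) * W r =
        indicator {0<..} r * v r x * W r"
      using mild_solution_Duhamel[OF v _ x, of r] by (cases "0 < r") (simp_all flip: distrib_right)
  qed
  finally show ?thesis by (simp add: W_def mult_ac)
qed

lemma occupation_renewal:
  assumes v: "mild_solution v" and H: "borel_measurable2 H"
  shows "occupation v H = (\<integral>\<^sup>+x. v 0 x * H 0 x \<partial>haar) + occupation v (jump_op H)"
proof -
  interpret haar_lborel: pair_sigma_finite haar lborel ..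
  note v2 = mild_solution_measurable[OF v]
  note [measurable] = borel_measurable2_compose[OF H] borel_measurable2_compose[OF v2]
    borel_measurable2_compose[OF borel_measurable2_gain[OF v2]]
  have "occupation v (jump_op H) = (\<integral>\<^sup>+x. \<integral>\<^sup>+r. indicator {0<..} r *
      (ennreal (x powr \<alpha>) * v r x * (\<integral>\<^sup>+z. H r (z * x) \<partial>ratio_law)) \<partial>lborel \<partial>haar)"
    unfolding occupation_def using AE_haar_pos
    by (intro nn_integral_cong_AE) (auto elim!: eventually_mono simp: mild_solution_jump_op[OF v H])
  also have "\<dots> = (\<integral>\<^sup>+r. \<integral>\<^sup>+x. indicator {0<..} r *
      (ennreal (x powr \<alpha>) * v r x * (\<integral>\<^sup>+z. H r (z * x) \<partial>ratio_law)) \<partial>haar \<partial>lborel)"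
    by (rule haar_lborel.Fubini'[symmetric]) measurable
  also have "\<dots> = (\<integral>\<^sup>+r. indicator {0<..} r *
      (\<integral>\<^sup>+x. ennreal (x powr \<alpha>) * v r x * (\<integral>\<^sup>+z. H r (z * x) \<partial>ratio_law) \<partial>haar) \<partial>lborel)"
    by (intro nn_integral_cong nn_integral_cmult) measurable
  also have "\<dots> = (\<integral>\<^sup>+r. indicator {0<..} r * (\<integral>\<^sup>+x. gain (v r) x * H r x \<partial>haar) \<partial>lborel)"
    by (intro nn_integral_cong arg_cong2[where f="(*)"] gain_adjoint[symmetric] refl) measurable
  also have "\<dots> = (\<integral>\<^sup>+r. \<integral>\<^sup>+x. indicator {0<..} r * gain (v r) x * H r x \<partial>haar \<partial>lborel)"
    by (intro nn_integral_cong, subst nn_integral_cmult[symmetric]) (auto simp: mult.assoc)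
  also have "\<dots> = (\<integral>\<^sup>+x. \<integral>\<^sup>+r. indicator {0<..} r * gain (v r) x * H r x \<partial>lborel \<partial>haar)"
    by (rule haar_lborel.Fubini') measurable
  finally show ?thesis unfolding occupation_def[of v H] by (subst nn_integral_add) auto
qed

lemma suminf_jump_op_le_occupation:
  assumes v: "mild_solution v" and H: "borel_measurable2 H"
  shows "(\<Sum>n. \<integral>\<^sup>+x. v 0 x * (jump_op ^^ n) H 0 x \<partial>haar) \<le> occupation v H"
proof (rule suminf_le_const)
  fix N
  have "occupation v H = (\<Sum>n<N. \<integral>\<^sup>+x. v 0 x * (jump_op ^^ n) H 0 x \<partial>haar) + occupation v ((jump_op ^^ N) H)"
  proof (induction N)
    case (Suc N)
    then show ?case
      using occupation_renewal[OF v borel_measurable2_jump_op_pow[OF H], of N] by (simp add: add.assoc)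
  qed simp
  then show "(\<Sum>n<N. \<integral>\<^sup>+x. v 0 x * (jump_op ^^ n) H 0 x \<partial>haar) \<le> occupation v H" by (simp add: le_iff_add)
qed (rule summableI)

lemma mild_solution_dominates_transition:
  assumes v: "mild_solution v" and f[measurable]: "f \<in> borel_measurable borel" and t: "0 \<le> t"
  shows "(\<integral>\<^sup>+x. v 0 x * transition t f x \<partial>haar) \<le> (\<integral>\<^sup>+x. v t x * f x \<partial>haar)"
proof -
  note [measurable] = borel_measurable2_compose[OF mild_solution_measurable[OF v]]
  note hold = borel_measurable2_hold_until[OF f, of t]
  have [measurable]: "(\<lambda>x. (jump_op ^^ n) (hold_until t f) 0 x) \<in> borel_measurable borel" for n
    by (intro borel_measurable2_compose[OF borel_measurable2_jump_op_pow[OF hold]]) auto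
  have "(\<integral>\<^sup>+x. v 0 x * transition t f x \<partial>haar) =
      (\<integral>\<^sup>+x. (\<Sum>n. v 0 x * (jump_op ^^ n) (hold_until t f) 0 x) \<partial>haar)"
    using AE_haar_pos t renewal_series_eq_transition[OF f, of _ 0 t]
    by (intro nn_integral_cong_AE) (auto elim!: eventually_mono simp: renewal_series_def)
  also have "\<dots> = (\<Sum>n. \<integral>\<^sup>+x. v 0 x * (jump_op ^^ n) (hold_until t f) 0 x \<partial>haar)"
    by (rule nn_integral_suminf) measurable
  also have "\<dots> \<le> occupation v (hold_until t f)" by (rule suminf_jump_op_le_occupation[OF v hold])
  also have "\<dots> = (\<integral>\<^sup>+x. v t x * f x \<partial>haar)" by (rule occupation_hold_until[OF v f t])
  finally show ?thesis .
qed

subsection \<open>The perpetuity\<close>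

definition perpetuity_term :: "nat \<Rightarrow> (nat \<Rightarrow> real \<times> real) \<Rightarrow> ennreal" where
  "perpetuity_term n \<omega> = ennreal ((\<Prod>i<n. fst (\<omega> i) powr \<alpha>) * snd (\<omega> n))"

definition perpetuity :: "(nat \<Rightarrow> real \<times> real) \<Rightarrow> ennreal" where
  "perpetuity \<omega> = (\<Sum>n. perpetuity_term n \<omega>)"

lemma measurable_perpetuity_term [measurable]: "perpetuity_term n \<in> borel_measurable noise_law"
  unfolding perpetuity_term_def[abs_def] by measurable

lemma measurable_perpetuity [measurable]: "perpetuity \<in> borel_measurable noise_law"
  unfolding perpetuity_def[abs_def] by measurable

lemma perpetuity_term_Suc_case_nat:
  "perpetuity_term (Suc n) (case_nat (z, e) \<omega>) = ennreal (z powr \<alpha>) * perpetuity_term n \<omega>"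
  by (simp add: perpetuity_term_def prod.lessThan_Suc_shift mult.assoc ennreal_mult' del: prod.lessThan_Suc)

lemma perpetuity_case_nat: "perpetuity (case_nat (z, e) \<omega>) = ennreal e + ennreal (z powr \<alpha>) * perpetuity \<omega>"
proof -
  have "perpetuity (case_nat (z, e) \<omega>) =
      perpetuity_term 0 (case_nat (z, e) \<omega>) + (\<Sum>n. perpetuity_term (Suc n) (case_nat (z, e) \<omega>))"
    unfolding perpetuity_def by (subst suminf_offset[where i=1]) (auto intro: summableI)
  also have "perpetuity_term 0 (case_nat (z, e) \<omega>) = ennreal e" by (simp add: perpetuity_term_def)
  finally show ?thesis by (simp add: perpetuity_term_Suc_case_nat perpetuity_def)
qed

lemma nn_integral_ratio_powr_less_1: "(\<integral>\<^sup>+z. ennreal (z powr \<alpha>) \<partial>ratio_law) < 1"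
proof -
  have "(\<integral>\<^sup>+z. ennreal (z powr \<alpha>) \<partial>ratio_law) < (\<integral>\<^sup>+z. 1 \<partial>ratio_law)"
  proof (rule nn_integral_less)
    show le: "AE z in ratio_law. ennreal (z powr \<alpha>) \<le> 1"
      by (rule AE_ratio_lawI) (use ratio_powr_less_1 in \<open>force intro: less_imp_le\<close>)
    show "(\<integral>\<^sup>+z. ennreal (z powr \<alpha>) \<partial>ratio_law) \<noteq> \<infinity>"
      using nn_integral_mono_AE[OF le] by (auto simp: top_unique)
    show "\<not> (AE z in ratio_law. 1 \<le> ennreal (z powr \<alpha>))"
    proof
      assume "AE z in ratio_law. 1 \<le> ennreal (z powr \<alpha>)"
      moreover have "AE z in ratio_law. z powr \<alpha> < 1" by (rule AE_ratio_lawI) (rule ratio_powr_less_1)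
      ultimately have "AE z in ratio_law. False" by eventually_elim simp
      then show False by simp
    qed
  qed auto
  then show ?thesis by simp
qed

lemma nn_integral_perpetuity_term:
  "(\<integral>\<^sup>+\<omega>. perpetuity_term n \<omega> \<partial>noise_law) = (\<integral>\<^sup>+z. ennreal (z powr \<alpha>) \<partial>ratio_law) ^ n"
proof (induction n)
  case 0
  show ?case
    by (subst nn_integral_noise_law) (auto simp: perpetuity_term_def nn_integral_hold_law_ident)
next
  case (Suc n)
  have "(\<integral>\<^sup>+\<omega>. perpetuity_term (Suc n) \<omega> \<partial>noise_law) =
      (\<integral>\<^sup>+z. \<integral>\<^sup>+e. \<integral>\<^sup>+\<omega>. ennreal (z powr \<alpha>) * perpetuity_term n \<omega> \<partial>noise_law \<partial>hold_law \<partial>ratio_law)"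
    by (subst nn_integral_noise_law) (auto simp: perpetuity_term_Suc_case_nat)
  then show ?case by (simp add: Suc nn_integral_cmult nn_integral_multc)
qed

lemma AE_perpetuity_finite: "AE \<omega> in noise_law. perpetuity \<omega> < \<infinity>"
proof -
  obtain q where q: "(\<integral>\<^sup>+z. ennreal (z powr \<alpha>) \<partial>ratio_law) = ennreal q" "0 \<le> q" "q < 1"
    using nn_integral_ratio_powr_less_1
    by (cases "\<integral>\<^sup>+z. ennreal (z powr \<alpha>) \<partial>ratio_law") (auto simp: ennreal_less_one_iff)
  have "(\<integral>\<^sup>+\<omega>. perpetuity \<omega> \<partial>noise_law) = (\<Sum>n. ennreal (q ^ n))"
    unfolding perpetuity_def using q
    by (subst nn_integral_suminf) (auto simp: nn_integral_perpetuity_term ennreal_power)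
  also have "\<dots> \<noteq> \<infinity>" using q by (subst suminf_ennreal2) (auto intro!: summable_geometric)
  finally have "AE \<omega> in noise_law. perpetuity \<omega> \<noteq> \<infinity>" by (intro nn_integral_PInf_AE) auto
  then show ?thesis by eventually_elim (simp add: less_top)
qed

definition perpetuity_law :: "real measure" where
  "perpetuity_law = distr noise_law borel (\<lambda>\<omega>. enn2real (perpetuity \<omega>))"

lemma sets_perpetuity_law [measurable_cong, simp]: "sets perpetuity_law = sets borel"
  and space_perpetuity_law [simp]: "space perpetuity_law = UNIV"
  by (simp_all add: perpetuity_law_def)

sublocale perpetuity: prob_space perpetuity_law
  unfolding perpetuity_law_def by (rule noise.prob_space_distr) measurable

lemma emeasure_perpetuity_law_UNIV [simp]: "emeasure perpetuity_law UNIV = 1"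
  using perpetuity.emeasure_space_1 by simp

lemma AE_perpetuity_law_pos: "AE i in perpetuity_law. 0 < i"
  unfolding perpetuity_law_def
proof (subst AE_distr_iff)
  show "AE \<omega> in noise_law. 0 < enn2real (perpetuity \<omega>)"
    using AE_noise_law AE_perpetuity_finite
  proof eventually_elim
    case (elim \<omega>)
    then have "0 < perpetuity_term 0 \<omega>" by (simp add: perpetuity_term_def)
    also have "\<dots> \<le> perpetuity \<omega>"
      unfolding perpetuity_def using sum_le_suminf[of "\<lambda>n. perpetuity_term n \<omega>" "{0}"]
      by (simp add: summableI)
    finally show ?case using elim by (simp add: enn2real_positive_iff)
  qed
qed measurable

definition scaled_perpetuity_law :: "real measure" where
  "scaled_perpetuity_law = distr (ratio_law \<Otimes>\<^sub>M perpetuity_law) borel (\<lambda>p. fst p powr \<alpha> * snd p)"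

lemma sets_scaled_perpetuity_law [measurable_cong, simp]: "sets scaled_perpetuity_law = sets borel"
  and space_scaled_perpetuity_law [simp]: "space scaled_perpetuity_law = UNIV"
  by (simp_all add: scaled_perpetuity_law_def)

sublocale ratio_perpetuity: pair_prob_space ratio_law perpetuity_law ..

sublocale scaled_perpetuity: prob_space scaled_perpetuity_law
  unfolding scaled_perpetuity_law_def by (rule ratio_perpetuity.prob_space_distr) measurable

lemma emeasure_scaled_perpetuity_law_UNIV [simp]: "emeasure scaled_perpetuity_law UNIV = 1"
  using scaled_perpetuity.emeasure_space_1 by simp

lemma nn_integral_scaled_perpetuity_law:
  assumes [measurable]: "F \<in> borel_measurable borel"
  shows "(\<integral>\<^sup>+j. F j \<partial>scaled_perpetuity_law) = (\<integral>\<^sup>+z. \<integral>\<^sup>+i. F (z powr \<alpha> * i) \<partial>perpetuity_law \<partial>ratio_law)"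
  unfolding scaled_perpetuity_law_def
  by (subst nn_integral_distr, measurable) (subst perpetuity.nn_integral_fst[symmetric], auto)

lemma AE_scaled_perpetuity_law_pos: "AE j in scaled_perpetuity_law. 0 < j"
  unfolding scaled_perpetuity_law_def
proof (subst AE_distr_iff)
  show "AE p in ratio_law \<Otimes>\<^sub>M perpetuity_law. 0 < fst p powr \<alpha> * snd p"
  proof (rule ratio_perpetuity.AE_pair_measure)
    show "AE z in ratio_law. AE i in perpetuity_law. 0 < fst (z, i) powr \<alpha> * snd (z, i)"
      using AE_perpetuity_law_pos by (intro AE_ratio_lawI) (auto elim!: eventually_mono)
  qed measurable
qed measurable

lemma nn_integral_perpetuity_law:
  assumes [measurable]: "F \<in> borel_measurable borel"
  shows "(\<integral>\<^sup>+i. F i \<partial>perpetuity_law) =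
      (\<integral>\<^sup>+z. \<integral>\<^sup>+e. \<integral>\<^sup>+i. F (e + z powr \<alpha> * i) \<partial>perpetuity_law \<partial>hold_law \<partial>ratio_law)"
proof -
  have "(\<integral>\<^sup>+i. F i \<partial>perpetuity_law) = (\<integral>\<^sup>+\<omega>. F (enn2real (perpetuity \<omega>)) \<partial>noise_law)"
    unfolding perpetuity_law_def by (rule nn_integral_distr) measurable
  also have "\<dots> = (\<integral>\<^sup>+z. \<integral>\<^sup>+e. \<integral>\<^sup>+\<omega>. F (enn2real (perpetuity (case_nat (z, e) \<omega>))) \<partial>noise_law \<partial>hold_law \<partial>ratio_law)"
    by (rule nn_integral_noise_law) measurable
  also have "\<dots> = (\<integral>\<^sup>+z. \<integral>\<^sup>+e. \<integral>\<^sup>+\<omega>. F (e + z powr \<alpha> * enn2real (perpetuity \<omega>)) \<partial>noise_law \<partial>hold_law \<partial>ratio_law)"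
  proof (rule nn_integral_cong, rule nn_integral_cong_AE)
    fix z
    show "AE e in hold_law. (\<integral>\<^sup>+\<omega>. F (enn2real (perpetuity (case_nat (z, e) \<omega>))) \<partial>noise_law) =
        (\<integral>\<^sup>+\<omega>. F (e + z powr \<alpha> * enn2real (perpetuity \<omega>)) \<partial>noise_law)"
      using AE_hold_law_pos
    proof eventually_elim
      case (elim e)
      show ?case
        using AE_perpetuity_finite elim by (intro nn_integral_cong_AE)
          (auto elim!: eventually_mono simp: perpetuity_case_nat enn2real_plus enn2real_mult ennreal_mult_less_top)
    qed
  qed
  also have "\<dots> = (\<integral>\<^sup>+z. \<integral>\<^sup>+e. \<integral>\<^sup>+i. F (e + z powr \<alpha> * i) \<partial>perpetuity_law \<partial>hold_law \<partial>ratio_law)"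
    unfolding perpetuity_law_def by (simp add: nn_integral_distr)
  finally show ?thesis .
qed

lemma nn_integral_perpetuity_law_hold:
  assumes [measurable]: "F \<in> borel_measurable borel"
  shows "(\<integral>\<^sup>+i. F i \<partial>perpetuity_law) = (\<integral>\<^sup>+j. \<integral>\<^sup>+e. F (e + j) \<partial>hold_law \<partial>scaled_perpetuity_law)"
proof -
  interpret perpetuity_hold: pair_prob_space perpetuity_law hold_law ..
  have "(\<integral>\<^sup>+j. \<integral>\<^sup>+e. F (e + j) \<partial>hold_law \<partial>scaled_perpetuity_law) =
      (\<integral>\<^sup>+z. \<integral>\<^sup>+i. \<integral>\<^sup>+e. F (e + z powr \<alpha> * i) \<partial>hold_law \<partial>perpetuity_law \<partial>ratio_law)"
    by (rule nn_integral_scaled_perpetuity_law) measurable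
  also have "\<dots> = (\<integral>\<^sup>+z. \<integral>\<^sup>+e. \<integral>\<^sup>+i. F (e + z powr \<alpha> * i) \<partial>perpetuity_law \<partial>hold_law \<partial>ratio_law)"
    by (intro nn_integral_cong perpetuity_hold.Fubini'[symmetric]) measurable
  finally show ?thesis using nn_integral_perpetuity_law[OF assms] by simp
qed

definition perpetuity_density :: "real \<Rightarrow> ennreal" where
  "perpetuity_density s = (\<integral>\<^sup>+j. (if j \<le> s then ennreal (exp (j - s)) else 0) \<partial>scaled_perpetuity_law)"

lemma measurable_perpetuity_density [measurable]: "perpetuity_density \<in> borel_measurable borel"
  unfolding perpetuity_density_def[abs_def] by measurable

lemma perpetuity_density_le_1: "perpetuity_density s \<le> 1"
proof -
  have "perpetuity_density s \<le> (\<integral>\<^sup>+j. 1 \<partial>scaled_perpetuity_law)"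
    unfolding perpetuity_density_def by (intro nn_integral_mono) auto
  then show ?thesis by simp
qed

lemma nn_integral_perpetuity_law_density:
  assumes [measurable]: "F \<in> borel_measurable borel"
  shows "(\<integral>\<^sup>+i. F i \<partial>perpetuity_law) = (\<integral>\<^sup>+s. perpetuity_density s * F s \<partial>lborel)"
proof -
  interpret scaled_lborel: pair_sigma_finite scaled_perpetuity_law lborel ..
  have "(\<integral>\<^sup>+e. F (e + j) \<partial>hold_law) = (\<integral>\<^sup>+s. (if j \<le> s then ennreal (exp (j - s)) else 0) * F s \<partial>lborel)" for j
  proof -
    have "(\<integral>\<^sup>+e. F (e + j) \<partial>hold_law) = (\<integral>\<^sup>+e. ennreal (exp (- e)) * indicator {0<..} e * F (e + j) \<partial>lborel)"
      by (rule nn_integral_hold_law) measurable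
    also have "\<dots> = (\<integral>\<^sup>+s. ennreal (exp (- (- j + s))) * indicator {0<..} (- j + s) * F (- j + s + j) \<partial>lborel)"
      by (subst nn_integral_real_affine[where c=1 and t="-j"]) (auto simp: algebra_simps)
    also have "\<dots> = (\<integral>\<^sup>+s. (if j \<le> s then ennreal (exp (j - s)) else 0) * F s \<partial>lborel)"
      using AE_lborel_singleton[of j]
      by (intro nn_integral_cong_AE) (auto elim!: eventually_mono simp: indicator_def)
    finally show ?thesis .
  qed
  then have "(\<integral>\<^sup>+i. F i \<partial>perpetuity_law) =
      (\<integral>\<^sup>+j. \<integral>\<^sup>+s. (if j \<le> s then ennreal (exp (j - s)) else 0) * F s \<partial>lborel \<partial>scaled_perpetuity_law)"
    by (simp add: nn_integral_perpetuity_law_hold)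
  also have "\<dots> = (\<integral>\<^sup>+s. \<integral>\<^sup>+j. (if j \<le> s then ennreal (exp (j - s)) else 0) *
      F s \<partial>scaled_perpetuity_law \<partial>lborel)"
    by (rule scaled_lborel.Fubini'[symmetric]) measurable
  also have "\<dots> = (\<integral>\<^sup>+s. perpetuity_density s * F s \<partial>lborel)"
    unfolding perpetuity_density_def by (intro nn_integral_cong nn_integral_multc) measurable
  finally show ?thesis .
qed

subsection \<open>Positivity of the density\<close>

lemma ratio_powr_atMost_not_null:
  obtains q where "0 < q" "q < 1" "emeasure ratio_law {z. z powr \<alpha> \<le> q} \<noteq> 0"
proof -
  obtain r where r: "(\<integral>\<^sup>+z. ennreal (z powr \<alpha>) \<partial>ratio_law) < r" "r < 1"
    using dense[OF nn_integral_ratio_powr_less_1] by blast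
  then obtain q where q: "r = ennreal q" by (cases r) auto
  have "0 < q" using r(1) q by (metis ennreal_neg linorder_not_less not_less_zero)
  moreover have "q < 1" using r(2) q by (simp add: ennreal_less_one_iff)
  moreover have "emeasure ratio_law {z. z powr \<alpha> \<le> q} \<noteq> 0"
  proof
    assume "emeasure ratio_law {z. z powr \<alpha> \<le> q} = 0"
    then have "AE z in ratio_law. q < z powr \<alpha>" by (subst AE_iff_measurable[OF _ refl]) (auto simp: not_less)
    then have "ennreal q \<le> (\<integral>\<^sup>+z. ennreal (z powr \<alpha>) \<partial>ratio_law)"
      by (intro ratio.nn_integral_ge_const) (auto elim!: eventually_mono intro: ennreal_leI)
    then show False using r(1) q by (simp add: not_less[symmetric])
  qed
  ultimately show ?thesis by (rule that)
qed

lemma perpetuity_law_atMost_step: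
  assumes q: "emeasure ratio_law {z. z powr \<alpha> \<le> q} \<noteq> 0" and c: "emeasure perpetuity_law {..c} \<noteq> 0" "0 < c"
    and d: "0 < d"
  shows "emeasure perpetuity_law {..q * c + d} \<noteq> 0"
proof -
  have "emeasure ratio_law {z. z powr \<alpha> \<le> q} * (emeasure hold_law {..d} * emeasure perpetuity_law {..c}) =
      (\<integral>\<^sup>+z. \<integral>\<^sup>+e. \<integral>\<^sup>+i. indicator {z. z powr \<alpha> \<le> q} z * (indicator {..d} e * indicator {..c} i)
      \<partial>perpetuity_law \<partial>hold_law \<partial>ratio_law)"
    by (simp add: nn_integral_cmult nn_integral_multc)
  also have "\<dots> \<le> (\<integral>\<^sup>+z. \<integral>\<^sup>+e. \<integral>\<^sup>+i.
      indicator {..q * c + d} (e + z powr \<alpha> * i) \<partial>perpetuity_law \<partial>hold_law \<partial>ratio_law)"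
  proof (intro nn_integral_mono)
    fix z e i :: real
    have "e + z powr \<alpha> * i \<le> q * c + d" if "z powr \<alpha> \<le> q" "e \<le> d" "i \<le> c"
    proof -
      have "z powr \<alpha> * i \<le> z powr \<alpha> * c" using that by (intro mult_left_mono) auto
      also have "\<dots> \<le> q * c" using that c by (intro mult_right_mono) auto
      finally show ?thesis using that by simp
    qed
    then show "indicator {z. z powr \<alpha> \<le> q} z * (indicator {..d} e * indicator {..c} i) \<le>
        (indicator {..q * c + d} (e + z powr \<alpha> * i) :: ennreal)"
      by (auto simp: indicator_def)
  qed
  also have "\<dots> = emeasure perpetuity_law {..q * c + d}"
    by (subst nn_integral_perpetuity_law[symmetric]) auto
  finally show ?thesis using q c d by (auto simp: emeasure_hold_law_atMost)
qed

lemma perpetuity_law_atMost_not_null: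
  assumes "0 < s" shows "emeasure perpetuity_law {..s} \<noteq> 0"
proof -
  define C where "C = {c. 0 < c \<and> emeasure perpetuity_law {..c} \<noteq> 0}"
  obtain q where q: "0 < q" "q < 1" "emeasure ratio_law {z. z powr \<alpha> \<le> q} \<noteq> 0"
    by (rule ratio_powr_atMost_not_null)
  have "(\<lambda>n. emeasure perpetuity_law {..real (Suc n)}) \<longlonglongrightarrow> emeasure perpetuity_law (\<Union>n. {..real (Suc n)})"
    by (rule Lim_emeasure_incseq) (auto simp: incseq_def)
  moreover have "(\<Union>n. {..real (Suc n)}) = UNIV"
  proof -
    have "\<exists>n. i \<le> real (Suc n)" for i :: real
      using real_arch_simple[of i] by (metis le_SucI of_nat_le_iff order_refl order_trans)
    then show ?thesis by auto
  qed
  ultimately have "(\<lambda>n. emeasure perpetuity_law {..real (Suc n)}) \<longlonglongrightarrow> 1"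
    by (simp only: emeasure_perpetuity_law_UNIV)
  then have "\<not> (\<forall>n. emeasure perpetuity_law {..real (Suc n)} = 0)"
    using LIMSEQ_unique[OF _ tendsto_const[of 0]] by fastforce
  then obtain n where "emeasure perpetuity_law {..real (Suc n)} \<noteq> 0" by blast
  then have "C \<noteq> {}" by (auto simp: C_def intro!: exI[of _ "real (Suc n)"])
  have bdd: "bdd_below C" by (auto simp: C_def intro!: bdd_belowI[of _ 0])
  have "Inf C \<le> 0"
  proof (rule ccontr)
    assume "\<not> Inf C \<le> 0"
    then have "Inf C < 2 / (1 + q) * Inf C" using q by (simp add: field_simps)
    then obtain c where c: "c \<in> C" "c < 2 / (1 + q) * Inf C"
      using cInf_less_iff[OF \<open>C \<noteq> {}\<close> bdd] by blast
    then have "emeasure perpetuity_law {..q * c + (1 - q) / 2 * c} \<noteq> 0"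
      using q by (intro perpetuity_law_atMost_step) (auto simp: C_def)
    then have "(1 + q) / 2 * c \<in> C" using c(1) q by (simp add: C_def field_simps add_pos_pos)
    then have "Inf C \<le> (1 + q) / 2 * c" by (rule cInf_lower[OF _ bdd])
    also have "\<dots> < Inf C" using c(2) q by (simp add: field_simps)
    finally show False by simp
  qed
  then obtain c where "c \<in> C" "c < s" using assms cInf_less_iff[OF \<open>C \<noteq> {}\<close> bdd, of s] by auto
  then show ?thesis
    using emeasure_mono[of "{..c}" "{..s}" perpetuity_law] by (auto simp: C_def)
qed

lemma perpetuity_density_pos:
  assumes "0 < s" shows "0 < perpetuity_density s"
proof -
  have "0 < emeasure perpetuity_law {..s}"
    using perpetuity_law_atMost_not_null[OF assms] by (simp add: zero_less_iff_neq_zero)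
  also have "\<dots> = (\<integral>\<^sup>+z. \<integral>\<^sup>+i. indicator {..s} i \<partial>perpetuity_law \<partial>ratio_law)" by simp
  also have "\<dots> \<le> (\<integral>\<^sup>+z. \<integral>\<^sup>+i. indicator {..s} (z powr \<alpha> * i) \<partial>perpetuity_law \<partial>ratio_law)"
  proof (intro nn_integral_mono_AE AE_ratio_lawI)
    fix z :: real assume "0 < z" "z < 1"
    then have shrink: "z powr \<alpha> * i \<le> i" if "0 < i" for i
      using ratio_powr_less_1[of z] that by (simp add: mult_le_cancel_right1)
    show "AE i in perpetuity_law. indicator {..s} i \<le> (indicator {..s} (z powr \<alpha> * i) :: ennreal)"
      using AE_perpetuity_law_pos
    proof eventually_elim
      case (elim i)
      from shrink[OF elim] show ?case by (intro indicator_leI) (simp only: atMost_iff)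
    qed
  qed
  also have "\<dots> = emeasure scaled_perpetuity_law {..s}"
    by (subst nn_integral_scaled_perpetuity_law[symmetric]) auto
  finally have "0 < ennreal (exp (- s)) * emeasure scaled_perpetuity_law {..s}"
    by (simp add: ennreal_zero_less_mult_iff)
  also have "\<dots> = (\<integral>\<^sup>+j. ennreal (exp (- s)) * indicator {..s} j \<partial>scaled_perpetuity_law)"
    by (rule nn_integral_cmult_indicator[symmetric]) simp
  also have "\<dots> \<le> perpetuity_density s"
    unfolding perpetuity_density_def using AE_scaled_perpetuity_law_pos
    by (intro nn_integral_mono_AE) (auto elim!: eventually_mono simp: indicator_def ennreal_leI)
  finally show ?thesis .
qed

subsection \<open>The self-similar flow\<close>

definition self_similar_flow :: "real \<Rightarrow> real \<Rightarrow> ennreal" where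
  "self_similar_flow t x = perpetuity_density ((1 + t) * x powr \<alpha>)"

lemma borel_measurable2_self_similar_flow: "borel_measurable2 self_similar_flow"
  unfolding self_similar_flow_def split_beta by measurable

lemma nn_integral_scaled_perpetuity_law_gain:
  assumes [measurable]: "F \<in> borel_measurable borel" and x: "0 < x"
  shows "(\<integral>\<^sup>+j. F j \<partial>scaled_perpetuity_law) =
    (\<integral>\<^sup>+r. gain (self_similar_flow r) x * F ((1 + r) * x powr \<alpha>) \<partial>lborel)"
proof -
  interpret lborel_ratio: pair_sigma_finite lborel ratio_law ..
  note [measurable] = borel_measurable2_compose[OF borel_measurable2_self_similar_flow]
  let ?g = "\<lambda>r z. ennreal ((x / z) powr \<alpha>) * self_similar_flow r (x / z) * F ((1 + r) * x powr \<alpha>)"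
  have "(\<integral>\<^sup>+j. F j \<partial>scaled_perpetuity_law) =
      (\<integral>\<^sup>+z. \<integral>\<^sup>+s. perpetuity_density s * F (z powr \<alpha> * s) \<partial>lborel \<partial>ratio_law)"
    by (simp add: nn_integral_scaled_perpetuity_law nn_integral_perpetuity_law_density)
  also have "\<dots> = (\<integral>\<^sup>+z. \<integral>\<^sup>+r. ?g r z \<partial>lborel \<partial>ratio_law)"
  proof (rule nn_integral_cong_AE, rule AE_ratio_lawI)
    fix z :: real assume z: "0 < z"
    define b where "b = (x / z) powr \<alpha>"
    have b: "0 < b" "x powr \<alpha> = z powr \<alpha> * b" using x z by (simp_all add: b_def powr_divide)
    have "(\<integral>\<^sup>+s. perpetuity_density s * F (z powr \<alpha> * s) \<partial>lborel) =
        ennreal b * (\<integral>\<^sup>+r. perpetuity_density (b + b * r) * F (z powr \<alpha> * (b + b * r)) \<partial>lborel)"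
      using b(1) nn_integral_real_affine[of "\<lambda>s. perpetuity_density s * F (z powr \<alpha> * s)" b b] by simp
    also have "\<dots> = (\<integral>\<^sup>+r. ?g r z \<partial>lborel)"
      using b by (subst nn_integral_cmult[symmetric])
        (auto intro!: nn_integral_cong simp: self_similar_flow_def b_def[symmetric] algebra_simps)
    finally show "(\<integral>\<^sup>+s. perpetuity_density s * F (z powr \<alpha> * s) \<partial>lborel) = (\<integral>\<^sup>+r. ?g r z \<partial>lborel)" .
  qed
  also have "\<dots> = (\<integral>\<^sup>+r. \<integral>\<^sup>+z. ?g r z \<partial>ratio_law \<partial>lborel)" by (rule lborel_ratio.Fubini') measurable
  also have "\<dots> = (\<integral>\<^sup>+r. gain (self_similar_flow r) x * F ((1 + r) * x powr \<alpha>) \<partial>lborel)"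
    unfolding gain_def by (intro nn_integral_cong nn_integral_multc) measurable
  finally show ?thesis .
qed

lemma mild_solution_self_similar_flow: "mild_solution self_similar_flow"
  unfolding mild_solution_def
proof (intro conjI allI impI)
  fix t x :: real assume t: "0 \<le> t" and x: "0 < x"
  define l where "l = x powr \<alpha>"
  have l: "0 < l" using x by (simp add: l_def)
  define F where "F j = (if l < j \<and> j \<le> (1 + t) * l then ennreal (exp (j - (1 + t) * l)) else 0)" for j
  have [measurable]: "F \<in> borel_measurable borel" unfolding F_def[abs_def] by measurable
  have "self_similar_flow t x =
      (\<integral>\<^sup>+j. survival t x * (if j \<le> l then ennreal (exp (j - l)) else 0) + F j \<partial>scaled_perpetuity_law)"
    unfolding self_similar_flow_def perpetuity_density_def l_def[symmetric]
  proof (rule nn_integral_cong)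
    fix j
    have "l \<le> (1 + t) * l" using t l by (simp add: algebra_simps)
    moreover have "ennreal (exp (j - (1 + t) * l)) = survival t x * ennreal (exp (j - l))"
      by (simp add: survival_def l_def[symmetric] mult_exp_exp algebra_simps flip: ennreal_mult)
    ultimately show "(if j \<le> (1 + t) * l then ennreal (exp (j - (1 + t) * l)) else 0) =
        survival t x * (if j \<le> l then ennreal (exp (j - l)) else 0) + F j"
      by (auto simp: F_def)
  qed
  also have "\<dots> = survival t x * self_similar_flow 0 x + (\<integral>\<^sup>+j. F j \<partial>scaled_perpetuity_law)"
    by (simp add: nn_integral_add nn_integral_cmult self_similar_flow_def perpetuity_density_def l_def[symmetric])
  also have "(\<integral>\<^sup>+j. F j \<partial>scaled_perpetuity_law) =
      (\<integral>\<^sup>+s. gain (self_similar_flow s) x * F ((1 + s) * x powr \<alpha>) \<partial>lborel)"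
    by (rule nn_integral_scaled_perpetuity_law_gain) (use x in auto)
  also have "\<dots> = (\<integral>\<^sup>+s. indicator {0<..t} s * survival (t - s) x * gain (self_similar_flow s) x \<partial>lborel)"
  proof (rule nn_integral_cong)
    fix s
    have "l < (1 + s) * l \<longleftrightarrow> 0 < s" "(1 + s) * l \<le> (1 + t) * l \<longleftrightarrow> s \<le> t" using l by auto
    then have "F ((1 + s) * l) = indicator {0<..t} s * survival (t - s) x"
      by (simp add: F_def survival_def l_def[symmetric] algebra_simps)
    then show "gain (self_similar_flow s) x * F ((1 + s) * x powr \<alpha>) =
        indicator {0<..t} s * survival (t - s) x * gain (self_similar_flow s) x"
      by (simp add: l_def mult_ac)
  qed
  finally show "survival t x * self_similar_flow 0 x +
      (\<integral>\<^sup>+s. indicator {0<..t} s * survival (t - s) x * gain (self_similar_flow s) x \<partial>lborel) = self_similar_flow t x"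
    by (rule sym)
qed (rule borel_measurable2_self_similar_flow)

subsection \<open>The logarithmic moment\<close>

definition log_moment :: ennreal where
  "log_moment = (\<integral>\<^sup>+z. ennreal (- ln z) \<partial>ratio_law)"

lemma log_moment_eq: "log_moment = (\<integral>\<^sup>+z\<in>{0<..<1}. ennreal (- ln z * h z * z) \<partial>lborel)"
proof -
  have "log_moment = (\<integral>\<^sup>+z. ratio_density z * ennreal (- ln z) \<partial>lborel)"
    unfolding log_moment_def by (rule nn_integral_ratio_law) measurable
  also have "\<dots> = (\<integral>\<^sup>+z\<in>{0<..<1}. ennreal (- ln z * h z * z) \<partial>lborel)"
  proof (rule nn_integral_cong)
    fix z :: real
    have "ennreal (h z * z) * ennreal (- ln z) = ennreal (- ln z * h z * z)" if "z \<in> {0<..<1}"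
      using that h_nonneg by (subst ennreal_mult[symmetric]) (auto simp: mult_ac)
    then show "ratio_density z * ennreal (- ln z) = ennreal (- ln z * h z * z) * indicator {0<..<1} z"
      by (auto simp: ratio_density_def indicator_def)
  qed
  finally show ?thesis .
qed

text \<open>Both sides are the expected increment of \<open>G\<close> from \<open>\<theta>\<^sup>\<alpha> I\<close> to \<open>I\<close>, since \<open>E + \<theta>\<^sup>\<alpha> I\<close> has the law of \<open>I\<close>.\<close>
lemma perpetuity_increment:
  assumes [measurable]: "G \<in> borel_measurable borel" and D: "borel_measurable2 D"
    and increment: "\<And>x y. 0 < x \<Longrightarrow> x \<le> y \<Longrightarrow> G y = G x + D x y"
    and fin: "(\<integral>\<^sup>+j. G j \<partial>scaled_perpetuity_law) \<noteq> \<infinity>"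
  shows "(\<integral>\<^sup>+j. \<integral>\<^sup>+e. D j (e + j) \<partial>hold_law \<partial>scaled_perpetuity_law) =
    (\<integral>\<^sup>+z. \<integral>\<^sup>+i. D (z powr \<alpha> * i) i \<partial>perpetuity_law \<partial>ratio_law)"
proof -
  note [measurable] = borel_measurable2_compose[OF D]
  have "(\<integral>\<^sup>+j. G j \<partial>scaled_perpetuity_law) + (\<integral>\<^sup>+j. \<integral>\<^sup>+e. D j (e + j) \<partial>hold_law \<partial>scaled_perpetuity_law) =
      (\<integral>\<^sup>+j. \<integral>\<^sup>+e. G j + D j (e + j) \<partial>hold_law \<partial>scaled_perpetuity_law)"
    by (simp add: nn_integral_add)
  also have "\<dots> = (\<integral>\<^sup>+j. \<integral>\<^sup>+e. G (e + j) \<partial>hold_law \<partial>scaled_perpetuity_law)"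
  proof (rule nn_integral_cong_AE)
    show "AE j in scaled_perpetuity_law. (\<integral>\<^sup>+e. G j + D j (e + j) \<partial>hold_law) = (\<integral>\<^sup>+e. G (e + j) \<partial>hold_law)"
      using AE_scaled_perpetuity_law_pos
    proof eventually_elim
      case (elim j)
      then show ?case using AE_hold_law_pos
        by (intro nn_integral_cong_AE) (auto elim!: eventually_mono intro!: increment[symmetric])
    qed
  qed
  also have "\<dots> = (\<integral>\<^sup>+z. \<integral>\<^sup>+i. G i \<partial>perpetuity_law \<partial>ratio_law)"
    by (simp add: nn_integral_perpetuity_law_hold)
  also have "\<dots> = (\<integral>\<^sup>+z. \<integral>\<^sup>+i. G (z powr \<alpha> * i) + D (z powr \<alpha> * i) i \<partial>perpetuity_law \<partial>ratio_law)"
  proof (rule nn_integral_cong_AE, rule AE_ratio_lawI)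
    fix z :: real assume z: "0 < z" "z < 1"
    show "(\<integral>\<^sup>+i. G i \<partial>perpetuity_law) = (\<integral>\<^sup>+i. G (z powr \<alpha> * i) + D (z powr \<alpha> * i) i \<partial>perpetuity_law)"
      using AE_perpetuity_law_pos z ratio_powr_less_1[OF z] by (intro nn_integral_cong_AE)
        (auto elim!: eventually_mono intro!: increment simp: mult_le_cancel_right1)
  qed
  also have "\<dots> = (\<integral>\<^sup>+j. G j \<partial>scaled_perpetuity_law) +
      (\<integral>\<^sup>+z. \<integral>\<^sup>+i. D (z powr \<alpha> * i) i \<partial>perpetuity_law \<partial>ratio_law)"
    by (simp add: nn_integral_add nn_integral_scaled_perpetuity_law)
  finally show ?thesis using fin by (simp add: ennreal_add_left_cancel)
qed

lemma clamp_ln_perpetuity_increment_le: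
  "(\<integral>\<^sup>+j. \<integral>\<^sup>+e. ennreal (clamp_ln n (e + j) - clamp_ln n j) \<partial>hold_law \<partial>scaled_perpetuity_law) \<le>
      ennreal \<alpha> * log_moment"
proof -
  have "(\<integral>\<^sup>+j. shifted_clamp_ln n j \<partial>scaled_perpetuity_law) \<le>
      (\<integral>\<^sup>+j. ennreal (2 * real n) \<partial>scaled_perpetuity_law)"
    by (intro nn_integral_mono shifted_clamp_ln_le)
  then have "(\<integral>\<^sup>+j. shifted_clamp_ln n j \<partial>scaled_perpetuity_law) \<noteq> \<infinity>" by (auto simp: top_unique)
  then have "(\<integral>\<^sup>+j. \<integral>\<^sup>+e. ennreal (clamp_ln n (e + j) - clamp_ln n j) \<partial>hold_law \<partial>scaled_perpetuity_law) =
      (\<integral>\<^sup>+z. \<integral>\<^sup>+i. ennreal (clamp_ln n i - clamp_ln n (z powr \<alpha> * i)) \<partial>perpetuity_law \<partial>ratio_law)"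
    by (intro perpetuity_increment[where G="shifted_clamp_ln n"] shifted_clamp_ln_increment) measurable
  also have "\<dots> \<le> (\<integral>\<^sup>+z. \<integral>\<^sup>+i. ennreal \<alpha> * ennreal (- ln z) \<partial>perpetuity_law \<partial>ratio_law)"
  proof (intro nn_integral_mono_AE AE_ratio_lawI)
    fix z :: real assume z: "0 < z" "z < 1"
    show "AE i in perpetuity_law. ennreal (clamp_ln n i - clamp_ln n (z powr \<alpha> * i)) \<le>
        ennreal \<alpha> * ennreal (- ln z)"
      using AE_perpetuity_law_pos
    proof eventually_elim
      case (elim i)
      have "clamp_ln n i - clamp_ln n (z powr \<alpha> * i) \<le> ln i - ln (z powr \<alpha> * i)"
        using z ratio_powr_less_1[OF z] elim by (intro clamp_ln_diff_le) (auto simp: mult_le_cancel_right1)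
      also have "\<dots> = \<alpha> * (- ln z)" using z elim by (simp add: ln_mult ln_powr)
      finally show ?case using alpha_pos by (simp add: ennreal_leI flip: ennreal_mult')
    qed
  qed
  also have "\<dots> = ennreal \<alpha> * log_moment" by (simp add: log_moment_def nn_integral_cmult)
  finally show ?thesis .
qed

lemma nn_integral_perpetuity_density_haar:
  "(\<integral>\<^sup>+x. perpetuity_density x \<partial>haar) =
    (\<integral>\<^sup>+j. \<integral>\<^sup>+e. ennreal (ln (e + j) - ln j) \<partial>hold_law \<partial>scaled_perpetuity_law)"
proof -
  have "(\<integral>\<^sup>+x. perpetuity_density x \<partial>haar) = (\<integral>\<^sup>+x. perpetuity_density x * ennreal (1 / x) * ennreal x \<partial>haar)"
    using AE_haar_pos
    by (intro nn_integral_cong_AE) (auto elim!: eventually_mono simp: mult.assoc simp flip: ennreal_mult)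
  also have "\<dots> = (\<integral>\<^sup>+s. perpetuity_density s * (ennreal (1 / s) * indicator {0<..} s) \<partial>lborel)"
    by (subst nn_integral_lborel_Ioi_eq_haar[symmetric]) (auto simp: mult.assoc)
  also have "\<dots> = (\<integral>\<^sup>+i. ennreal (1 / i) * indicator {0<..} i \<partial>perpetuity_law)"
    by (rule nn_integral_perpetuity_law_density[symmetric]) measurable
  also have "\<dots> = (\<integral>\<^sup>+j. \<integral>\<^sup>+e. ennreal (1 / (e + j)) *
      indicator {0<..} (e + j) \<partial>hold_law \<partial>scaled_perpetuity_law)"
    by (rule nn_integral_perpetuity_law_hold) measurable
  also have "\<dots> = (\<integral>\<^sup>+j. \<integral>\<^sup>+e. ennreal (ln (e + j) - ln j) \<partial>hold_law \<partial>scaled_perpetuity_law)"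
  proof (rule nn_integral_cong_AE)
    show "AE j in scaled_perpetuity_law. (\<integral>\<^sup>+e. ennreal (1 / (e + j)) * indicator {0<..} (e + j) \<partial>hold_law) =
        (\<integral>\<^sup>+e. ennreal (ln (e + j) - ln j) \<partial>hold_law)"
      using AE_scaled_perpetuity_law_pos
    proof eventually_elim
      case (elim j)
      have "(\<integral>\<^sup>+e. ennreal (1 / (e + j)) * indicator {0<..} (e + j) \<partial>hold_law) =
          (\<integral>\<^sup>+e. ennreal (1 / (e + j)) \<partial>hold_law)"
        using AE_hold_law_pos elim by (intro nn_integral_cong_AE) (auto elim!: eventually_mono)
      also have "\<dots> = (\<integral>\<^sup>+e. ennreal (ln (e + j) - ln (0 + j)) \<partial>hold_law)"
        using elim by (intro nn_integral_hold_law_antiderivative[symmetric])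
          (auto intro!: derivative_eq_intros)
      finally show ?case by simp
    qed
  qed
  finally show ?thesis .
qed

lemma nn_integral_perpetuity_density_haar_le: "(\<integral>\<^sup>+x. perpetuity_density x \<partial>haar) \<le> ennreal \<alpha> * log_moment"
proof -
  have "(\<integral>\<^sup>+x. perpetuity_density x \<partial>haar) =
      (\<integral>\<^sup>+p. ennreal (ln (snd p + fst p) - ln (fst p)) \<partial>(scaled_perpetuity_law \<Otimes>\<^sub>M hold_law))"
    unfolding nn_integral_perpetuity_density_haar by (subst hold.nn_integral_fst[symmetric]) auto
  also have "\<dots> \<le> ennreal \<alpha> * log_moment"
  proof (rule nn_integral_le_of_AE_LIMSEQ)
    show "(\<integral>\<^sup>+p. ennreal (clamp_ln n (snd p + fst p) - clamp_ln n (fst p))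
        \<partial>(scaled_perpetuity_law \<Otimes>\<^sub>M hold_law)) \<le>
        ennreal \<alpha> * log_moment" for n
      using clamp_ln_perpetuity_increment_le[of n] by (subst hold.nn_integral_fst[symmetric]) auto
    show "AE p in scaled_perpetuity_law \<Otimes>\<^sub>M hold_law.
        (\<lambda>n. ennreal (clamp_ln n (snd p + fst p) - clamp_ln n (fst p)))
        \<longlonglongrightarrow> ennreal (ln (snd p + fst p) - ln (fst p))"
      by (intro AE_I2 tendsto_ennrealI tendsto_diff clamp_ln_tendsto)
  qed measurable
  finally show ?thesis .
qed

subsection \<open>Necessity of the logarithmic moment\<close>

definition self_similar :: "(real \<Rightarrow> real) \<Rightarrow> real \<Rightarrow> real \<Rightarrow> real" where
  "self_similar u t x = ((1 + t) powr (1 / \<alpha>))\<^sup>2 * u ((1 + t) powr (1 / \<alpha>) * x)"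

lemma measurable_self_similar [measurable]:
  assumes [measurable]: "u \<in> borel_measurable borel" shows "self_similar u t \<in> borel_measurable borel"
  unfolding self_similar_def[abs_def] by measurable

lemma self_similar_0 [simp]: "self_similar u 0 = u"
  by (simp add: self_similar_def fun_eq_iff)

lemma nn_integral_self_similar:
  assumes [measurable]: "u \<in> borel_measurable borel" "F \<in> borel_measurable borel" and t: "0 \<le> t"
  shows "(\<integral>\<^sup>+x. ennreal (self_similar u t x) * F x \<partial>mm) =
      (\<integral>\<^sup>+x. ennreal (u x) * F (x / (1 + t) powr (1 / \<alpha>)) \<partial>mm)"
proof -
  define c where "c = (1 + t) powr (1 / \<alpha>)"
  have c: "0 < c" using t by (simp add: c_def)
  have "(\<integral>\<^sup>+x. ennreal (self_similar u t x) * F x \<partial>mm) =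
      (\<integral>\<^sup>+x. ennreal (c\<^sup>2) * (ennreal (u (c * x)) * F (c * x / c)) \<partial>mm)"
    using c by (intro nn_integral_cong) (simp add: self_similar_def c_def[symmetric] ennreal_mult' mult.assoc)
  also have "\<dots> = (\<integral>\<^sup>+x. ennreal (u x) * F (x / c) \<partial>mm)"
    using c by (intro nn_integral_mm_scale[where f="\<lambda>x. ennreal (u x) * F (x / c)"]) auto
  finally show ?thesis unfolding c_def .
qed

lemma frag_solution_nn_integral:
  assumes sol: "frag_solution \<alpha> h c0 c" and c0: "c0 \<in> Dm" and t: "0 \<le> t"
    and F[measurable]: "F \<in> borel_measurable borel"
  shows "(\<integral>\<^sup>+x. ennreal (c t x) * F x \<partial>mm) = (\<integral>\<^sup>+x. ennreal (c0 x) * transition t F x \<partial>mm)"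
proof -
  have ct: "c t \<in> Dm" "distr (jump_space h c0) borel (\<lambda>\<omega>. Yproc \<alpha> \<omega> t) = density mm (\<lambda>x. ennreal (c t x))"
    using sol t by (auto simp: frag_solution_def)
  note [measurable] = measurable_Dm[OF ct(1)] measurable_Dm[OF c0]
  show ?thesis
    using nn_integral_distr_jump_space[of c0 F t] unfolding ct(2) by (simp add: nn_integral_density)
qed

definition jump_prob :: "real \<Rightarrow> real \<Rightarrow> ennreal" where
  "jump_prob t x = ennreal (1 - exp (- (t * x powr \<alpha>)))"

lemma measurable_jump_prob [measurable]: "jump_prob t \<in> borel_measurable borel"
  unfolding jump_prob_def[abs_def] by measurable

lemma survival_plus_jump_prob: "0 \<le> t \<Longrightarrow> survival t x + jump_prob t x = 1"
  by (simp add: survival_def jump_prob_def flip: ennreal_plus)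

lemma nn_integral_first_jump_time:
  assumes "0 < x" "0 \<le> t"
  shows "(\<integral>\<^sup>+r. indicator {0<..t} r * (ennreal (x powr \<alpha>) * survival r x) \<partial>lborel) = jump_prob t x"
proof -
  have "borel_measurable2 (\<lambda>s _. indicator {..t} s)" unfolding split_beta by measurable
  from jump_op_density[OF this assms(1), of 0] jump_op_indicator_atMost[OF assms(1), of t 0] assms(2)
  have "(\<integral>\<^sup>+r. indicator {0<..} r * (ennreal (x powr \<alpha>) * survival r x) * indicator {..t} r \<partial>lborel) =
      jump_prob t x"
    by (simp add: jump_prob_def)
  moreover have "indicator {0<..} r * (ennreal (x powr \<alpha>) * survival r x) * indicator {..t} r =
      indicator {0<..t} r * (ennreal (x powr \<alpha>) * survival r x)" for r
    by (auto simp: indicator_def)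
  ultimately show ?thesis by simp
qed

text \<open>The first jump alone makes a monotone function \<open>G\<close> of the state lose this much.\<close>
lemma transition_increment_le:
  assumes [measurable]: "G \<in> borel_measurable borel" and D: "borel_measurable2 D" and G0: "G 0 = 0"
    and increment: "\<And>x y. 0 < x \<Longrightarrow> x \<le> y \<Longrightarrow> G y = G x + D x y" and x: "0 < x" and t: "0 \<le> t"
  shows "transition t G x + jump_prob t x * (\<integral>\<^sup>+z. D (z * x) x \<partial>ratio_law) \<le> G x"
proof -
  note [measurable] = borel_measurable2_compose[OF D]
  have mono: "G a \<le> G b" if "0 < a" "a \<le> b" for a b using increment[OF that] by simp
  have "transition t G x = survival t x * G x +
      (\<integral>\<^sup>+r. indicator {0<..t} r * (ennreal (x powr \<alpha>) * survival r x) *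
      (\<integral>\<^sup>+z. transition (t - r) G (z * x) \<partial>ratio_law) \<partial>lborel)"
    using x t by (intro transition_first_jump) auto
  also have "\<dots> \<le> survival t x * G x + (\<integral>\<^sup>+r. indicator {0<..t} r * (ennreal (x powr \<alpha>) * survival r x) *
      (\<integral>\<^sup>+z. G (z * x) \<partial>ratio_law) \<partial>lborel)"
  proof (intro add_left_mono nn_integral_mono)
    fix r
    show "indicator {0<..t} r * (ennreal (x powr \<alpha>) * survival r x) *
        (\<integral>\<^sup>+z. transition (t - r) G (z * x) \<partial>ratio_law) \<le>
        indicator {0<..t} r * (ennreal (x powr \<alpha>) * survival r x) * (\<integral>\<^sup>+z. G (z * x) \<partial>ratio_law)"
      using x by (cases "r \<in> {0<..t}")
        (auto intro!: mult_left_mono nn_integral_mono_AE AE_ratio_lawI transition_le_of_mono G0 mono)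
  qed
  also have "\<dots> = survival t x * G x + jump_prob t x * (\<integral>\<^sup>+z. G (z * x) \<partial>ratio_law)"
    using x t by (simp add: nn_integral_multc nn_integral_first_jump_time)
  finally have "transition t G x + jump_prob t x * (\<integral>\<^sup>+z. D (z * x) x \<partial>ratio_law) \<le>
      survival t x * G x + jump_prob t x * ((\<integral>\<^sup>+z. G (z * x) \<partial>ratio_law) + (\<integral>\<^sup>+z. D (z * x) x \<partial>ratio_law))"
    by (simp add: distrib_left add_right_mono flip: add.assoc)
  also have "(\<integral>\<^sup>+z. G (z * x) \<partial>ratio_law) + (\<integral>\<^sup>+z. D (z * x) x \<partial>ratio_law) = (\<integral>\<^sup>+z. G x \<partial>ratio_law)"
  proof -
    have "AE z in ratio_law. G (z * x) + D (z * x) x = G x"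
      using x by (intro AE_ratio_lawI increment[symmetric]) (auto simp: mult_le_cancel_right1)
    then have "(\<integral>\<^sup>+z. G (z * x) + D (z * x) x \<partial>ratio_law) = (\<integral>\<^sup>+z. G x \<partial>ratio_law)"
      by (rule nn_integral_cong_AE)
    then show ?thesis by (simp add: nn_integral_add)
  qed
  also have "survival t x * G x + jump_prob t x * (\<integral>\<^sup>+z. G x \<partial>ratio_law) = G x"
    using survival_plus_jump_prob[OF t, of x] by (simp flip: distrib_right)
  finally show ?thesis .
qed

context
  fixes u :: "real \<Rightarrow> real"
  assumes u: "u \<in> Dm" and self_similar_solution: "frag_solution \<alpha> h u (self_similar u)"
begin

lemma self_similar_clamp_ln_loss_le:
  "(\<integral>\<^sup>+x. ennreal (u x) * (jump_prob 1 x *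
      (\<integral>\<^sup>+z. ennreal (clamp_ln n x - clamp_ln n (z * x)) \<partial>ratio_law)) \<partial>mm) \<le>
    ennreal (ln 2 / \<alpha>)"
proof -
  note [measurable] = measurable_Dm[OF u]
  define c where "c = (2::real) powr (1 / \<alpha>)"
  have c: "1 \<le> c" "ln c = ln 2 / \<alpha>" using alpha_pos by (simp_all add: c_def ge_one_powr_ge_zero ln_powr)
  let ?G = "shifted_clamp_ln n"
  let ?loss = "\<lambda>x. jump_prob 1 x * (\<integral>\<^sup>+z. ennreal (clamp_ln n x - clamp_ln n (z * x)) \<partial>ratio_law)"
  have "(\<integral>\<^sup>+x. ennreal (u x) * ?G (x / c) \<partial>mm) + (\<integral>\<^sup>+x. ennreal (u x) * ?loss x \<partial>mm) =
      (\<integral>\<^sup>+x. ennreal (u x) * transition 1 ?G x \<partial>mm) + (\<integral>\<^sup>+x. ennreal (u x) * ?loss x \<partial>mm)"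
    using nn_integral_self_similar[of u ?G 1] frag_solution_nn_integral[OF self_similar_solution u, of 1 ?G]
    by (simp add: c_def)
  also have "\<dots> = (\<integral>\<^sup>+x. ennreal (u x) * (transition 1 ?G x + ?loss x) \<partial>mm)"
    by (simp add: distrib_left nn_integral_add)
  also have "\<dots> \<le> (\<integral>\<^sup>+x. ennreal (u x) * (?G (x / c) + ennreal (ln c)) \<partial>mm)"
  proof (rule nn_integral_mono_AE)
    show "AE x in mm. ennreal (u x) * (transition 1 ?G x + ?loss x) \<le>
        ennreal (u x) * (?G (x / c) + ennreal (ln c))"
      using AE_mm_pos
    proof eventually_elim
      case (elim x)
      have "transition 1 ?G x + ?loss x \<le> ?G x"
        using elim by (intro transition_increment_le shifted_clamp_ln_increment) auto
      also have "\<dots> \<le> ?G (x / c) + ennreal (ln c)" by (intro shifted_clamp_ln_le_divide elim c(1))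
      finally show ?case by (rule mult_left_mono) simp
    qed
  qed
  also have "\<dots> = (\<integral>\<^sup>+x. ennreal (u x) * ?G (x / c) \<partial>mm) + ennreal (ln c)"
    using nn_integral_Dm[OF u] by (simp add: distrib_left nn_integral_add nn_integral_multc)
  finally have "(\<integral>\<^sup>+x. ennreal (u x) * ?G (x / c) \<partial>mm) + (\<integral>\<^sup>+x. ennreal (u x) * ?loss x \<partial>mm) \<le>
      (\<integral>\<^sup>+x. ennreal (u x) * ?G (x / c) \<partial>mm) + ennreal (ln c)" .
  moreover have "(\<integral>\<^sup>+x. ennreal (u x) * ?G (x / c) \<partial>mm) \<le> (\<integral>\<^sup>+x. ennreal (u x) * ennreal (2 * real n) \<partial>mm)"
    by (intro nn_integral_mono mult_left_mono shifted_clamp_ln_le) auto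
  then have "(\<integral>\<^sup>+x. ennreal (u x) * ?G (x / c) \<partial>mm) \<noteq> top"
    using nn_integral_Dm[OF u] by (auto simp: nn_integral_multc top_unique)
  ultimately show ?thesis using c(2) by (simp add: ennreal_add_left_cancel_le)
qed

lemma self_similar_log_loss_le: "(\<integral>\<^sup>+x. ennreal (u x) * jump_prob 1 x \<partial>mm) * log_moment \<le> ennreal (ln 2 / \<alpha>)"
proof -
  note [measurable] = measurable_Dm[OF u]
  interpret mm_ratio: pair_sigma_finite mm ratio_law ..
  have "(\<integral>\<^sup>+x. ennreal (u x) * jump_prob 1 x \<partial>mm) * log_moment =
      (\<integral>\<^sup>+p. ennreal (u (fst p)) * (jump_prob 1 (fst p) * ennreal (- ln (snd p))) \<partial>(mm \<Otimes>\<^sub>M ratio_law))"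
    by (subst ratio.nn_integral_fst[symmetric])
      (auto simp: log_moment_def nn_integral_cmult mult.assoc simp flip: nn_integral_multc)
  also have "\<dots> \<le> ennreal (ln 2 / \<alpha>)"
  proof (rule nn_integral_le_of_AE_LIMSEQ)
    show "(\<integral>\<^sup>+p. ennreal (u (fst p)) *
        (jump_prob 1 (fst p) * ennreal (clamp_ln n (fst p) - clamp_ln n (snd p * fst p)))
        \<partial>(mm \<Otimes>\<^sub>M ratio_law)) \<le> ennreal (ln 2 / \<alpha>)" for n
      using self_similar_clamp_ln_loss_le[of n]
      by (subst ratio.nn_integral_fst[symmetric]) (auto simp: nn_integral_cmult)
    have "AE p in mm \<Otimes>\<^sub>M ratio_law. 0 < fst p \<and> 0 < snd p"
    proof (rule mm_ratio.AE_pair_measure)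
      show "AE x in mm. AE z in ratio_law. 0 < fst (x, z) \<and> 0 < snd (x, z)"
        using AE_mm_pos by eventually_elim (auto intro: AE_ratio_lawI)
    qed measurable
    then show "AE p in mm \<Otimes>\<^sub>M ratio_law.
        (\<lambda>n. ennreal (u (fst p)) * (jump_prob 1 (fst p) * ennreal (clamp_ln n (fst p) - clamp_ln n (snd p * fst p))))
        \<longlonglongrightarrow> ennreal (u (fst p)) * (jump_prob 1 (fst p) * ennreal (- ln (snd p)))"
    proof eventually_elim
      case (elim p)
      have "- ln (snd p) = ln (fst p) - ln (snd p * fst p)" using elim by (simp add: ln_mult)
      then show ?case
        by (auto simp: jump_prob_def
          intro!: ennreal_tendsto_cmult tendsto_ennrealI tendsto_diff clamp_ln_tendsto)
    qed
  qed measurable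
  finally show ?thesis .
qed

theorem log_moment_finite_of_self_similar: "log_moment < \<infinity>"
proof -
  note [measurable] = measurable_Dm[OF u]
  have "(\<integral>\<^sup>+x. ennreal (u x) * jump_prob 1 x \<partial>mm) \<noteq> 0"
  proof
    assume "(\<integral>\<^sup>+x. ennreal (u x) * jump_prob 1 x \<partial>mm) = 0"
    then have "AE x in mm. ennreal (u x) * jump_prob 1 x = 0" by (subst (asm) nn_integral_0_iff_AE) auto
    with AE_mm_pos have "AE x in mm. ennreal (u x) = 0"
      by eventually_elim (auto simp: jump_prob_def ennreal_eq_0_iff)
    then have "(\<integral>\<^sup>+x. ennreal (u x) \<partial>mm) = 0" by (subst nn_integral_0_iff_AE) auto
    with nn_integral_Dm[OF u] show False by simp
  qed
  then show ?thesis
    using self_similar_log_loss_le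
    by (cases "log_moment = \<infinity>") (auto simp: ennreal_mult_top top_unique less_top)
qed

end

subsection \<open>Minorization\<close>

definition ratio_law_minorant :: "real \<Rightarrow> real set \<Rightarrow> bool" where
  "ratio_law_minorant \<delta> B \<longleftrightarrow> (\<forall>F\<in>borel_measurable borel.
    ennreal \<delta> * (\<integral>\<^sup>+v. indicator B v * F (exp (- v)) \<partial>lborel) \<le> (\<integral>\<^sup>+z. F z \<partial>ratio_law))"

lemma nn_integral_ratio_law_exp:
  assumes [measurable]: "f \<in> borel_measurable borel"
  shows "(\<integral>\<^sup>+z. f z \<partial>ratio_law) =
      (\<integral>\<^sup>+v. ratio_density (exp (- v)) * ennreal (exp (- v)) * f (exp (- v)) \<partial>lborel)"
proof -
  have "(\<integral>\<^sup>+z. f z \<partial>ratio_law) = (\<integral>\<^sup>+z. (ratio_density z * f z) * indicator {0<..} z \<partial>lborel)"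
    by (subst nn_integral_ratio_law) (auto intro!: nn_integral_cong simp: ratio_density_def indicator_def)
  also have "\<dots> = (\<integral>\<^sup>+v. (ratio_density (exp v) * f (exp v)) * ennreal (exp v) \<partial>lborel)"
    by (rule nn_integral_lborel_Ioi_exp) measurable
  also have "\<dots> = (\<integral>\<^sup>+v. (ratio_density (exp (- v)) * f (exp (- v))) * ennreal (exp (- v)) \<partial>lborel)"
    using nn_integral_real_affine[of "\<lambda>v. (ratio_density (exp v) * f (exp v)) * ennreal (exp v)" "-1" 0]
    by simp
  finally show ?thesis by (simp add: mult_ac)
qed

lemma exists_ratio_law_minorant:
  obtains \<delta> B p w where "0 < \<delta>" "almost_interval B p w" "ratio_law_minorant \<delta> B"
proof -
  define g where "g v = ratio_density (exp (- v)) * ennreal (exp (- v))" for v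
  have [measurable]: "g \<in> borel_measurable borel" unfolding g_def[abs_def] by measurable
  have ratio_g: "(\<integral>\<^sup>+z. f z \<partial>ratio_law) = (\<integral>\<^sup>+v. g v * f (exp (- v)) \<partial>lborel)"
    if "f \<in> borel_measurable borel" for f
    using nn_integral_ratio_law_exp[OF that] by (simp add: g_def)
  have "(\<integral>\<^sup>+v. g v \<partial>lborel) \<noteq> 0" using ratio_g[of "\<lambda>_. 1"] by simp
  then obtain \<delta> m where \<delta>: "0 < \<delta>" and level: "emeasure lborel {v \<in> {- m..m}. ennreal \<delta> \<le> g v} \<noteq> 0"
    by (rule exists_level_set_not_null[rotated]) measurable
  define A where "A = {v \<in> {- m..m}. ennreal \<delta> \<le> g v}"
  have A[measurable]: "A \<in> sets borel" unfolding A_def by measurable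
  have "A \<subseteq> {- m..m}" "emeasure lborel A \<noteq> 0" using level by (auto simp: A_def)
  then obtain p w where "almost_interval (A \<inter> {p..p + w}) p w" by (rule exists_almost_interval[OF A])
  moreover have "ratio_law_minorant \<delta> (A \<inter> {p..p + w})"
    unfolding ratio_law_minorant_def
  proof
    fix F :: "real \<Rightarrow> ennreal" assume [measurable]: "F \<in> borel_measurable borel"
    have "ennreal \<delta> * (\<integral>\<^sup>+v. indicator (A \<inter> {p..p + w}) v * F (exp (- v)) \<partial>lborel) =
        (\<integral>\<^sup>+v. ennreal \<delta> * (indicator (A \<inter> {p..p + w}) v * F (exp (- v))) \<partial>lborel)"
      by (rule nn_integral_cmult[symmetric]) measurable
    also have "\<dots> \<le> (\<integral>\<^sup>+v. g v * F (exp (- v)) \<partial>lborel)"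
      by (intro nn_integral_mono) (auto simp: indicator_def A_def intro!: mult_right_mono)
    finally show "ennreal \<delta> * (\<integral>\<^sup>+v. indicator (A \<inter> {p..p + w}) v * F (exp (- v)) \<partial>lborel) \<le>
        (\<integral>\<^sup>+z. F z \<partial>ratio_law)"
      by (simp add: ratio_g)
  qed
  ultimately show ?thesis using \<delta> that by blast
qed

lemma transition_ge_no_jump:
  assumes f: "f \<in> borel_measurable borel" and x: "0 < x" "x \<le> b" and t: "0 \<le> t" "t \<le> T"
  shows "survival T b * f x \<le> transition t f x"
proof -
  have "survival T b * f x \<le> survival t x * f x" using x t by (intro mult_right_mono survival_antimono) auto
  also have "\<dots> \<le> transition t f x" unfolding transition_first_jump[OF f x(1) t(1)] by simp
  finally show ?thesis .
qed

lemma transition_ge_first_jump: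
  assumes minorant: "ratio_law_minorant \<delta> B" and [measurable]: "B \<in> sets borel" "f \<in> borel_measurable borel"
    and x: "0 < x" and \<sigma>: "0 \<le> \<sigma>" "\<sigma> \<le> t"
    and W: "\<And>r v. 0 < r \<Longrightarrow> r \<le> \<sigma> \<Longrightarrow> v \<in> B \<Longrightarrow> W v \<le> transition (t - r) f (exp (- v) * x)"
  shows "ennreal \<sigma> * (ennreal (x powr \<alpha>) * survival \<sigma> x) * (ennreal \<delta> * (\<integral>\<^sup>+v. indicator B v * W v \<partial>lborel)) \<le>
    transition t f x"
proof -
  let ?D = "ennreal \<delta> * (\<integral>\<^sup>+v. indicator B v * W v \<partial>lborel)"
  let ?rate = "\<lambda>r. ennreal (x powr \<alpha>) * survival r x"
  have "ennreal \<sigma> * ?rate \<sigma> * ?D = ?rate \<sigma> * ?D * emeasure lborel {0<..\<sigma>}"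
    using \<sigma> by (simp add: mult_ac)
  also have "\<dots> = (\<integral>\<^sup>+r. ?rate \<sigma> * ?D * indicator {0<..\<sigma>} r \<partial>lborel)"
    by (rule nn_integral_cmult_indicator[symmetric]) simp
  also have "\<dots> \<le> (\<integral>\<^sup>+r. indicator {0<..t} r * ?rate r *
      (\<integral>\<^sup>+z. transition (t - r) f (z * x) \<partial>ratio_law) \<partial>lborel)"
  proof (rule nn_integral_mono)
    fix r :: real
    show "?rate \<sigma> * ?D * indicator {0<..\<sigma>} r \<le>
        indicator {0<..t} r * ?rate r * (\<integral>\<^sup>+z. transition (t - r) f (z * x) \<partial>ratio_law)"
    proof (cases "r \<in> {0<..\<sigma>}")
      case True
      have "(\<integral>\<^sup>+v. indicator B v * W v \<partial>lborel) \<le>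
          (\<integral>\<^sup>+v. indicator B v * transition (t - r) f (exp (- v) * x) \<partial>lborel)"
        using W True by (intro nn_integral_mono) (simp add: indicator_def)
      then have "?D \<le> ennreal \<delta> * (\<integral>\<^sup>+v. indicator B v * transition (t - r) f (exp (- v) * x) \<partial>lborel)"
        by (rule mult_left_mono) simp
      also have "\<dots> \<le> (\<integral>\<^sup>+z. transition (t - r) f (z * x) \<partial>ratio_law)"
        using minorant unfolding ratio_law_minorant_def
        by (elim ballE[of _ _ "\<lambda>z. transition (t - r) f (z * x)"]) auto
      finally have "?rate \<sigma> * ?D \<le> ?rate r * (\<integral>\<^sup>+z. transition (t - r) f (z * x) \<partial>ratio_law)"
        using True x by (intro mult_mono mult_left_mono survival_antimono) auto
      then show ?thesis using True \<sigma> by simp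
    qed simp
  qed
  also have "\<dots> \<le> transition t f x"
    using x \<sigma> by (subst transition_first_jump[of f x t]) auto
  finally show ?thesis .
qed

lemma transition_ge_first_jump_uniform:
  assumes minorant: "ratio_law_minorant \<delta> B" and \<delta>: "0 < \<delta>" and B: "B \<in> sets borel"
    and a: "0 < a" and \<sigma>: "0 < \<sigma>"
  obtains d where "0 < d" "\<And>x t f W. x \<in> {a..b} \<Longrightarrow> \<sigma> \<le> t \<Longrightarrow> f \<in> borel_measurable borel \<Longrightarrow>
    (\<And>r v. 0 < r \<Longrightarrow> r \<le> \<sigma> \<Longrightarrow> v \<in> B \<Longrightarrow> W v \<le> transition (t - r) f (exp (- v) * x)) \<Longrightarrow>
    ennreal d * (\<integral>\<^sup>+v. indicator B v * W v \<partial>lborel) \<le> transition t f x"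
proof (rule that)
  let ?d = "\<sigma> * (a powr \<alpha> * exp (- (\<sigma> * b powr \<alpha>))) * \<delta>"
  show "0 < ?d" using a \<sigma> \<delta> by simp
  fix x t and f W :: "real \<Rightarrow> ennreal"
  assume x: "x \<in> {a..b}" and t: "\<sigma> \<le> t" and f: "f \<in> borel_measurable borel"
    and W: "\<And>r v. 0 < r \<Longrightarrow> r \<le> \<sigma> \<Longrightarrow> v \<in> B \<Longrightarrow> W v \<le> transition (t - r) f (exp (- v) * x)"
  let ?D = "ennreal \<delta> * (\<integral>\<^sup>+v. indicator B v * W v \<partial>lborel)"
  have "ennreal ?d * (\<integral>\<^sup>+v. indicator B v * W v \<partial>lborel) =
      ennreal \<sigma> * (ennreal (a powr \<alpha>) * survival \<sigma> b) * ?D"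
    using a \<sigma> \<delta> by (simp add: survival_def ennreal_mult mult.assoc)
  also have "\<dots> \<le> ennreal \<sigma> * (ennreal (x powr \<alpha>) * survival \<sigma> x) * ?D"
    using a x \<sigma> alpha_pos
    by (intro mult_right_mono mult_left_mono mult_mono survival_antimono ennreal_leI powr_mono2) auto
  also have "\<dots> \<le> transition t f x"
    using a x \<sigma> t by (intro transition_ge_first_jump[OF minorant B f] W) auto
  finally show "ennreal ?d * (\<integral>\<^sup>+v. indicator B v * W v \<partial>lborel) \<le> transition t f x" .
qed

lemma transition_ge_conv_indicator_pow:
  assumes minorant: "ratio_law_minorant \<delta> B" and \<delta>: "0 < \<delta>" and B[measurable]: "B \<in> sets borel"
    and sub: "B \<subseteq> {p..p + w}"
    and \<tau>: "0 < \<tau>" "\<tau> \<le> T"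
  shows "\<exists>c>0. \<forall>x\<in>{a..b}. \<forall>t\<in>{\<tau>..T}. \<forall>f\<in>borel_measurable borel.
    ennreal c * (conv_indicator B ^^ n) (\<lambda>s. f (exp s)) x \<le> transition t f (exp x)"
  using \<tau>
proof (induction n arbitrary: a b \<tau>)
  case 0
  have "ennreal (exp (- (T * exp b powr \<alpha>))) * f (exp x) \<le> transition t f (exp x)"
    if "x \<in> {a..b}" "t \<in> {\<tau>..T}" "f \<in> borel_measurable borel" for x t f
    using that 0 transition_ge_no_jump[of f "exp x" "exp b" t T] by (simp add: survival_def)
  then show ?case by (intro exI[of _ "exp (- (T * exp b powr \<alpha>))"]) simp
next
  case (Suc n)
  obtain c where c: "0 < c"
    and IH: "\<And>x t f. x \<in> {a - p - w..b - p} \<Longrightarrow> t \<in> {\<tau> / 2..T} \<Longrightarrow> f \<in> borel_measurable borel \<Longrightarrow>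
      ennreal c * (conv_indicator B ^^ n) (\<lambda>s. f (exp s)) x \<le> transition t f (exp x)"
    using Suc.IH[of "\<tau> / 2" "a - p - w" "b - p"] Suc.prems by auto
  have half_pos: "0 < \<tau> / 2" using Suc.prems by simp
  obtain d where d: "0 < d"
    and first_jump: "\<And>x t f W. x \<in> {exp a..exp b} \<Longrightarrow> \<tau> / 2 \<le> t \<Longrightarrow> f \<in> borel_measurable borel \<Longrightarrow>
      (\<And>r v. 0 < r \<Longrightarrow> r \<le> \<tau> / 2 \<Longrightarrow> v \<in> B \<Longrightarrow> W v \<le> transition (t - r) f (exp (- v) * x)) \<Longrightarrow>
      ennreal d * (\<integral>\<^sup>+v. indicator B v * W v \<partial>lborel) \<le> transition t f x"
    by (rule transition_ge_first_jump_uniform[OF minorant \<delta> B exp_gt_zero half_pos, of a "exp b"]) iprover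
  show ?case
  proof (intro exI conjI ballI)
    show "0 < d * c" using c d by simp
    fix x t and f :: "real \<Rightarrow> ennreal"
    assume x: "x \<in> {a..b}" and t: "t \<in> {\<tau>..T}" and f[measurable]: "f \<in> borel_measurable borel"
    let ?F = "(conv_indicator B ^^ n) (\<lambda>s. f (exp s))"
    have [measurable]: "?F \<in> borel_measurable borel" by measurable
    have "ennreal (d * c) * (conv_indicator B ^^ Suc n) (\<lambda>s. f (exp s)) x =
        ennreal d * conv_indicator B (\<lambda>y. ennreal c * ?F y) x"
      using c d by (simp add: conv_indicator_cmult ennreal_mult mult.assoc)
    also have "\<dots> \<le> transition t f (exp x)"
      unfolding conv_indicator_def[of B "\<lambda>y. ennreal c * ?F y"]
    proof (rule first_jump[of "exp x" t f "\<lambda>v. ennreal c * ?F (x - v)"])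
      show "ennreal c * ?F (x - v) \<le> transition (t - r) f (exp (- v) * exp x)"
        if "0 < r" "r \<le> \<tau> / 2" "v \<in> B" for r v
        using IH[of "x - v" "t - r" f] that sub x t f by (auto simp: mult_exp_exp)
    qed (use x t f Suc.prems in auto)
    finally show "ennreal (d * c) * (conv_indicator B ^^ Suc n) (\<lambda>s. f (exp s)) x \<le> transition t f (exp x)" .
  qed
qed

definition log_window :: "real \<Rightarrow> (real \<Rightarrow> ennreal) \<Rightarrow> ennreal" where
  "log_window q f = (\<integral>\<^sup>+s. indicator {q..q + 1} s * f (exp s) \<partial>lborel)"

lemma log_window_indicator_split:
  assumes [measurable]: "B \<in> sets borel"
  shows "log_window q (indicator B) + log_window q (indicator (- B)) = 1"
proof -
  have "log_window q (indicator B) + log_window q (indicator (- B)) =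
      (\<integral>\<^sup>+s. indicator {q..q + 1} s * indicator B (exp s) +
      indicator {q..q + 1} s * indicator (- B) (exp s) \<partial>lborel)"
    unfolding log_window_def by (rule nn_integral_add[symmetric]) measurable
  also have "\<dots> = (\<integral>\<^sup>+s. indicator {q..q + 1} s \<partial>lborel)"
    by (intro nn_integral_cong) (auto simp: indicator_def)
  finally show ?thesis by simp
qed

lemma transition_minorization:
  assumes ab: "0 < a" "a \<le> b"
  obtains c q where "0 < c" "\<And>x f. x \<in> {a..b} \<Longrightarrow> f \<in> borel_measurable borel \<Longrightarrow>
    ennreal c * log_window q f \<le> transition 1 f x"
proof -
  obtain \<delta> B p w where \<delta>: "0 < \<delta>" and B: "almost_interval B p w" and minorant: "ratio_law_minorant \<delta> B"
    by (rule exists_ratio_law_minorant)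
  have B_sets: "B \<in> sets borel" "B \<subseteq> {p..p + w}" using B by (auto simp: almost_interval_def)
  define R where "R = ln b - ln a + 1"
  obtain n r c where c: "0 < c" and spread: "\<And>F x. F \<in> borel_measurable borel \<Longrightarrow>
      ennreal c * conv_indicator {r..r + R} F x \<le> (conv_indicator B ^^ n) F x"
    using almost_interval_conv_dominates_interval[OF B, of R] unfolding conv_dominates_interval_def by blast
  obtain d where d: "0 < d" and ge: "\<And>x f. x \<in> {ln a..ln b} \<Longrightarrow> f \<in> borel_measurable borel \<Longrightarrow>
      ennreal d * (conv_indicator B ^^ n) (\<lambda>s. f (exp s)) x \<le> transition 1 f (exp x)"
    using transition_ge_conv_indicator_pow[OF minorant \<delta> B_sets, of 1 1 "ln a" "ln b" n] by auto
  show ?thesis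
  proof (rule that[of "d * c" "ln a - r - 1"])
    show "0 < d * c" using c d by simp
    fix x and f :: "real \<Rightarrow> ennreal" assume x: "x \<in> {a..b}" and [measurable]: "f \<in> borel_measurable borel"
    have ln_x: "ln x \<in> {ln a..ln b}" "exp (ln x) = x" using x ab by auto
    have "log_window (ln a - r - 1) f \<le> (\<integral>\<^sup>+s. indicator {r..r + R} (ln x - s) * f (exp s) \<partial>lborel)"
      unfolding log_window_def
      using ln_x(1) by (intro nn_integral_mono mult_right_mono indicator_leI) (auto simp: R_def)
    also have "\<dots> = conv_indicator {r..r + R} (\<lambda>s. f (exp s)) (ln x)"
      using nn_integral_real_affine[of "\<lambda>s. indicator {r..r + R} (ln x - s) * f (exp s)" "-1" "ln x"]
      by (simp add: conv_indicator_def)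
    finally have "ennreal (d * c) * log_window (ln a - r - 1) f \<le>
        ennreal d * (ennreal c * conv_indicator {r..r + R} (\<lambda>s. f (exp s)) (ln x))"
      using c d by (simp add: ennreal_mult mult.assoc mult_left_mono)
    also have "\<dots> \<le> ennreal d * (conv_indicator B ^^ n) (\<lambda>s. f (exp s)) (ln x)"
      by (intro mult_left_mono spread) auto
    also have "\<dots> \<le> transition 1 f x" using ge[OF ln_x(1), of f] ln_x(2) by simp
    finally show "ennreal (d * c) * log_window (ln a - r - 1) f \<le> transition 1 f x" .
  qed
qed

subsection \<open>The renormalised step\<close>

definition renorm_scale :: real where
  "renorm_scale = 2 powr (1 / \<alpha>)"

lemma renorm_scale_pos: "0 < renorm_scale"
  by (simp add: renorm_scale_def)

lemma renorm_scale_powr: "renorm_scale powr \<alpha> = 2"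
  using alpha_pos by (simp add: renorm_scale_def powr_powr)

text \<open>One step covers the time span from \<open>1 + t = 2\<^sup>k\<close> to \<open>1 + t = 2\<^sup>k\<^sup>+\<^sup>1\<close> in the self-similar variable
  \<open>(1 + t)\<^sup>1\<^sup>/\<^sup>\<alpha> x\<close>, in which the self-similar solution is stationary.\<close>
definition renorm :: "(real \<Rightarrow> ennreal) \<Rightarrow> real \<Rightarrow> ennreal" where
  "renorm F x = transition 1 (\<lambda>y. F (renorm_scale * y)) x"

lemma measurable_renorm [measurable]:
  assumes [measurable]: "F \<in> borel_measurable borel"
  shows "renorm F \<in> borel_measurable borel"
  unfolding renorm_def[abs_def] by measurable

lemma measurable_renorm_pow [measurable]:
  "F \<in> borel_measurable borel \<Longrightarrow> (renorm ^^ k) F \<in> borel_measurable borel"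
  by (induction k) auto

lemma renorm_pow_le_1: "(\<And>y. F y \<le> 1) \<Longrightarrow> (renorm ^^ k) F x \<le> 1"
  by (induction k arbitrary: x) (auto simp: renorm_def intro: transition_le_1)

lemma renorm_pow_eq:
  assumes F[measurable]: "F \<in> borel_measurable borel" and F_le_1: "\<And>y. F y \<le> 1" and "0 < x"
  shows "(renorm ^^ k) F x = transition (2 ^ k - 1) (\<lambda>y. F (renorm_scale ^ k * y)) x"
  using \<open>0 < x\<close>
proof (induction k arbitrary: x)
  case 0
  then show ?case by (simp add: transition_0)
next
  case (Suc k)
  let ?F = "\<lambda>y. F (renorm_scale ^ Suc k * y)"
  have "(renorm ^^ Suc k) F x = transition 1 (\<lambda>y. (renorm ^^ k) F (renorm_scale * y)) x"
    by (simp add: renorm_def)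
  also have "\<dots> = transition 1 (transition (2 * (2 ^ k - 1)) ?F) x"
  proof (rule transition_cong)
    fix y :: real assume y: "0 < y"
    have "2 * (2 ^ k - 1) / renorm_scale powr \<alpha> = 2 ^ k - 1" by (simp add: renorm_scale_powr)
    then have "(renorm ^^ k) F (renorm_scale * y) =
        transition (2 * (2 ^ k - 1) / renorm_scale powr \<alpha>) (\<lambda>y. F (renorm_scale ^ k * y)) (renorm_scale * y)"
      using Suc.IH[of "renorm_scale * y"] y renorm_scale_pos by simp
    also have "\<dots> = transition (2 * (2 ^ k - 1)) (\<lambda>y. F (renorm_scale ^ k * (renorm_scale * y))) y"
      by (rule transition_scale[symmetric, OF renorm_scale_pos y])
    finally show "(renorm ^^ k) F (renorm_scale * y) = transition (2 * (2 ^ k - 1)) ?F y"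
      by (simp add: mult_ac)
  qed (use Suc in auto)
  also have "\<dots> = transition (1 + 2 * (2 ^ k - 1)) ?F x"
    using Suc F_le_1 by (intro transition_semigroup[symmetric]) auto
  finally show ?case by simp
qed

lemma renorm_pow_transition:
  assumes G[measurable]: "G \<in> borel_measurable borel" and G_le_1: "\<And>y. G y \<le> 1" and x: "0 < x"
    and t: "2 ^ k - 1 \<le> t"
  shows "(renorm ^^ k) (\<lambda>y. transition (t - (2 ^ k - 1)) G (y / renorm_scale ^ k)) x = transition t G x"
proof -
  have "(renorm ^^ k) (\<lambda>y. transition (t - (2 ^ k - 1)) G (y / renorm_scale ^ k)) x =
      transition (2 ^ k - 1) (\<lambda>y. transition (t - (2 ^ k - 1)) G (renorm_scale ^ k * y / renorm_scale ^ k)) x"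
    by (rule renorm_pow_eq) (use x in \<open>auto intro: transition_le_1 G_le_1\<close>)
  also have "\<dots> = transition (2 ^ k - 1) (transition (t - (2 ^ k - 1)) G) x" using renorm_scale_pos by simp
  also have "\<dots> = transition (2 ^ k - 1 + (t - (2 ^ k - 1))) G x"
    using t x by (intro transition_semigroup[symmetric] G_le_1) auto
  finally show ?thesis by simp
qed

end

subsection \<open>The self-similar solution\<close>

locale fragmentation_log_moment = fragmentation +
  assumes log_moment_finite: "log_moment < \<infinity>"
begin

definition profile_norm :: real where
  "profile_norm = enn2real (\<integral>\<^sup>+x. perpetuity_density x \<partial>haar)"

definition profile :: "real \<Rightarrow> real" where
  "profile x = (if 0 < x then \<alpha> * enn2real (perpetuity_density (x powr \<alpha>)) / (profile_norm * x\<^sup>2) else 0)"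

lemma measurable_profile [measurable]: "profile \<in> borel_measurable borel"
  unfolding profile_def[abs_def] by measurable

lemma ennreal_profile_norm: "ennreal profile_norm = (\<integral>\<^sup>+x. perpetuity_density x \<partial>haar)"
proof -
  have "(\<integral>\<^sup>+x. perpetuity_density x \<partial>haar) < \<infinity>"
    using nn_integral_perpetuity_density_haar_le log_moment_finite
    by (auto simp: ennreal_mult_less_top intro: order_le_less_trans)
  then show ?thesis by (simp add: profile_norm_def)
qed

lemma profile_norm_pos: "0 < profile_norm"
proof -
  have "(\<integral>\<^sup>+x. perpetuity_density x \<partial>haar) \<noteq> 0"
  proof
    assume "(\<integral>\<^sup>+x. perpetuity_density x \<partial>haar) = 0"
    then have "AE x in haar. perpetuity_density x = 0" by (subst (asm) nn_integral_0_iff_AE) auto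
    with AE_haar_pos have "AE x in haar. False"
      by eventually_elim (use perpetuity_density_pos in fastforce)
    then show False by (simp add: not_AE_haar_False)
  qed
  then show ?thesis by (simp flip: ennreal_profile_norm add: ennreal_eq_0_iff)
qed

lemma ennreal_perpetuity_density: "ennreal (enn2real (perpetuity_density s)) = perpetuity_density s"
  using perpetuity_density_le_1[of s] by (intro ennreal_enn2real) (auto simp: less_top[symmetric] top_unique)

lemma profile_pos: assumes "0 < x" shows "0 < profile x"
proof -
  have "0 < ennreal (enn2real (perpetuity_density (x powr \<alpha>)))"
    unfolding ennreal_perpetuity_density using assms by (intro perpetuity_density_pos) simp
  then show ?thesis using alpha_pos profile_norm_pos assms by (simp add: profile_def)
qed

lemma self_similar_profile_nonneg: "0 \<le> self_similar profile t x"
  using alpha_pos profile_norm_pos by (auto simp: self_similar_def profile_def)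

lemma self_similar_profile_eq:
  assumes "0 < x" "0 \<le> t"
  shows "self_similar profile t x = \<alpha> * enn2real (self_similar_flow t x) / (profile_norm * x\<^sup>2)"
proof -
  define c where "c = (1 + t) powr (1 / \<alpha>)"
  have c: "0 < c" using assms by (simp add: c_def)
  have "(c * x) powr \<alpha> = (1 + t) * x powr \<alpha>"
    using assms alpha_pos c by (simp add: powr_mult) (simp add: c_def powr_powr)
  then show ?thesis
    using assms c
    by (simp add: self_similar_def profile_def self_similar_flow_def c_def[symmetric] power_mult_distrib divide_simps)
qed

lemma nn_integral_self_similar_profile:
  assumes [measurable]: "F \<in> borel_measurable borel" and t: "0 \<le> t"
  shows "(\<integral>\<^sup>+x. ennreal (self_similar profile t x) * F x \<partial>mm) =
    ennreal (\<alpha> / profile_norm) * (\<integral>\<^sup>+x. self_similar_flow t x * F x \<partial>haar)"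
proof -
  note [measurable] = borel_measurable2_compose[OF borel_measurable2_self_similar_flow]
  have "(\<integral>\<^sup>+x. ennreal (self_similar profile t x) * F x \<partial>mm) =
      (\<integral>\<^sup>+x. ennreal (self_similar profile t x) * F x * ennreal (x\<^sup>2) \<partial>haar)"
    by (rule nn_integral_mm_eq_haar) measurable
  also have "\<dots> = (\<integral>\<^sup>+x. ennreal (\<alpha> / profile_norm) * (self_similar_flow t x * F x) \<partial>haar)"
  proof (rule nn_integral_cong_AE)
    show "AE x in haar. ennreal (self_similar profile t x) * F x * ennreal (x\<^sup>2) =
        ennreal (\<alpha> / profile_norm) * (self_similar_flow t x * F x)"
      using AE_haar_pos
    proof eventually_elim
      case (elim x)
      have "self_similar profile t x * x\<^sup>2 = \<alpha> / profile_norm * enn2real (self_similar_flow t x)"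
        using self_similar_profile_eq[OF elim t] elim by (simp add: field_simps)
      then have "ennreal (self_similar profile t x) * ennreal (x\<^sup>2) =
          ennreal (\<alpha> / profile_norm * enn2real (self_similar_flow t x))"
        by (simp add: self_similar_profile_nonneg flip: ennreal_mult)
      also have "\<dots> = ennreal (\<alpha> / profile_norm) * self_similar_flow t x"
        using alpha_pos profile_norm_pos
        by (subst ennreal_mult) (auto simp: self_similar_flow_def ennreal_perpetuity_density)
      finally show ?case by (simp add: mult_ac)
    qed
  qed
  also have "\<dots> = ennreal (\<alpha> / profile_norm) * (\<integral>\<^sup>+x. self_similar_flow t x * F x \<partial>haar)"
    by (rule nn_integral_cmult) measurable
  finally show ?thesis .
qed

lemma nn_integral_profile: "(\<integral>\<^sup>+x. ennreal (profile x) \<partial>mm) = 1"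
proof -
  have "ennreal \<alpha> * (\<integral>\<^sup>+x. self_similar_flow 0 x \<partial>haar) = ennreal profile_norm"
    unfolding ennreal_profile_norm using alpha_pos by (simp add: self_similar_flow_def nn_integral_haar_powr)
  moreover have "ennreal (\<alpha> / profile_norm) = ennreal (1 / profile_norm) * ennreal \<alpha>"
    using alpha_pos profile_norm_pos by (simp flip: ennreal_mult)
  ultimately have "(\<integral>\<^sup>+x. ennreal (profile x) \<partial>mm) = ennreal (1 / profile_norm) * ennreal profile_norm"
    using nn_integral_self_similar_profile[of "\<lambda>_. 1" 0] by (simp add: mult.assoc)
  then show ?thesis using profile_norm_pos by (simp flip: ennreal_mult)
qed

lemma self_similar_profile_Dm: "0 \<le> t \<Longrightarrow> self_similar profile t \<in> Dm"
  using nn_integral_self_similar[of profile "\<lambda>_. 1" t]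
  by (intro DmI) (auto simp: self_similar_profile_nonneg nn_integral_profile)

lemma profile_Dm: "profile \<in> Dm"
  using self_similar_profile_Dm[of 0] by simp

lemma distr_jump_space_profile:
  assumes t: "0 \<le> t"
  shows "distr (jump_space h profile) borel (\<lambda>\<omega>. Yproc \<alpha> \<omega> t) =
      density mm (\<lambda>x. ennreal (self_similar profile t x))"
    (is "?law = ?density")
proof (rule measure_eqI_le)
  note [measurable] = borel_measurable2_compose[OF borel_measurable2_self_similar_flow]
  have law: "emeasure ?law B = (\<integral>\<^sup>+x. ennreal (profile x) * transition t (indicator B) x \<partial>mm)"
    if "B \<in> sets borel" for B
    using nn_integral_distr_jump_space[of profile "indicator B" t] that by simp
  have "emeasure ?density UNIV = 1"
    using nn_integral_Dm[OF self_similar_profile_Dm[OF t]] by (simp add: emeasure_density)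
  then show "emeasure ?law (space ?law) = emeasure ?density (space ?density)"
      "emeasure ?density (space ?density) \<noteq> \<infinity>"
    using law[of UNIV] by (simp_all add: nn_integral_profile)
  fix B assume "B \<in> sets ?law"
  then have [measurable]: "B \<in> sets borel" by simp
  have "emeasure ?law B = (\<integral>\<^sup>+x. ennreal (self_similar profile 0 x) * transition t (indicator B) x \<partial>mm)"
    by (simp add: law)
  also have "\<dots> = ennreal (\<alpha> / profile_norm) *
      (\<integral>\<^sup>+x. self_similar_flow 0 x * transition t (indicator B) x \<partial>haar)"
    by (rule nn_integral_self_similar_profile) auto
  also have "\<dots> \<le> ennreal (\<alpha> / profile_norm) * (\<integral>\<^sup>+x. self_similar_flow t x * indicator B x \<partial>haar)"
    by (intro mult_left_mono mild_solution_dominates_transition mild_solution_self_similar_flow t) auto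
  also have "\<dots> = (\<integral>\<^sup>+x. ennreal (self_similar profile t x) * indicator B x \<partial>mm)"
    by (rule nn_integral_self_similar_profile[symmetric]) (use t in auto)
  also have "\<dots> = emeasure ?density B" by (rule emeasure_density[symmetric]) auto
  finally show "emeasure ?law B \<le> emeasure ?density B" .
qed simp

lemma frag_solution_self_similar_profile: "frag_solution \<alpha> h profile (self_similar profile)"
  by (simp add: frag_solution_def self_similar_profile_Dm distr_jump_space_profile)

definition profile_law :: "real measure" where
  "profile_law = density mm (\<lambda>x. ennreal (profile x))"

lemma sets_profile_law [measurable_cong, simp]: "sets profile_law = sets borel"
  and space_profile_law [simp]: "space profile_law = UNIV"
  by (simp_all add: profile_law_def)

sublocale profile: prob_space profile_law
  unfolding profile_law_def by (rule prob_space_density_Dm[OF profile_Dm])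

lemma emeasure_profile_law_UNIV [simp]: "emeasure profile_law UNIV = 1"
  using profile.emeasure_space_1 by simp

lemma AE_profile_law_pos: "AE x in profile_law. 0 < x"
  unfolding profile_law_def using AE_mm_pos by (subst AE_density) (auto elim: eventually_mono)

lemma nn_integral_profile_law:
  "f \<in> borel_measurable borel \<Longrightarrow> (\<integral>\<^sup>+x. f x \<partial>profile_law) = (\<integral>\<^sup>+x. ennreal (profile x) * f x \<partial>mm)"
  unfolding profile_law_def by (rule nn_integral_density) auto

lemma nn_integral_profile_transition:
  assumes "0 \<le> t" "f \<in> borel_measurable borel"
  shows "(\<integral>\<^sup>+x. ennreal (profile x) * transition t f x \<partial>mm) =
      (\<integral>\<^sup>+x. ennreal (self_similar profile t x) * f x \<partial>mm)"
  using frag_solution_nn_integral[OF frag_solution_self_similar_profile profile_Dm assms] by simp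

lemma nn_integral_renorm:
  assumes [measurable]: "F \<in> borel_measurable borel"
  shows "(\<integral>\<^sup>+x. renorm F x \<partial>profile_law) = (\<integral>\<^sup>+x. F x \<partial>profile_law)"
proof -
  have "(\<integral>\<^sup>+x. renorm F x \<partial>profile_law) = (\<integral>\<^sup>+x. ennreal (self_similar profile 1 x) * F (renorm_scale * x) \<partial>mm)"
    by (simp add: nn_integral_profile_law renorm_def nn_integral_profile_transition)
  also have "\<dots> = (\<integral>\<^sup>+x. ennreal (profile x) * F x \<partial>mm)"
    using nn_integral_self_similar[of profile "\<lambda>x. F (renorm_scale * x)" 1] renorm_scale_pos
    by (simp add: renorm_scale_def)
  finally show ?thesis by (simp add: nn_integral_profile_law)
qed

subsection \<open>Contraction of the renormalised step\<close>

abbreviation pairing :: "(real \<Rightarrow> ennreal) \<Rightarrow> (real \<Rightarrow> ennreal) \<Rightarrow> ennreal" ("\<langle>_, _\<rangle>") where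
  "\<langle>f, F\<rangle> \<equiv> \<integral>\<^sup>+x. f x * F x \<partial>profile_law"

abbreviation mass :: "(real \<Rightarrow> ennreal) \<Rightarrow> ennreal" where
  "mass f \<equiv> \<integral>\<^sup>+x. f x \<partial>profile_law"

definition dominated :: "real \<Rightarrow> (real \<Rightarrow> ennreal) \<Rightarrow> bool" where
  "dominated C f \<longleftrightarrow> f \<in> borel_measurable borel \<and>
    (\<forall>F\<in>borel_measurable borel. \<langle>f, F\<rangle> \<le> ennreal C * mass F)"

definition pushes :: "(real \<Rightarrow> ennreal) \<Rightarrow> (real \<Rightarrow> ennreal) \<Rightarrow> bool" where
  "pushes f g \<longleftrightarrow> (\<forall>F\<in>borel_measurable borel. \<langle>g, F\<rangle> = \<langle>f, renorm F\<rangle>)"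

lemma
  assumes "dominated C f"
  shows dominated_measurable: "f \<in> borel_measurable borel"
    and dominated_pairing_le: "F \<in> borel_measurable borel \<Longrightarrow> \<langle>f, F\<rangle> \<le> ennreal C * mass F"
  using assms by (auto simp: dominated_def)

lemma pushesD: "pushes f g \<Longrightarrow> F \<in> borel_measurable borel \<Longrightarrow> \<langle>g, F\<rangle> = \<langle>f, renorm F\<rangle>"
  by (simp add: pushes_def)

lemma pushes_mass: "pushes f g \<Longrightarrow> mass g = mass f"
  using pushesD[of f g "\<lambda>_. 1"] by (simp add: renorm_def)

lemma dominatedI:
  assumes [measurable]: "f \<in> borel_measurable borel" and "\<And>x. f x \<le> ennreal C"
  shows "dominated C f"
  unfolding dominated_def
proof (intro conjI ballI)
  fix F :: "real \<Rightarrow> ennreal" assume [measurable]: "F \<in> borel_measurable borel"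
  have "\<langle>f, F\<rangle> \<le> (\<integral>\<^sup>+x. ennreal C * F x \<partial>profile_law)" by (intro nn_integral_mono mult_right_mono assms) auto
  then show "\<langle>f, F\<rangle> \<le> ennreal C * mass F" by (simp add: nn_integral_cmult)
qed measurable

lemma dominated_diff:
  assumes g: "dominated C g" and [measurable]: "m \<in> borel_measurable borel"
  shows "dominated C (\<lambda>x. g x - m x)"
  unfolding dominated_def
proof (intro conjI ballI)
  note [measurable] = dominated_measurable[OF g]
  show "(\<lambda>x. g x - m x) \<in> borel_measurable borel" by measurable
  fix F :: "real \<Rightarrow> ennreal" assume "F \<in> borel_measurable borel"
  then have "\<langle>g, F\<rangle> \<le> ennreal C * mass F" by (rule dominated_pairing_le[OF g])
  moreover have "\<langle>\<lambda>x. g x - m x, F\<rangle> \<le> \<langle>g, F\<rangle>"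
    by (intro nn_integral_mono mult_right_mono) (auto simp: diff_le_self_ennreal)
  ultimately show "\<langle>\<lambda>x. g x - m x, F\<rangle> \<le> ennreal C * mass F" by simp
qed

lemma exists_push_forward:
  assumes f: "dominated C f"
  obtains g where "dominated C g" "pushes f g"
proof -
  note [measurable] = dominated_measurable[OF f]
  define M where
    "M = distr (distr (density profile_law f \<Otimes>\<^sub>M noise_law) borel (\<lambda>w. Yproc \<alpha> w 1)) borel ((*) renorm_scale)"
  have sets_M: "sets M = sets borel" by (simp add: M_def)
  have M: "(\<integral>\<^sup>+x. F x \<partial>M) = \<langle>f, renorm F\<rangle>" if [measurable]: "F \<in> borel_measurable borel" for F
  proof -
    have "(\<integral>\<^sup>+x. F x \<partial>M) =
        (\<integral>\<^sup>+x. F (renorm_scale * x) \<partial>distr (density profile_law f \<Otimes>\<^sub>M noise_law) borel (\<lambda>w. Yproc \<alpha> w 1))"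
      unfolding M_def by (rule nn_integral_distr) measurable
    also have "\<dots> = (\<integral>\<^sup>+x. renorm F x \<partial>density profile_law f)"
      unfolding renorm_def by (rule nn_integral_distr_Yproc) auto
    also have "\<dots> = \<langle>f, renorm F\<rangle>" by (rule nn_integral_density) measurable
    finally show ?thesis .
  qed
  have dom: "(\<integral>\<^sup>+x. F x \<partial>M) \<le> ennreal C * mass F" if [measurable]: "F \<in> borel_measurable borel" for F
    using dominated_pairing_le[OF f, of "renorm F"] by (simp add: M nn_integral_renorm)
  have "absolutely_continuous profile_law M"
    unfolding absolutely_continuous_def
  proof
    fix B assume B: "B \<in> null_sets profile_law"
    then have [measurable]: "B \<in> sets borel" by (auto simp: null_sets_def)
    show "B \<in> null_sets M" using B dom[of "indicator B"] by (auto simp: null_sets_def sets_M)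
  qed
  then obtain g where g: "g \<in> borel_measurable profile_law" "density profile_law g = M"
    using profile.Radon_Nikodym[of M] sets_M by auto
  then have [measurable]: "g \<in> borel_measurable borel" by (simp cong: measurable_cong_sets)
  have gM: "\<langle>g, F\<rangle> = (\<integral>\<^sup>+x. F x \<partial>M)" if [measurable]: "F \<in> borel_measurable borel" for F
    unfolding g(2)[symmetric] by (subst nn_integral_density) auto
  show ?thesis
  proof
    show "dominated C g" by (auto simp: dominated_def gM dom)
    show "pushes f g" by (simp add: pushes_def gM M)
  qed
qed

lemma dominated_mass_on_large_set:
  assumes f: "dominated C f" and mass: "ennreal \<delta> \<le> mass f" and [measurable]: "K \<in> sets borel"
    and K: "emeasure profile_law (- K) \<le> ennreal (\<delta> / (2 * C))" and C: "0 < C" and \<delta>: "0 < \<delta>"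
  shows "ennreal (\<delta> / 2) \<le> \<langle>f, indicator K\<rangle>"
proof -
  note [measurable] = dominated_measurable[OF f]
  have "\<langle>f, indicator (- K)\<rangle> \<le> ennreal C * emeasure profile_law (- K)"
    using dominated_pairing_le[OF f, of "indicator (- K)"] by simp
  also have "\<dots> \<le> ennreal C * ennreal (\<delta> / (2 * C))" using K by (intro mult_left_mono) auto
  also have "\<dots> = ennreal (\<delta> / 2)" using C \<delta> by (simp flip: ennreal_mult)
  finally have outside: "\<langle>f, indicator (- K)\<rangle> \<le> ennreal (\<delta> / 2)" .
  have "ennreal (\<delta> / 2) + ennreal (\<delta> / 2) \<le> mass f" using mass \<delta> by (simp flip: ennreal_plus)
  also have "mass f = (\<integral>\<^sup>+x. f x * indicator (- K) x + f x * indicator K x \<partial>profile_law)"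
    by (intro nn_integral_cong) (auto simp: indicator_def)
  also have "\<dots> \<le> ennreal (\<delta> / 2) + \<langle>f, indicator K\<rangle>"
    using outside by (simp add: nn_integral_add add_right_mono)
  finally show ?thesis by (simp add: ennreal_add_left_cancel_le)
qed

lemma renorm_minorant:
  assumes C: "0 < C" and \<delta>: "0 < \<delta>"
  obtains c q where "0 < c" "\<And>f F. dominated C f \<Longrightarrow> ennreal \<delta> \<le> mass f \<Longrightarrow> F \<in> borel_measurable borel \<Longrightarrow>
    ennreal c * log_window q (\<lambda>y. F (renorm_scale * y)) \<le> \<langle>f, renorm F\<rangle>"
proof -
  obtain a b where ab: "0 < a" "a \<le> b" and tight: "emeasure profile_law (- {a..b}) \<le> ennreal (\<delta> / (2 * C))"
    using exists_Icc_compl_le[OF profile.finite_measure_axioms sets_profile_law AE_profile_law_pos, of "\<delta> / (2 * C)"] C \<delta>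
    by auto
  obtain c q where c: "0 < c" and minor: "\<And>x f. x \<in> {a..b} \<Longrightarrow> f \<in> borel_measurable borel \<Longrightarrow>
      ennreal c * log_window q f \<le> transition 1 f x"
    by (rule transition_minorization[OF ab]) iprover
  show ?thesis
  proof (rule that[of "c * (\<delta> / 2)" q])
    show "0 < c * (\<delta> / 2)" using c \<delta> by simp
    fix f F :: "real \<Rightarrow> ennreal" assume f: "dominated C f" "ennreal \<delta> \<le> mass f"
      and [measurable]: "F \<in> borel_measurable borel"
    note [measurable] = dominated_measurable[OF f(1)]
    define \<Lambda> where "\<Lambda> = ennreal c * log_window q (\<lambda>y. F (renorm_scale * y))"
    have renorm_ge: "\<Lambda> \<le> renorm F x" if "x \<in> {a..b}" for x
      using minor[OF that, of "\<lambda>y. F (renorm_scale * y)"] by (simp add: \<Lambda>_def renorm_def)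
    have "ennreal (c * (\<delta> / 2)) * log_window q (\<lambda>y. F (renorm_scale * y)) = \<Lambda> * ennreal (\<delta> / 2)"
      using c \<delta> by (subst ennreal_mult) (simp_all add: \<Lambda>_def mult_ac)
    also have "\<dots> \<le> \<Lambda> * \<langle>f, indicator {a..b}\<rangle>"
      using dominated_mass_on_large_set[OF f _ tight C \<delta>] by (intro mult_left_mono) auto
    also have "\<dots> = (\<integral>\<^sup>+x. \<Lambda> * (f x * indicator {a..b} x) \<partial>profile_law)"
      by (rule nn_integral_cmult[symmetric]) measurable
    also have "\<dots> \<le> \<langle>f, renorm F\<rangle>"
    proof (rule nn_integral_mono)
      show "\<Lambda> * (f x * indicator {a..b} x) \<le> f x * renorm F x" for x
        using mult_right_mono[OF renorm_ge[of x], of "f x"] by (auto simp: indicator_def mult.commute)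
    qed
    finally show "ennreal (c * (\<delta> / 2)) * log_window q (\<lambda>y. F (renorm_scale * y)) \<le> \<langle>f, renorm F\<rangle>" .
  qed
qed

definition common_mass_ge :: "real \<Rightarrow> real \<Rightarrow> real \<Rightarrow> bool" where
  "common_mass_ge C \<delta> \<eta> \<longleftrightarrow> (\<forall>f1 f2 g1 g2.
    dominated C f1 \<longrightarrow> dominated C f2 \<longrightarrow> ennreal \<delta> \<le> mass f1 \<longrightarrow> ennreal \<delta> \<le> mass f2 \<longrightarrow>
    pushes f1 g1 \<longrightarrow> pushes f2 g2 \<longrightarrow> g1 \<in> borel_measurable borel \<longrightarrow> g2 \<in> borel_measurable borel \<longrightarrow>
    ennreal \<eta> \<le> mass (\<lambda>x. min (g1 x) (g2 x)))"

lemma exists_common_mass_ge: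
  assumes C: "0 < C" and \<delta>: "0 < \<delta>"
  obtains \<eta> where "0 < \<eta>" "common_mass_ge C \<delta> \<eta>"
proof -
  obtain c q where c: "0 < c"
    and minor: "\<And>f F. dominated C f \<Longrightarrow> ennreal \<delta> \<le> mass f \<Longrightarrow> F \<in> borel_measurable borel \<Longrightarrow>
      ennreal c * log_window q (\<lambda>y. F (renorm_scale * y)) \<le> \<langle>f, renorm F\<rangle>"
    by (rule renorm_minorant[OF C \<delta>]) iprover
  have "common_mass_ge C \<delta> c"
    unfolding common_mass_ge_def
  proof (intro allI impI)
    fix f1 f2 g1 g2 :: "real \<Rightarrow> ennreal"
    assume f: "dominated C f1" "dominated C f2" "ennreal \<delta> \<le> mass f1" "ennreal \<delta> \<le> mass f2"
      and g: "pushes f1 g1" "pushes f2 g2"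
      and [measurable]: "g1 \<in> borel_measurable borel" "g2 \<in> borel_measurable borel"
    define B where "B = {x. g1 x \<le> g2 x}"
    define A where "A = {y. renorm_scale * y \<in> B}"
    have [measurable]: "B \<in> sets borel" "A \<in> sets borel" unfolding A_def B_def by measurable
    have ind: "(\<lambda>y. indicator B (renorm_scale * y)) = (indicator A :: real \<Rightarrow> ennreal)"
      "(\<lambda>y. indicator (- B) (renorm_scale * y)) = (indicator (- A) :: real \<Rightarrow> ennreal)"
      by (auto simp: A_def indicator_def fun_eq_iff)
    have "ennreal c = ennreal c * log_window q (indicator A) + ennreal c * log_window q (indicator (- A))"
      by (simp add: log_window_indicator_split flip: distrib_left)
    also have "\<dots> \<le> \<langle>f1, renorm (indicator B)\<rangle> + \<langle>f2, renorm (indicator (- B))\<rangle>"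
      unfolding ind[symmetric] by (intro add_mono minor f) measurable
    also have "\<dots> = \<langle>g1, indicator B\<rangle> + \<langle>g2, indicator (- B)\<rangle>"
      using g by (simp add: pushesD)
    also have "\<dots> = (\<integral>\<^sup>+x. g1 x * indicator B x + g2 x * indicator (- B) x \<partial>profile_law)"
      by (rule nn_integral_add[symmetric]) measurable
    also have "\<dots> = mass (\<lambda>x. min (g1 x) (g2 x))"
      by (intro nn_integral_cong) (auto simp: B_def indicator_def min_def)
    finally show "ennreal c \<le> mass (\<lambda>x. min (g1 x) (g2 x))" .
  qed
  with c show ?thesis by (rule that)
qed

lemma coupling_step:
  assumes common: "common_mass_ge C \<delta> \<eta>"
    and f: "dominated C f1" "dominated C f2" "mass f1 = ennreal p" "mass f2 = ennreal p"
    and p: "0 \<le> p" "\<delta> \<le> p"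
  obtains g1 g2 r m where "dominated C g1" "dominated C g2" "mass g1 = ennreal r" "mass g2 = ennreal r"
    "0 \<le> r" "r \<le> p - \<eta>"
    "\<forall>F\<in>borel_measurable borel. \<langle>f1, renorm F\<rangle> = \<langle>g1, F\<rangle> + \<langle>m, F\<rangle>"
    "\<forall>F\<in>borel_measurable borel. \<langle>f2, renorm F\<rangle> = \<langle>g2, F\<rangle> + \<langle>m, F\<rangle>"
proof -
  obtain g1 where g1: "dominated C g1" "pushes f1 g1" by (rule exists_push_forward[OF f(1)])
  obtain g2 where g2: "dominated C g2" "pushes f2 g2" by (rule exists_push_forward[OF f(2)])
  note g_borel = dominated_measurable[OF g1(1)] dominated_measurable[OF g2(1)]
  note [measurable] = g_borel
  define m where "m x = min (g1 x) (g2 x)" for x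
  have [measurable]: "m \<in> borel_measurable borel" unfolding m_def[abs_def] by measurable
  have split1: "\<langle>g1, F\<rangle> = \<langle>\<lambda>x. g1 x - m x, F\<rangle> + \<langle>m, F\<rangle>" and split2: "\<langle>g2, F\<rangle> = \<langle>\<lambda>x. g2 x - m x, F\<rangle> + \<langle>m, F\<rangle>"
    if [measurable]: "F \<in> borel_measurable borel" for F
    by (auto intro!: nn_integral_diff_add AE_I2 simp: m_def)
  have mass_p: "ennreal p = mass (\<lambda>x. g1 x - m x) + mass m" "ennreal p = mass (\<lambda>x. g2 x - m x) + mass m"
    using split1[of "\<lambda>_. 1"] split2[of "\<lambda>_. 1"] pushes_mass[OF g1(2)] pushes_mass[OF g2(2)] f(3,4) by simp_all
  then obtain s where s: "mass m = ennreal s" "0 \<le> s" by (cases "mass m") auto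
  have "mass m \<le> ennreal p" unfolding mass_p(1) by simp
  then have "s \<le> p" using s p by simp
  have "ennreal \<eta> \<le> mass m"
    using common f p g1 g2 g_borel unfolding m_def[abs_def] common_mass_ge_def by (simp add: ennreal_leI)
  then have "\<eta> \<le> s" using s by simp
  have cancel: "X = ennreal (p - s)" if "ennreal p = X + ennreal s" for X
    using that s(2) by (metis ennreal_add_diff_cancel_right ennreal_minus ennreal_neq_top)
  show ?thesis
  proof
    show "dominated C (\<lambda>x. g1 x - m x)" "dominated C (\<lambda>x. g2 x - m x)"
      by (auto intro!: dominated_diff g1 g2)
    show "mass (\<lambda>x. g1 x - m x) = ennreal (p - s)" "mass (\<lambda>x. g2 x - m x) = ennreal (p - s)"
      using mass_p by (auto intro!: cancel simp: s(1))
    show "0 \<le> p - s" "p - s \<le> p - \<eta>" using \<open>s \<le> p\<close> \<open>\<eta> \<le> s\<close> by auto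
    show "\<forall>F\<in>borel_measurable borel. \<langle>f1, renorm F\<rangle> = \<langle>\<lambda>x. g1 x - m x, F\<rangle> + \<langle>m, F\<rangle>"
      by (intro ballI) (simp only: pushesD[OF g1(2), symmetric] split1)
    show "\<forall>F\<in>borel_measurable borel. \<langle>f2, renorm F\<rangle> = \<langle>\<lambda>x. g2 x - m x, F\<rangle> + \<langle>m, F\<rangle>"
      by (intro ballI) (simp only: pushesD[OF g2(2), symmetric] split2)
  qed
qed

lemma renorm_pow_le_of_small_mass:
  assumes "mass f1 \<le> ennreal \<delta>" "\<And>y. F y \<le> 1"
  shows "\<langle>f1, (renorm ^^ k) F\<rangle> \<le> \<langle>f2, (renorm ^^ k) F\<rangle> + ennreal \<delta>"
proof -
  have "\<langle>f1, (renorm ^^ k) F\<rangle> \<le> mass f1" by (intro nn_integral_mult_le_of_le_1 renorm_pow_le_1 assms(2))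
  with assms(1) show ?thesis by (meson add_increasing order_trans zero_le)
qed

lemma contraction_iterate:
  assumes common: "common_mass_ge C \<delta> \<eta>"
    and F[measurable]: "F \<in> borel_measurable borel" and F_le_1: "\<And>y. F y \<le> 1"
    and f: "dominated C f1" "dominated C f2" "mass f1 = ennreal p" "mass f2 = ennreal p" "0 \<le> p"
      "p \<le> \<delta> + real k * \<eta>"
  shows "\<langle>f1, (renorm ^^ k) F\<rangle> \<le> \<langle>f2, (renorm ^^ k) F\<rangle> + ennreal \<delta>"
  using f
proof (induction k arbitrary: f1 f2 p)
  case 0
  then show ?case by (intro renorm_pow_le_of_small_mass F_le_1) (simp add: ennreal_leI)
next
  case (Suc k)
  show ?case
  proof (cases "p \<le> \<delta>")
    case True
    with Suc.prems show ?thesis by (intro renorm_pow_le_of_small_mass F_le_1) (simp add: ennreal_leI)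
  next
    case False
    then have "\<delta> \<le> p" by simp
    obtain g1 g2 r m where g: "dominated C g1" "dominated C g2" "mass g1 = ennreal r" "mass g2 = ennreal r"
      "0 \<le> r"
        and r: "r \<le> p - \<eta>"
        and split: "\<forall>F\<in>borel_measurable borel. \<langle>f1, renorm F\<rangle> = \<langle>g1, F\<rangle> + \<langle>m, F\<rangle>"
          "\<forall>F\<in>borel_measurable borel. \<langle>f2, renorm F\<rangle> = \<langle>g2, F\<rangle> + \<langle>m, F\<rangle>"
      by (rule coupling_step[OF common Suc.prems(1-5) \<open>\<delta> \<le> p\<close>])
    have "\<langle>f1, (renorm ^^ Suc k) F\<rangle> = \<langle>g1, (renorm ^^ k) F\<rangle> + \<langle>m, (renorm ^^ k) F\<rangle>"
      using split(1) by simp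
    also have "\<dots> \<le> (\<langle>g2, (renorm ^^ k) F\<rangle> + ennreal \<delta>) + \<langle>m, (renorm ^^ k) F\<rangle>"
      using Suc.prems(6) r by (intro add_right_mono Suc.IH[OF g]) (simp add: algebra_simps)
    also have "\<dots> = \<langle>f2, (renorm ^^ Suc k) F\<rangle> + ennreal \<delta>"
      using split(2) by (simp add: add_ac)
    finally show ?thesis .
  qed
qed

lemma contraction:
  assumes C: "0 < C" and \<delta>: "0 < \<delta>"
  obtains k where "\<And>f1 f2 F. dominated C f1 \<Longrightarrow> dominated C f2 \<Longrightarrow> mass f1 = mass f2 \<Longrightarrow> mass f1 \<le> 1 \<Longrightarrow>
    F \<in> borel_measurable borel \<Longrightarrow> (\<And>y. F y \<le> 1) \<Longrightarrow> \<langle>f1, (renorm ^^ k) F\<rangle> \<le> \<langle>f2, (renorm ^^ k) F\<rangle> + ennreal \<delta>"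
proof -
  obtain \<eta> where \<eta>: "0 < \<eta>" and common: "common_mass_ge C \<delta> \<eta>" by (rule exists_common_mass_ge[OF C \<delta>])
  obtain k where k: "1 / \<eta> \<le> real k" using real_arch_simple by blast
  then have enough: "1 \<le> \<delta> + real k * \<eta>" using \<eta> \<delta> by (simp add: field_simps)
  show ?thesis
  proof (rule that[of k])
    fix f1 f2 F :: "real \<Rightarrow> ennreal"
    assume f: "dominated C f1" "dominated C f2" "mass f1 = mass f2" "mass f1 \<le> 1"
      and F: "F \<in> borel_measurable borel" "\<And>y. F y \<le> 1"
    obtain p where p: "mass f1 = ennreal p" "0 \<le> p" using f(4) by (cases "mass f1") (auto simp: top_unique)
    then show "\<langle>f1, (renorm ^^ k) F\<rangle> \<le> \<langle>f2, (renorm ^^ k) F\<rangle> + ennreal \<delta>"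
      using enough f F by (intro contraction_iterate[OF common, where p = p]) auto
  qed
qed

subsection \<open>Convergence\<close>

definition profile_cutoff :: "nat \<Rightarrow> (real \<Rightarrow> real) \<Rightarrow> real \<Rightarrow> real" where
  "profile_cutoff n f x = min (f x) (real n * profile x)"

lemma measurable_profile_cutoff [measurable]:
  "f \<in> borel_measurable borel \<Longrightarrow> profile_cutoff n f \<in> borel_measurable borel"
  unfolding profile_cutoff_def[abs_def] by measurable

lemma profile_nonneg: "0 \<le> profile x"
  using profile_pos[of x] by (cases "0 < x") (auto simp: profile_def)

lemma dominated_profile_cutoff:
  assumes [measurable]: "f \<in> borel_measurable borel"
  shows "dominated (real n) (\<lambda>x. ennreal (profile_cutoff n f x / profile x))"
proof (rule dominatedI)
  show "ennreal (profile_cutoff n f x / profile x) \<le> ennreal (real n)" for x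
    using profile_nonneg[of x]
    by (intro ennreal_leI) (cases "profile x = 0", auto simp: profile_cutoff_def divide_le_eq)
qed measurable

lemma pairing_profile_cutoff:
  assumes [measurable]: "f \<in> borel_measurable borel" "G \<in> borel_measurable borel"
  shows "\<langle>\<lambda>x. ennreal (profile_cutoff n f x / profile x), G\<rangle> =
      (\<integral>\<^sup>+x. ennreal (profile_cutoff n f x) * G x \<partial>mm)"
proof -
  have "AE x in mm. ennreal (profile x) * (ennreal (profile_cutoff n f x / profile x) * G x) =
      ennreal (profile_cutoff n f x) * G x"
    using AE_mm_pos
  proof eventually_elim
    case (elim x)
    have "ennreal (profile x) * ennreal (profile_cutoff n f x / profile x) = ennreal (profile_cutoff n f x)"
      using profile_pos[OF elim] by (simp flip: ennreal_mult')
    then show ?case by (simp add: mult.assoc[symmetric])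
  qed
  then show ?thesis by (simp add: nn_integral_profile_law cong: nn_integral_cong_AE)
qed

lemma nn_integral_profile_cutoff_tendsto:
  assumes c0: "c0 \<in> Dm"
  shows "(\<lambda>n. \<integral>\<^sup>+x. ennreal (profile_cutoff n c0 x) \<partial>mm) \<longlonglongrightarrow> 1"
proof -
  note [measurable] = measurable_Dm[OF c0]
  have "(\<lambda>n. \<integral>\<^sup>+x. ennreal (profile_cutoff n c0 x) \<partial>mm) \<longlonglongrightarrow>
      (\<integral>\<^sup>+x. (if 0 < x then ennreal (c0 x) else 0) \<partial>mm)"
  proof (rule nn_integral_LIMSEQ)
    show "incseq (\<lambda>n x. ennreal (profile_cutoff n c0 x))"
      using profile_nonneg unfolding incseq_def le_fun_def profile_cutoff_def
      by (intro allI impI ennreal_leI min.mono mult_right_mono) auto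
    show "(\<lambda>n. ennreal (profile_cutoff n c0 x)) \<longlonglongrightarrow> (if 0 < x then ennreal (c0 x) else 0)" for x
    proof (cases "0 < x")
      case True
      obtain m where m: "c0 x / profile x \<le> real m" using real_arch_simple by blast
      have "c0 x \<le> real n * profile x" if "m \<le> n" for n
      proof -
        have "c0 x / profile x \<le> real n" using m that by linarith
        then show ?thesis using profile_pos[OF True] by (simp add: field_simps)
      qed
      then have "\<forall>\<^sub>F n in sequentially. ennreal (profile_cutoff n c0 x) = ennreal (c0 x)"
        by (auto simp: eventually_sequentially profile_cutoff_def min_absorb1 intro!: exI[of _ m])
      then show ?thesis using True by (simp add: tendsto_eventually)
    qed (simp add: profile_cutoff_def profile_def ennreal_neg)
  qed measurable
  also have "(\<integral>\<^sup>+x. (if 0 < x then ennreal (c0 x) else 0) \<partial>mm) = (\<integral>\<^sup>+x. ennreal (c0 x) \<partial>mm)"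
    using AE_mm_pos by (intro nn_integral_cong_AE) (auto elim!: eventually_mono)
  finally show ?thesis by (simp add: nn_integral_Dm[OF c0])
qed

lemma exists_profile_cutoff_remainder_le:
  assumes c0: "c0 \<in> Dm" and e: "0 < e"
  obtains n where "1 \<le> n" "(\<integral>\<^sup>+x. ennreal (c0 x) - ennreal (profile_cutoff n c0 x) \<partial>mm) \<le> ennreal e"
proof -
  note [measurable] = measurable_Dm[OF c0]
  let ?m = "\<lambda>n. \<integral>\<^sup>+x. ennreal (profile_cutoff n c0 x) \<partial>mm"
  have "(\<lambda>n. ?m n + ennreal e) \<longlonglongrightarrow> 1 + ennreal e"
    by (intro tendsto_add nn_integral_profile_cutoff_tendsto c0 tendsto_const)
  moreover have "1 < 1 + ennreal e" using e ennreal_less_iff[of 1 "1 + e"] by simp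
  ultimately have "\<forall>\<^sub>F n in sequentially. 1 < ?m n + ennreal e" by (rule order_tendstoD(1))
  then have "\<forall>\<^sub>F n in sequentially. 1 \<le> n \<and> 1 < ?m n + ennreal e"
    using eventually_ge_at_top[of 1] by eventually_elim auto
  then obtain n where n: "1 \<le> n" "1 < ?m n + ennreal e" by (auto dest: eventually_happens)
  have total: "1 = (\<integral>\<^sup>+x. ennreal (c0 x) - ennreal (profile_cutoff n c0 x) \<partial>mm) + ?m n"
    using nn_integral_diff_add[of "\<lambda>x. ennreal (profile_cutoff n c0 x)" mm "\<lambda>x. ennreal (c0 x)" "\<lambda>_. 1"]
      nn_integral_Dm[OF c0]
    by (simp add: profile_cutoff_def ennreal_leI)
  then have "?m n \<noteq> \<infinity>" by auto
  moreover have "?m n + (\<integral>\<^sup>+x. ennreal (c0 x) - ennreal (profile_cutoff n c0 x) \<partial>mm) \<le> ?m n + ennreal e"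
    using n(2) total by (simp add: add.commute)
  ultimately show ?thesis using n(1) that by (simp add: ennreal_add_left_cancel_le)
qed

lemma exists_dominated_approximation:
  assumes c0: "c0 \<in> Dm" and e: "0 < e"
  obtains n f where "1 \<le> real n" "dominated (real n) f" "mass f \<le> 1"
    "\<And>G. G \<in> borel_measurable borel \<Longrightarrow> (\<And>y. G y \<le> 1) \<Longrightarrow> (\<integral>\<^sup>+x. ennreal (c0 x) * G x \<partial>mm) \<le> \<langle>f, G\<rangle> + ennreal e"
proof -
  note [measurable] = measurable_Dm[OF c0]
  obtain n where n: "1 \<le> n" "(\<integral>\<^sup>+x. ennreal (c0 x) - ennreal (profile_cutoff n c0 x) \<partial>mm) \<le> ennreal e"
    by (rule exists_profile_cutoff_remainder_le[OF c0 e])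
  define f where "f x = ennreal (profile_cutoff n c0 x / profile x)" for x
  have pairing_f: "\<langle>f, G\<rangle> = (\<integral>\<^sup>+x. ennreal (profile_cutoff n c0 x) * G x \<partial>mm)"
    if [measurable]: "G \<in> borel_measurable borel" for G
    unfolding f_def by (rule pairing_profile_cutoff) measurable
  show ?thesis
  proof (rule that[of n f])
    show "1 \<le> real n" using n by simp
    show "dominated (real n) f" unfolding f_def by (rule dominated_profile_cutoff) measurable
    have "(\<integral>\<^sup>+x. ennreal (profile_cutoff n c0 x) \<partial>mm) \<le> (\<integral>\<^sup>+x. ennreal (c0 x) \<partial>mm)"
      by (intro nn_integral_mono ennreal_leI) (simp add: profile_cutoff_def)
    then show "mass f \<le> 1" using pairing_f[of "\<lambda>_. 1"] nn_integral_Dm[OF c0] by simp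
    fix G :: "real \<Rightarrow> ennreal" assume [measurable]: "G \<in> borel_measurable borel" and G: "\<And>y. G y \<le> 1"
    have "(\<integral>\<^sup>+x. ennreal (c0 x) * G x \<partial>mm) =
        (\<integral>\<^sup>+x. (ennreal (c0 x) - ennreal (profile_cutoff n c0 x)) * G x \<partial>mm) + \<langle>f, G\<rangle>"
      unfolding pairing_f[OF \<open>G \<in> borel_measurable borel\<close>]
      by (intro nn_integral_diff_add) (auto simp: profile_cutoff_def ennreal_leI)
    also have "\<dots> \<le> ennreal e + \<langle>f, G\<rangle>"
      by (intro add_right_mono order_trans[OF nn_integral_mult_le_of_le_1[OF G] n(2)])
    finally show "(\<integral>\<^sup>+x. ennreal (c0 x) * G x \<partial>mm) \<le> \<langle>f, G\<rangle> + ennreal e" by (simp add: add.commute)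
  qed
qed

lemma frag_solution_le_self_similar:
  assumes c0: "c0 \<in> Dm" and sol: "frag_solution \<alpha> h c0 c" and e: "0 < e"
  obtains T where "0 \<le> T" "\<And>t B. T \<le> t \<Longrightarrow> B \<in> sets borel \<Longrightarrow>
    (\<integral>\<^sup>+x. ennreal (c t x) * indicator B x \<partial>mm) \<le>
    (\<integral>\<^sup>+x. ennreal (self_similar profile t x) * indicator B x \<partial>mm) + ennreal (2 * e)"
proof -
  obtain n f where n: "1 \<le> real n" and f: "dominated (real n) f" "mass f \<le> 1"
    and approx: "\<And>G. G \<in> borel_measurable borel \<Longrightarrow> (\<And>y. G y \<le> 1) \<Longrightarrow>
      (\<integral>\<^sup>+x. ennreal (c0 x) * G x \<partial>mm) \<le> \<langle>f, G\<rangle> + ennreal e"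
    by (rule exists_dominated_approximation[OF c0 e]) iprover
  obtain k where contract: "\<And>f1 f2 F. dominated (real n) f1 \<Longrightarrow> dominated (real n) f2 \<Longrightarrow> mass f1 = mass f2 \<Longrightarrow>
      mass f1 \<le> 1 \<Longrightarrow> F \<in> borel_measurable borel \<Longrightarrow> (\<And>y. F y \<le> 1) \<Longrightarrow>
      \<langle>f1, (renorm ^^ k) F\<rangle> \<le> \<langle>f2, (renorm ^^ k) F\<rangle> + ennreal e"
    by (rule contraction[of "real n" e]) (use n e in auto)
  show ?thesis
  proof (rule that[of "2 ^ k - 1"])
    show "(0::real) \<le> 2 ^ k - 1" by simp
    fix t :: real and B :: "real set" assume t: "2 ^ k - 1 \<le> t" and [measurable]: "B \<in> sets borel"
    have "(1::real) \<le> 2 ^ k" by simp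
    then have t0: "0 \<le> t" using t by linarith
    define F where "F y = transition (t - (2 ^ k - 1)) (indicator B) (y / renorm_scale ^ k)" for y
    have [measurable]: "F \<in> borel_measurable borel" unfolding F_def[abs_def] by measurable
    have F_le_1: "F y \<le> 1" for y unfolding F_def by (rule transition_le_1) (simp add: indicator_def)
    have evolve: "(\<integral>\<^sup>+x. ennreal (u x) * (renorm ^^ k) F x \<partial>mm) =
        (\<integral>\<^sup>+x. ennreal (u x) * transition t (indicator B) x \<partial>mm)" for u
      unfolding F_def[abs_def] using AE_mm_pos t
      by (intro nn_integral_cong_AE) (auto elim!: eventually_mono simp: renorm_pow_transition indicator_def)
    have "(\<integral>\<^sup>+x. ennreal (c t x) * indicator B x \<partial>mm) = (\<integral>\<^sup>+x. ennreal (c0 x) * (renorm ^^ k) F x \<partial>mm)"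
      unfolding evolve by (rule frag_solution_nn_integral[OF sol c0 t0]) measurable
    also have "\<dots> \<le> \<langle>f, (renorm ^^ k) F\<rangle> + ennreal e"
      by (intro approx renorm_pow_le_1 F_le_1) measurable
    also have "\<langle>f, (renorm ^^ k) F\<rangle> \<le> \<langle>\<lambda>_. mass f, (renorm ^^ k) F\<rangle> + ennreal e"
    proof (intro contract f F_le_1)
      show "dominated (real n) (\<lambda>_. mass f)" using f(2) n by (intro dominatedI) (auto intro: order_trans)
    qed auto
    also have "\<langle>\<lambda>_. mass f, (renorm ^^ k) F\<rangle> \<le> mass ((renorm ^^ k) F)"
      using f(2) by (intro nn_integral_mono) (metis mult_1 mult_right_mono zero_le)
    also have "mass ((renorm ^^ k) F) = (\<integral>\<^sup>+x. ennreal (self_similar profile t x) * indicator B x \<partial>mm)"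
      by (simp add: nn_integral_profile_law evolve nn_integral_profile_transition t0)
    finally show "(\<integral>\<^sup>+x. ennreal (c t x) * indicator B x \<partial>mm) \<le>
        (\<integral>\<^sup>+x. ennreal (self_similar profile t x) * indicator B x \<partial>mm) + ennreal (2 * e)"
      using e by (simp add: add.assoc add_right_mono flip: ennreal_plus)
  qed
qed

theorem convergence_to_self_similar:
  assumes c0: "c0 \<in> Dm" and sol: "frag_solution \<alpha> h c0 c"
  shows "((\<lambda>t. \<integral>x. \<bar>c t x - self_similar profile t x\<bar> \<partial>mm) \<longlongrightarrow> 0) at_top"
proof (rule tendstoI)
  fix \<epsilon> :: real assume \<epsilon>: "0 < \<epsilon>"
  obtain T where T: "0 \<le> T" and le: "\<And>t B. T \<le> t \<Longrightarrow> B \<in> sets borel \<Longrightarrow>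
      (\<integral>\<^sup>+x. ennreal (c t x) * indicator B x \<partial>mm) \<le>
      (\<integral>\<^sup>+x. ennreal (self_similar profile t x) * indicator B x \<partial>mm) + ennreal (2 * (\<epsilon> / 8))"
    by (rule frag_solution_le_self_similar[OF c0 sol, of "\<epsilon> / 8"]) (use \<epsilon> in auto)
  have "\<forall>\<^sub>F t in at_top. T \<le> t" by (rule eventually_ge_at_top)
  then show "\<forall>\<^sub>F t in at_top. dist (\<integral>x. \<bar>c t x - self_similar profile t x\<bar> \<partial>mm) 0 < \<epsilon>"
  proof eventually_elim
    case (elim t)
    have ct: "c t \<in> Dm" using sol T elim by (auto simp: frag_solution_def)
    note [measurable] = measurable_Dm[OF ct]
    have "(\<integral>x. \<bar>c t x - self_similar profile t x\<bar> \<partial>mm) \<le> 2 * (2 * (\<epsilon> / 8))"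
      using \<epsilon> T elim by (intro integral_abs_diff_Dm_le ct self_similar_profile_Dm le) auto
    moreover have "0 \<le> (\<integral>x. \<bar>c t x - self_similar profile t x\<bar> \<partial>mm)" by simp
    ultimately show ?case using \<epsilon> by simp
  qed
qed

end

theorem theorem1p1:
  fixes \<alpha> :: real and h :: "real \<Rightarrow> real"
  assumes "\<alpha> > 0"
    and "set_borel_measurable borel {0<..<1} h"
    and "\<forall>r\<in>{0<..<1}. 0 \<le> h r"
    and "(\<integral>\<^sup>+ r\<in>{0<..<1}. ennreal (h r * r) \<partial>lborel) = 1"
  shows "(\<exists>u\<in>Dm.
            (\<forall>t\<ge>0. (\<lambda>x. ((1 + t) powr (1 / \<alpha>))\<^sup>2 * u ((1 + t) powr (1 / \<alpha>) * x)) \<in> Dm) \<and>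
            frag_solution \<alpha> h u (\<lambda>t x. ((1 + t) powr (1 / \<alpha>))\<^sup>2 * u ((1 + t) powr (1 / \<alpha>) * x)) \<and>
            (\<forall>c0\<in>Dm. \<forall>c. frag_solution \<alpha> h c0 c \<longrightarrow>
               ((\<lambda>t. \<integral>x. \<bar>c t x - ((1 + t) powr (1 / \<alpha>))\<^sup>2 * u ((1 + t) powr (1 / \<alpha>) * x)\<bar> \<partial>mm)
                  \<longlongrightarrow> 0) at_top))
         \<longleftrightarrow> (\<integral>\<^sup>+ z\<in>{0<..<1}. ennreal (- ln z * h z * z) \<partial>lborel) < \<infinity>"
proof -
  interpret fragmentation \<alpha> h by standard fact+
  have self_similar: "(\<lambda>x. ((1 + t) powr (1 / \<alpha>))\<^sup>2 * u ((1 + t) powr (1 / \<alpha>) * x)) = self_similar u t" for u t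
    by (simp add: self_similar_def fun_eq_iff)
  show ?thesis
    unfolding log_moment_eq[symmetric] self_similar fun_cong[OF self_similar]
  proof
    assume "log_moment < \<infinity>"
    then interpret fragmentation_log_moment \<alpha> h by unfold_locales
    show "\<exists>u\<in>Dm. (\<forall>t\<ge>0. self_similar u t \<in> Dm) \<and> frag_solution \<alpha> h u (self_similar u) \<and>
        (\<forall>c0\<in>Dm. \<forall>c. frag_solution \<alpha> h c0 c \<longrightarrow> ((\<lambda>t. \<integral>x. \<bar>c t x - self_similar u t x\<bar> \<partial>mm) \<longlongrightarrow> 0) at_top)"
      using profile_Dm self_similar_profile_Dm frag_solution_self_similar_profile convergence_to_self_similar by blast
  qed (use log_moment_finite_of_self_similar in blast)
qed

end
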